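(* Fix the domain $[n]^d$, let $\epsilon>0$, let $p\ge1$ and let $\mathsf{dist}$ be the normalized $\ell_p$ metric on $[n]^d$. Let $\Delta\le\frac{1}{8d^{1/p}}\epsilon$. Then there is a $(\mathsf{CONN},\mathsf{CONN},\Delta)$-diameter-guarded $\epsilon$-tester for equivalence of distributions under $\mathsf{EMD}_{\mathsf{dist}}$ using at most $m(\epsilon)=2^{O(d)}\cdot\widetilde O\!\left(\epsilon^{-\max\{2,\frac{2d}{3}\}}\right)$ samples and $q(\epsilon)=O(d\epsilon^{d-2}n^{d-1})$ queries, and there is a $(\mathsf{CONN},\mathsf{CONN},\Delta)$-diameter-guarded $\epsilon$-tester for identity under $\mathsf{EMD}_{\mathsf{dist}}$ using at most $O(m(\epsilon))$ samples and $O(m(\epsilon)+q(\epsilon))$ queries. Here $\widetilde O(\cdot)$ hides polylogarithmic factors in $1/\epsilon$.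
   Context: The normalized $\ell_p$ metric on $[n]^d$ is $\mathsf{dist}(x,y)=\|x-y\|_p/(d^{1/p}n)$. For distributions $\mu,\nu$, $\mathsf{EMD}_{\mathsf{dist}}(\mu,\nu)=\inf_\pi\mathbb{E}_{(x,y)\sim\pi}[\mathsf{dist}(x,y)]$ over couplings $\pi$ of $\mu,\nu$. A clustering of a domain $\mathcal X$ is a pair $(\Gamma,\mathsf{rep})$ where $\Gamma=\{\Gamma_1,\dots,\Gamma_k\}$ partitions $\mathcal X$ into cells and $\mathsf{rep}(i)\in\Gamma_i$; $\gamma(x)$ is the index of the cell containing $x$. For a distribution $\mu$ the clustered-sample oracle returns independent samples $\mathsf{rep}(\gamma(x))$, $x\sim\mu$; the label oracle on query $x$ returns $\mathsf{rep}(\gamma(x))$. Samples are calls to clustered-sample oracles, queries are calls to the label oracle. $\mathsf{CONN}$ is the class of clusterings of $[n]^d$ each of whose cells is connected in the grid graph on $[n]^d$ (edges between $x,y$ with $\|x-y\|_1=1$). Let $c=\frac{1}{384\ln 24}$. For a universe $\mathcal U$ of clusterings, a subclass $\mathcal G\subseteq\mathcal U$ and $\Delta>0$: an algorithm is a $(\mathcal U,\mathcal G,\Delta)$-diameter-guarded $\epsilon$-tester for identity (with known target $\nu$) if it outputs ACCEPT, REJECT or CLUSTER-REJECT and, for every input $((\Gamma,\mathsf{rep}),\mu)$ with $(\Gamma,\mathsf{rep})\in\mathcal U$: (1) if $(\Gamma,\mathsf{rep})\in\mathcal G$ and $\Pr_{x\sim\mu}[\mathrm{diam}_{\mathsf{dist}}(\Gamma_{\gamma(x)})>\Delta]\le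 c\epsilon$, it outputs CLUSTER-REJECT with probability at most $1/6$; (2) if $\mu=\nu$ it outputs ACCEPT or CLUSTER-REJECT with probability at least $5/6$; (3) if $\mathsf{EMD}_{\mathsf{dist}}(\mu,\nu)>\epsilon$ it outputs REJECT or CLUSTER-REJECT with probability at least $5/6$. For equivalence testing there are two unknown distributions $\mu,\nu$, each accessed through its own clustered-sample oracle under the same clustering; condition (1) applies when $(\Gamma,\mathsf{rep})\in\mathcal G$ and both $\mu$ and $\nu$ satisfy the diameter condition, (2) applies when $\mu=\nu$, and (3) when $\mathsf{EMD}_{\mathsf{dist}}(\mu,\nu)>\epsilon$.
   Formalization: The equivalence query bound is proved with max(n, 1/ε) in place of n: the same for ε ≥ 1/n, and O(d/ε) for ε < 1/n, where the stated bound fails (for d = 3, n = 2, ε → 0 it would allow no query). The identity bounds are as stated. *)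

theory Defs
  imports "HOL-Probability.Probability" "HOL-Library.Disjoint_Sets" "HOL-Library.FuncSet"
begin

section \<open>The grid and the earth mover's distance\<close>

definition grid :: "nat \<Rightarrow> nat \<Rightarrow> (nat \<Rightarrow> nat) set" where
  "grid n d = {1..d} \<rightarrow>\<^sub>E {1..n}"

definition lp_dist :: "real \<Rightarrow> nat \<Rightarrow> nat \<Rightarrow> (nat \<Rightarrow> nat) \<Rightarrow> (nat \<Rightarrow> nat) \<Rightarrow> real" where
  "lp_dist p n d x y =
     (\<Sum>i=1..d. \<bar>real (x i) - real (y i)\<bar> powr p) powr (1 / p) / (real d powr (1 / p) * real n)"

definition couplings :: "'a pmf \<Rightarrow> 'a pmf \<Rightarrow> ('a \<times> 'a) pmf set" where
  "couplings \<mu> \<nu> = {\<pi>. map_pmf fst \<pi> = \<mu> \<and> map_pmf snd \<pi> = \<nu>}"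

definition EMD :: "('a \<Rightarrow> 'a \<Rightarrow> real) \<Rightarrow> 'a pmf \<Rightarrow> 'a pmf \<Rightarrow> real" where
  "EMD \<rho> \<mu> \<nu> = (INF \<pi>\<in>couplings \<mu> \<nu>. measure_pmf.expectation \<pi> (\<lambda>(x, y). \<rho> x y))"

definition diam :: "('a \<Rightarrow> 'a \<Rightarrow> real) \<Rightarrow> 'a set \<Rightarrow> real" where
  "diam \<rho> S = (SUP (x, y)\<in>S \<times> S. \<rho> x y)"


section \<open>Clusterings\<close>

text \<open>The cells serve as their own indices: a clustering is a partition \<open>\<Gamma>\<close> together with a map
  \<open>rep\<close> choosing a point of each cell. Values of \<open>rep\<close> on sets that are not cells are irrelevant.\<close>

type_synonym 'a clustering = "'a set set \<times> ('a set \<Rightarrow> 'a)"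

definition clusterings :: "'a set \<Rightarrow> 'a clustering set" where
  "clusterings X = {(\<Gamma>, rep). partition_on X \<Gamma> \<and> (\<forall>A\<in>\<Gamma>. rep A \<in> A)}"

definition cell_of :: "'a clustering \<Rightarrow> 'a \<Rightarrow> 'a set" where
  "cell_of K x = (THE A. A \<in> fst K \<and> x \<in> A)"

definition label :: "'a clustering \<Rightarrow> 'a \<Rightarrow> 'a" where
  "label K x = snd K (cell_of K x)"

definition grid_edges :: "nat \<Rightarrow> nat \<Rightarrow> ((nat \<Rightarrow> nat) \<times> (nat \<Rightarrow> nat)) set" where
  "grid_edges n d = {(x, y). x \<in> grid n d \<and> y \<in> grid n d \<and>
     (\<Sum>i=1..d. \<bar>int (x i) - int (y i)\<bar>) = 1}"

definition grid_connected :: "nat \<Rightarrow> nat \<Rightarrow> (nat \<Rightarrow> nat) set \<Rightarrow> bool" where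
  "grid_connected n d A \<longleftrightarrow> (\<forall>x\<in>A. \<forall>y\<in>A. (x, y) \<in> (grid_edges n d \<inter> A \<times> A)\<^sup>*)"

definition CONN :: "nat \<Rightarrow> nat \<Rightarrow> (nat \<Rightarrow> nat) clustering set" where
  "CONN n d = {K \<in> clusterings (grid n d). \<forall>A\<in>fst K. grid_connected n d A}"


section \<open>Randomized algorithms with oracle access\<close>

datatype verdict = Accept | Reject | Cluster_Reject

text \<open>An adaptive randomized algorithm over points of type \<open>'a\<close>, as a decision tree. \<open>Flip\<close> uses
  internal randomness, \<open>Sample i\<close> calls the clustered-sample oracle of the \<open>i\<close>-th unknown
  distribution and \<open>Query x\<close> calls the label oracle on \<open>x\<close>; the continuation receives the answer.\<close>

datatype ('i, 'a) alg =
    Output verdict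
  | Flip "('i, 'a) alg pmf"
  | Sample 'i "'a \<Rightarrow> ('i, 'a) alg"
  | Query 'a "'a \<Rightarrow> ('i, 'a) alg"

primrec run :: "'a clustering \<Rightarrow> ('i \<Rightarrow> 'a pmf) \<Rightarrow> ('i, 'a) alg \<Rightarrow> verdict pmf" where
  "run K D (Output v) = return_pmf v"
| "run K D (Flip P) = bind_pmf (map_pmf (run K D) P) (\<lambda>R. R)"
| "run K D (Sample i f) = bind_pmf (map_pmf (label K) (D i)) (\<lambda>y. run K D (f y))"
| "run K D (Query x f) = run K D (f (label K x))"

text \<open>\<open>within_budget X T m q\<close>: in every execution \<open>T\<close> makes at most \<open>m\<close> sample calls and at most \<open>q\<close> label
  queries, all of them to points of the domain \<open>X\<close>. The real numbers \<open>m\<close> and \<open>q\<close> are the remaining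
  budgets, which must be nonnegative when the algorithm stops.\<close>

primrec within_budget :: "'a set \<Rightarrow> ('i, 'a) alg \<Rightarrow> real \<Rightarrow> real \<Rightarrow> bool" where
  "within_budget X (Output v) = (\<lambda>m q. 0 \<le> m \<and> 0 \<le> q)"
| "within_budget X (Flip P) = (\<lambda>m q. \<forall>W\<in>set_pmf (map_pmf (within_budget X) P). W m q)"
| "within_budget X (Sample i f) = (\<lambda>m q. \<forall>y\<in>X. within_budget X (f y) (m - 1) q)"
| "within_budget X (Query x f) = (\<lambda>m q. x \<in> X \<and> (\<forall>y\<in>X. within_budget X (f y) m (q - 1)))"


section \<open>Diameter-guarded testers\<close>

definition guard_const :: real where
  "guard_const = 1 / (384 * ln 24)"

definition small_diam ::
  "('a \<Rightarrow> 'a \<Rightarrow> real) \<Rightarrow> real \<Rightarrow> real \<Rightarrow> 'a clustering \<Rightarrow> 'a pmf \<Rightarrow> bool" where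
  "small_diam \<rho> \<Delta> \<epsilon> K \<mu> \<longleftrightarrow>
     measure_pmf.prob \<mu> {x. diam \<rho> (cell_of K x) > \<Delta>} \<le> guard_const * \<epsilon>"

definition identity_tester ::
  "'a set \<Rightarrow> ('a \<Rightarrow> 'a \<Rightarrow> real) \<Rightarrow> 'a clustering set \<Rightarrow> 'a clustering set \<Rightarrow> real \<Rightarrow> real \<Rightarrow> 'a pmf
    \<Rightarrow> (unit, 'a) alg \<Rightarrow> bool" where
  "identity_tester X \<rho> \<U> \<G> \<Delta> \<epsilon> \<nu> T \<longleftrightarrow>
    (\<forall>K\<in>\<U>. \<forall>\<mu>. set_pmf \<mu> \<subseteq> X \<longrightarrow>
      (let Pr = measure_pmf.prob (run K (\<lambda>_. \<mu>) T) in
        (K \<in> \<G> \<and> small_diam \<rho> \<Delta> \<epsilon> K \<mu> \<longrightarrow> Pr {Cluster_Reject} \<le> 1 / 6) \<and>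
        (\<mu> = \<nu> \<longrightarrow> Pr {Accept, Cluster_Reject} \<ge> 5 / 6) \<and>
        (EMD \<rho> \<mu> \<nu> > \<epsilon> \<longrightarrow> Pr {Reject, Cluster_Reject} \<ge> 5 / 6)))"

definition equivalence_tester ::
  "'a set \<Rightarrow> ('a \<Rightarrow> 'a \<Rightarrow> real) \<Rightarrow> 'a clustering set \<Rightarrow> 'a clustering set \<Rightarrow> real \<Rightarrow> real
    \<Rightarrow> (bool, 'a) alg \<Rightarrow> bool" where
  "equivalence_tester X \<rho> \<U> \<G> \<Delta> \<epsilon> T \<longleftrightarrow>
    (\<forall>K\<in>\<U>. \<forall>\<mu> \<nu>. set_pmf \<mu> \<subseteq> X \<and> set_pmf \<nu> \<subseteq> X \<longrightarrow>
      (let Pr = measure_pmf.prob (run K (\<lambda>i. if i then \<mu> else \<nu>) T) in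
        (K \<in> \<G> \<and> small_diam \<rho> \<Delta> \<epsilon> K \<mu> \<and> small_diam \<rho> \<Delta> \<epsilon> K \<nu> \<longrightarrow>
           Pr {Cluster_Reject} \<le> 1 / 6) \<and>
        (\<mu> = \<nu> \<longrightarrow> Pr {Accept, Cluster_Reject} \<ge> 5 / 6) \<and>
        (EMD \<rho> \<mu> \<nu> > \<epsilon> \<longrightarrow> Pr {Reject, Cluster_Reject} \<ge> 5 / 6)))"


section \<open>Complexity bounds\<close>

text \<open>\<open>2\<^bsup>O(d)\<^esup> \<cdot> O~(\<epsilon>\<^bsup>-max{2, 2d/3}\<^esup>)\<close> with explicit constants \<open>a\<close> (in the exponent), \<open>b\<close> (leading
  factor) and \<open>k\<close> (degree of the polylogarithm). The \<open>2 +\<close> keeps the logarithm at least 1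
  for all \<open>\<epsilon> > 0\<close>.\<close>

definition sample_bound :: "real \<Rightarrow> real \<Rightarrow> nat \<Rightarrow> nat \<Rightarrow> real \<Rightarrow> real" where
  "sample_bound a b k d \<epsilon> =
     2 powr (a * real d) * (b * \<epsilon> powr (- max 2 (2 * real d / 3)) * log 2 (2 + 1 / \<epsilon>) ^ k)"

text \<open>The side length \<open>n\<close> is a real number here so that it can be replaced by \<open>max n (1 / \<epsilon>)\<close>.
  For \<open>\<epsilon> \<ge> 1 / n\<close> that is \<open>n\<close> itself. When \<open>\<epsilon>\<close> is below the grid spacing, the bound
  \<open>O(d \<epsilon>\<^bsup>d-2\<^esup> n\<^bsup>d-1\<^esup>)\<close> cannot hold for equivalence testing: if \<open>d \<ge> 3\<close> and \<open>n = 2\<close>, it tends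
  to 0 with \<open>\<epsilon>\<close>, but without queries the one-cell clustering cannot be told apart from point
  masses under the clustering into singletons.\<close>

definition query_bound :: "real \<Rightarrow> real \<Rightarrow> nat \<Rightarrow> real \<Rightarrow> real" where
  "query_bound C n d \<epsilon> = C * (real d * \<epsilon> powr (real d - 2) * n ^ (d - 1))"

end

theory Submission
  imports Defs
begin

text \<open>Two ideas reduce the problem to testing closeness of distributions on finite sets.

First, if a cell containing the sampled representative \<open>y\<close> is connected and not contained in the
\<open>\<ell>\<^sub>\<infinity>\<close> ball of radius \<open>r = \<lfloor>\<epsilon>n/8\<rfloor>\<close> around \<open>y\<close>, then it meets the shell of
points with exactly one coordinate at distance \<open>r + 1\<close> from \<open>y\<close> and all others within \<open>r\<close>. Querying the
\<open>2d(2r + 1)\<^bsup>d-1\<^esup>\<close> shell points of \<open>O(1/\<epsilon>)\<close> samples thus estimates the mass of large cells, and if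
that mass is small, replacing points by their representatives hardly changes the earth mover's distance.

Second, for the dyadic subdivisions of the grid into \<open>2\<^bsup>id\<^esup>\<close> boxes there is a single coupling that attains,
at every level \<open>i\<close> simultaneously, the total variation distance of the induced distributions. Hence two
distributions that are far apart in earth mover's distance differ in \<open>\<ell>\<^sub>1\<close> by about
\<open>\<epsilon>2\<^bsup>i\<^esup>/log(1/\<epsilon>)\<close> at some level \<open>i\<close>. Each level is tested by a collision statistic in
which cell \<open>c\<close> carries weight \<open>1/(1 + #c)\<close>, where \<open>#c\<close> counts occurrences of \<open>c\<close> in an independent
sample: this deterministic form of splitting heavy cells makes the variance small. Chebyshev's
inequality with failure probability \<open>O(1/log(1/\<epsilon>))\<close> per level costs only polylogarithmic factors.

For identity testing, samples of the known distribution are simulated by one label query each. The two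
estimates of the mass of large cells use thresholds a constant factor apart, so that when the
distributions agree, passing the first and failing the second is unlikely; the second may therefore
answer \<open>Reject\<close>.\<close>

section \<open>Finitely supported distributions and iid samples\<close>

abbreviation expct :: "'a pmf \<Rightarrow> ('a \<Rightarrow> real) \<Rightarrow> real" where
  "expct \<equiv> measure_pmf.expectation"

abbreviation prb :: "'a pmf \<Rightarrow> 'a set \<Rightarrow> real" where
  "prb \<equiv> measure_pmf.prob"

lemma expct_finite: "finite (set_pmf p) \<Longrightarrow> expct p f = (\<Sum>a\<in>set_pmf p. pmf p a * f a)"
  by (subst integral_measure_pmf[of "set_pmf p"]) auto

lemma expct_superset:
  "finite A \<Longrightarrow> set_pmf p \<subseteq> A \<Longrightarrow> expct p f = (\<Sum>a\<in>A. pmf p a * f a)"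
  by (subst integral_measure_pmf[of A]) auto

lemma expct_add:
  "finite (set_pmf p) \<Longrightarrow> expct p (\<lambda>x. f x + g x) = expct p f + expct p g"
  by (simp add: expct_finite distrib_left sum.distrib)

lemma expct_diff:
  "finite (set_pmf p) \<Longrightarrow> expct p (\<lambda>x. f x - g x) = expct p f - expct p g"
  by (simp add: expct_finite right_diff_distrib sum_subtractf)

lemma expct_sum:
  "finite (set_pmf p) \<Longrightarrow> expct p (\<lambda>x. \<Sum>i\<in>I. f i x) = (\<Sum>i\<in>I. expct p (f i))"
  by (simp add: expct_finite sum_distrib_left sum.swap[of _ I])

lemma expct_mono:
  "finite (set_pmf p) \<Longrightarrow> (\<And>x. x \<in> set_pmf p \<Longrightarrow> f x \<le> g x) \<Longrightarrow> expct p f \<le> expct p g"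
  by (auto simp: expct_finite intro!: sum_mono mult_left_mono)

lemma expct_bind:
  "finite (set_pmf p) \<Longrightarrow> (\<And>x. x \<in> set_pmf p \<Longrightarrow> finite (set_pmf (f x))) \<Longrightarrow>
    expct (bind_pmf p f) g = expct p (\<lambda>x. expct (f x) g)"
  by (subst pmf_expectation_bind[where A = "set_pmf p"]) (auto simp: expct_finite)

lemma expct_pair_mult:
  assumes "finite (set_pmf p)" "finite (set_pmf q)"
  shows "expct (pair_pmf p q) (\<lambda>z. f (fst z) * g (snd z)) = expct p f * expct q g"
  unfolding pair_pmf_def using assms by (simp add: expct_bind)

section \<open>Markov's and Chebyshev's inequalities\<close>

lemma markov_pmf:
  assumes "finite (set_pmf p)" "\<And>x. x \<in> set_pmf p \<Longrightarrow> 0 \<le> f x" "0 < c"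
  shows "prb p {x. c \<le> f x} \<le> expct p f / c"
proof -
  have "c * prb p {x. c \<le> f x} = expct p (\<lambda>x. c * indicator {x. c \<le> f x} x)"
    by simp
  also have "\<dots> \<le> expct p f"
    using assms by (intro expct_mono) (auto simp: indicator_def)
  finally show ?thesis using assms(3) by (simp add: field_simps)
qed

lemma chebyshev_pmf:
  assumes "finite (set_pmf p)" "expct p f = e" "expct p (\<lambda>x. (f x)\<^sup>2) \<le> e\<^sup>2 + v" "0 < a"
  shows "prb p {x. a \<le> \<bar>f x - e\<bar>} \<le> v / a\<^sup>2"
proof -
  have "{x. a \<le> \<bar>f x - e\<bar>} = {x. a\<^sup>2 \<le> (f x - e)\<^sup>2}"
    using assms(4) by (auto simp: abs_le_square_iff[symmetric])
  hence "prb p {x. a \<le> \<bar>f x - e\<bar>} \<le> expct p (\<lambda>x. (f x - e)\<^sup>2) / a\<^sup>2"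
    using assms by (simp only:) (intro markov_pmf, auto)
  also have "expct p (\<lambda>x. (f x - e)\<^sup>2) = expct p (\<lambda>x. (f x)\<^sup>2 - 2 * e * f x + e\<^sup>2)"
    by (simp add: power2_diff algebra_simps)
  also have "\<dots> = expct p (\<lambda>x. (f x)\<^sup>2) - 2 * e * expct p f + e\<^sup>2"
    using assms(1) by (simp add: expct_add expct_diff)
  also have "\<dots> \<le> v" using assms(2,3) by (simp add: power2_eq_square)
  finally show ?thesis by (simp add: divide_right_mono)
qed

section \<open>Moments of sums and counts over independent samples\<close>

lemma finite_set_replicate_pmf:
  assumes "finite (set_pmf p)"
  shows "finite (set_pmf (replicate_pmf m p))"
  using finite_lists_length_eq[OF assms, of m]
  by (rule rev_finite_subset) (auto simp: set_replicate_pmf)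

lemma expct_replicate_Suc:
  assumes "finite (set_pmf p)"
  shows "expct (replicate_pmf (Suc m) p) F
    = expct p (\<lambda>z. expct (replicate_pmf m p) (\<lambda>zs. F (z # zs)))"
  using assms by (simp add: expct_bind finite_set_replicate_pmf)

lemma expct_replicate_sum:
  assumes "finite (set_pmf p)"
  shows "expct (replicate_pmf m p) (\<lambda>zs. \<Sum>z\<leftarrow>zs. f z) = real m * expct p f"
proof (induction m)
  case (Suc m)
  then show ?case
    using assms unfolding expct_replicate_Suc[OF assms]
    by (simp add: expct_add finite_set_replicate_pmf algebra_simps)
qed simp

text \<open>Of the \<open>m * m\<close> products of a value of \<open>f\<close> with a value of
  \<open>g\<close>, the \<open>m\<close> diagonal ones involve a single sample; the other
  \<open>m * (m - 1)\<close> factorise by independence.\<close>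

lemma expct_replicate_sum_mult:
  assumes "finite (set_pmf p)"
  shows "expct (replicate_pmf m p) (\<lambda>zs. (\<Sum>z\<leftarrow>zs. f z) * (\<Sum>z\<leftarrow>zs. g z))
    = real m * expct p (\<lambda>z. f z * g z) + real m * (real m - 1) * (expct p f * expct p g)"
proof (induction m)
  case (Suc m)
  note [simp] = finite_set_replicate_pmf[OF assms] expct_replicate_sum[OF assms]
  have "expct (replicate_pmf (Suc m) p) (\<lambda>zs. (\<Sum>z\<leftarrow>zs. f z) * (\<Sum>z\<leftarrow>zs. g z))
    = expct p (\<lambda>z. expct (replicate_pmf m p) (\<lambda>zs. f z * g z + f z * (\<Sum>z\<leftarrow>zs. g z)
        + g z * (\<Sum>z\<leftarrow>zs. f z) + (\<Sum>z\<leftarrow>zs. f z) * (\<Sum>z\<leftarrow>zs. g z)))"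
    unfolding expct_replicate_Suc[OF assms] by (simp add: algebra_simps)
  also have "\<dots> = expct p (\<lambda>z. f z * g z) + expct p f * (real m * expct p g)
      + expct p g * (real m * expct p f)
      + (real m * expct p (\<lambda>z. f z * g z) + real m * (real m - 1) * (expct p f * expct p g))"
    using assms by (simp add: expct_add Suc)
  finally show ?case by (simp add: algebra_simps)
qed simp

text \<open>Size biasing of the binomial count: the factor \<open>length (filter A zs)\<close> marks
  one of the \<open>k + 1\<close> samples as satisfying \<open>A\<close>, and the other
  \<open>k\<close> are independent of it. The induction peels off the first sample; \<open>G\<close>
  is arbitrary because the shifted function occurs as well.\<close>

lemma expct_count_size_bias:
  fixes G :: "nat \<Rightarrow> real"
  assumes "finite (set_pmf p)"
  shows "expct (replicate_pmf (Suc k) p)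
      (\<lambda>zs. real (length (filter A zs)) * G (length (filter A zs)))
    = real (Suc k) * prb p {z. A z}
      * expct (replicate_pmf k p) (\<lambda>zs. G (Suc (length (filter A zs))))"
proof (induction k arbitrary: G)
  case 0
  have "expct (replicate_pmf (Suc 0) p) (\<lambda>zs. real (length (filter A zs)) * G (length (filter A zs)))
    = expct p (\<lambda>z. G 1 * indicator {z. A z} z)"
    unfolding expct_replicate_Suc[OF assms]
    by (intro arg_cong[of _ _ "expct p"]) (auto simp: indicator_def)
  then show ?case by simp
next
  case (Suc k)
  note fin = finite_set_replicate_pmf[OF assms]
  let ?X = "\<lambda>zs. length (filter A zs)" and ?R = "\<lambda>k. replicate_pmf k p"
  let ?P = "prb p {z. A z}"
  \<comment> \<open>Conditioning on whether the first sample satisfies \<open>A\<close>.\<close>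
  have split: "expct (?R (Suc k)) (\<lambda>zs. H (?X zs))
    = ?P * expct (?R k) (\<lambda>zs. H (Suc (?X zs))) + (1 - ?P) * expct (?R k) (\<lambda>zs. H (?X zs))"
    for k and H :: "nat \<Rightarrow> real"
  proof -
    have "expct (?R (Suc k)) (\<lambda>zs. H (?X zs))
      = expct p (\<lambda>z. indicator {z. A z} z * expct (?R k) (\<lambda>zs. H (Suc (?X zs)))
          + (1 - indicator {z. A z} z) * expct (?R k) (\<lambda>zs. H (?X zs)))"
      unfolding expct_replicate_Suc[OF assms]
      by (intro arg_cong[of _ _ "expct p"]) (auto simp: indicator_def)
    also have "\<dots> = ?P * expct (?R k) (\<lambda>zs. H (Suc (?X zs))) + (1 - ?P) * expct (?R k) (\<lambda>zs. H (?X zs))"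
      using assms by (simp add: expct_add expct_diff)
    finally show ?thesis .
  qed
  have "expct (?R (Suc (Suc k))) (\<lambda>zs. real (?X zs) * G (?X zs))
    = ?P * expct (?R (Suc k)) (\<lambda>zs. real (Suc (?X zs)) * G (Suc (?X zs)))
      + (1 - ?P) * expct (?R (Suc k)) (\<lambda>zs. real (?X zs) * G (?X zs))"
    by (rule split)
  also have "expct (?R (Suc k)) (\<lambda>zs. real (Suc (?X zs)) * G (Suc (?X zs)))
    = expct (?R (Suc k)) (\<lambda>zs. real (?X zs) * G (Suc (?X zs)))
      + expct (?R (Suc k)) (\<lambda>zs. G (Suc (?X zs)))"
    by (subst expct_add[OF fin, symmetric]) (simp add: algebra_simps)
  also have "expct (?R (Suc k)) (\<lambda>zs. real (?X zs) * G (Suc (?X zs)))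
    = real (Suc k) * ?P * expct (?R k) (\<lambda>zs. G (Suc (Suc (?X zs))))"
    by (rule Suc.IH[where G = "\<lambda>j. G (Suc j)"])
  also have "expct (?R (Suc k)) (\<lambda>zs. real (?X zs) * G (?X zs))
    = real (Suc k) * ?P * expct (?R k) (\<lambda>zs. G (Suc (?X zs)))"
    by (rule Suc.IH)
  also have "?P * (real (Suc k) * ?P * expct (?R k) (\<lambda>zs. G (Suc (Suc (?X zs))))
        + expct (?R (Suc k)) (\<lambda>zs. G (Suc (?X zs))))
      + (1 - ?P) * (real (Suc k) * ?P * expct (?R k) (\<lambda>zs. G (Suc (?X zs))))
    = real (Suc k) * ?P * (?P * expct (?R k) (\<lambda>zs. G (Suc (Suc (?X zs))))
         + (1 - ?P) * expct (?R k) (\<lambda>zs. G (Suc (?X zs))))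
      + ?P * expct (?R (Suc k)) (\<lambda>zs. G (Suc (?X zs)))"
    by (simp only: algebra_simps)
  also have "\<dots> = real (Suc k) * ?P * expct (?R (Suc k)) (\<lambda>zs. G (Suc (?X zs)))
      + ?P * expct (?R (Suc k)) (\<lambda>zs. G (Suc (?X zs)))"
    by (simp only: split[of k "\<lambda>j. G (Suc j)"])
  finally show ?case by (simp add: algebra_simps)
qed

text \<open>Size biasing with \<open>G j = 1 / j\<close>: the product \<open>j * G j\<close> is 1
  for \<open>j > 0\<close>, and it is 0 for \<open>j = 0\<close> by the convention on division by
  zero.\<close>

lemma expct_inverse_count:
  assumes "finite (set_pmf p)"
  shows "prb p {z. A z} * expct (replicate_pmf k p) (\<lambda>zs. 1 / real (Suc (length (filter A zs))))
    \<le> 1 / real (Suc k)"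
proof -
  have "real (Suc k) * prb p {z. A z}
      * expct (replicate_pmf k p) (\<lambda>zs. 1 / real (Suc (length (filter A zs))))
    = expct (replicate_pmf (Suc k) p)
      (\<lambda>zs. real (length (filter A zs)) * (1 / real (length (filter A zs))))"
    by (rule expct_count_size_bias[OF assms, where G = "\<lambda>j. 1 / real j", symmetric])
  also have "\<dots> \<le> expct (replicate_pmf (Suc k) p) (\<lambda>_. 1)"
    by (intro expct_mono finite_set_replicate_pmf assms) auto
  also have "\<dots> = 1" by simp
  finally show ?thesis by (simp add: field_simps)
qed

section \<open>Testing closeness in total variation\<close>

definition diff_count :: "'c \<Rightarrow> ('c \<times> 'c) list \<Rightarrow> real" where
  "diff_count c zs = (\<Sum>z\<leftarrow>zs. of_bool (fst z = c) - of_bool (snd z = c))"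

text \<open>Counting both components damps cells that are heavy under either distribution; the
  summand 1 caps the weight at 1 where nothing was counted.\<close>

definition weight :: "('c \<times> 'c) list \<Rightarrow> 'c \<Rightarrow> real" where
  "weight ws c = 1 / (1 + real (length (filter (\<lambda>z. fst z = c) ws))
     + real (length (filter (\<lambda>z. snd z = c) ws)))"

text \<open>Counts from two blocks are multiplied instead of squaring one count. With independent
  blocks of length \<open>m\<close> the mean is then \<open>m^2\<close> times the weighted squared
  difference, without a diagonal correction.\<close>

definition collision_stat :: "'c set \<Rightarrow> ('c \<Rightarrow> real) \<Rightarrow> ('c \<times> 'c) list \<Rightarrow> ('c \<times> 'c) list \<Rightarrow> real" where
  "collision_stat I w zs zs' = (\<Sum>c\<in>I. w c * (diff_count c zs * diff_count c zs'))"

text \<open>Cauchy-Schwarz for the inner product with weight \<open>w\<close>: each factor receives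
  \<open>sqrt (w c)\<close>.\<close>

lemma sum_mult_le_sqrt:
  fixes w f g :: "'c \<Rightarrow> real"
  assumes "\<And>c. c \<in> I \<Longrightarrow> 0 \<le> w c"
  shows "(\<Sum>c\<in>I. w c * f c * g c)\<^sup>2 \<le> (\<Sum>c\<in>I. w c * (f c)\<^sup>2) * (\<Sum>c\<in>I. w c * (g c)\<^sup>2)"
proof -
  have "(\<Sum>c\<in>I. w c * f c * g c)\<^sup>2 = (\<Sum>c\<in>I. (sqrt (w c) * f c) * (sqrt (w c) * g c))\<^sup>2"
    using assms by (intro arg_cong[of _ _ "\<lambda>x. x\<^sup>2"] sum.cong refl)
      (metis mult.assoc mult.left_commute real_sqrt_mult_self abs_of_nonneg)
  also have "\<dots> \<le> (\<Sum>c\<in>I. (sqrt (w c) * f c)\<^sup>2) * (\<Sum>c\<in>I. (sqrt (w c) * g c)\<^sup>2)"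
    by (rule Cauchy_Schwarz_ineq_sum)
  also have "\<dots> = (\<Sum>c\<in>I. w c * (f c)\<^sup>2) * (\<Sum>c\<in>I. w c * (g c)\<^sup>2)"
    using assms by (simp add: power_mult_distrib)
  finally show ?thesis .
qed

text \<open>The matrix \<open>(if c = l then p c + q c else 0) - p c * q l - q c * p l\<close> is
  the second moment matrix of the signed indicators of one sample pair, see
  \<open>expct_diff_indicator_mult\<close>. Its weighted sum of squares and its quadratic form at
  \<open>p - q\<close> are the two terms that make up the variance of the collision
  statistic.\<close>

lemma weighted_mass_bounds:
  fixes w p q :: "'c \<Rightarrow> real"
  assumes fin: "finite I"
    and w: "\<And>c. c \<in> I \<Longrightarrow> 0 \<le> w c" "\<And>c. c \<in> I \<Longrightarrow> w c \<le> 1"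
    and p: "\<And>c. c \<in> I \<Longrightarrow> 0 \<le> p c" "sum p I = 1"
    and q: "\<And>c. c \<in> I \<Longrightarrow> 0 \<le> q c" "sum q I = 1"
  defines "B \<equiv> (\<Sum>c\<in>I. w c * (p c + q c)\<^sup>2)"
    and "E \<equiv> (\<Sum>c\<in>I. w c * (p c - q c)\<^sup>2)"
  shows "0 \<le> B" "B \<le> 4"
    and "(\<Sum>c\<in>I. \<Sum>l\<in>I. w c * w l *
        ((if c = l then p c + q c else 0) - p c * q l - q c * p l)\<^sup>2) \<le> 10 * B"
    and "(\<Sum>c\<in>I. \<Sum>l\<in>I. w c * w l *
        (((if c = l then p c + q c else 0) - p c * q l - q c * p l)
          * ((p c - q c) * (p l - q l)))) \<le> 3 * sqrt B * E"
proof -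
  have ple: "p c \<le> 1" if "c \<in> I" for c
    using member_le_sum[of c I p] that p fin by auto
  have qle: "q c \<le> 1" if "c \<in> I" for c
    using member_le_sum[of c I q] that q fin by auto
  have pq: "p c + q c \<le> 2" "0 \<le> p c + q c" if "c \<in> I" for c
    using ple qle that p(1) q(1) by force+
  show B0: "0 \<le> B"
    unfolding B_def by (intro sum_nonneg mult_nonneg_nonneg w) auto
  have E0: "0 \<le> E"
    unfolding E_def by (intro sum_nonneg mult_nonneg_nonneg w) auto
  have "B \<le> (\<Sum>c\<in>I. 1 * (2 * (p c + q c)))"
    unfolding B_def power2_eq_square
    by (intro sum_mono mult_mono mult_right_mono w pq) (auto simp: pq)
  also have "\<dots> = 4" by (simp add: sum.distrib p q flip: sum_distrib_left)
  finally show B4: "B \<le> 4" .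
  have sB: "sqrt B \<le> 2" using B4 real_sqrt_le_mono[of B 4] by simp
  have BsB: "B \<le> 2 * sqrt B"
  proof -
    have "B = sqrt B * sqrt B" using B0 by simp
    also have "\<dots> \<le> 2 * sqrt B" using sB B0 by (intro mult_right_mono) auto
    finally show ?thesis .
  qed
  define U where "U = (\<Sum>c\<in>I. w c * (p c)\<^sup>2)"
  define V where "V = (\<Sum>c\<in>I. w c * (q c)\<^sup>2)"
  have U0: "0 \<le> U" and V0: "0 \<le> V"
    unfolding U_def V_def by (intro sum_nonneg mult_nonneg_nonneg w; simp)+
  have UV: "U + V \<le> B"
    unfolding U_def V_def B_def sum.distrib[symmetric]
    using p(1) q(1) w(1)
    by (intro sum_mono) (simp add: power2_sum algebra_simps)
  have UVB: "4 * (U * V) \<le> B\<^sup>2"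
  proof -
    have "4 * (U * V) \<le> (U + V)\<^sup>2" 
      using zero_le_power2[of "U - V"] by (simp add: power2_eq_square algebra_simps)
    also have "\<dots> \<le> B\<^sup>2" using UV U0 V0 by (intro power_mono) auto
    finally show ?thesis .
  qed
  show "(\<Sum>c\<in>I. \<Sum>l\<in>I. w c * w l *
        ((if c = l then p c + q c else 0) - p c * q l - q c * p l)\<^sup>2) \<le> 10 * B"
  proof -
    have "(\<Sum>c\<in>I. \<Sum>l\<in>I. w c * w l *
        ((if c = l then p c + q c else 0) - p c * q l - q c * p l)\<^sup>2)
      \<le> (\<Sum>c\<in>I. \<Sum>l\<in>I. 2 * (if c = l then w c * (p c + q c)\<^sup>2 else 0)
          + (4 * ((w c * (p c)\<^sup>2) * (w l * (q l)\<^sup>2)) + 4 * ((w c * (q c)\<^sup>2) * (w l * (p l)\<^sup>2))))"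
    proof (intro sum_mono)
      fix c l assume cl: "c \<in> I" "l \<in> I"
      let ?D = "if c = l then p c + q c else 0"
      have "(?D - p c * q l - q c * p l)\<^sup>2 \<le> 2 * ?D\<^sup>2 + 4 * (p c * q l)\<^sup>2 + 4 * (q c * p l)\<^sup>2"
      proof -
        \<comment> \<open>The parallelogram inequality twice: first \<open>x\<close> against
          \<open>y + z\<close>, then \<open>y\<close> against \<open>z\<close>.\<close>
        have "(x - y - z)\<^sup>2 \<le> 2 * x\<^sup>2 + 4 * y\<^sup>2 + 4 * z\<^sup>2" for x y z :: real
          using zero_le_power2[of "x + y + z"] zero_le_power2[of "y - z"]
          by (simp add: power2_eq_square algebra_simps)
        thus ?thesis .
      qed
      hence "w c * w l * (?D - p c * q l - q c * p l)\<^sup>2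
          \<le> w c * w l * (2 * ?D\<^sup>2 + 4 * (p c * q l)\<^sup>2 + 4 * (q c * p l)\<^sup>2)"
        using w cl by (intro mult_left_mono) auto
      also have "\<dots> = w c * w l * 2 * ?D\<^sup>2 + (4 * ((w c * (p c)\<^sup>2) * (w l * (q l)\<^sup>2))
          + 4 * ((w c * (q c)\<^sup>2) * (w l * (p l)\<^sup>2)))"
        by (simp add: algebra_simps power_mult_distrib)
      also have "w c * w l * 2 * ?D\<^sup>2 \<le> 2 * (if c = l then w c * (p c + q c)\<^sup>2 else 0)"
      proof (cases "c = l")
        case True
        have "w c * w c \<le> w c * 1" using w cl by (intro mult_left_mono) auto
        hence "w c * w c * (2 * (p c + q c)\<^sup>2) \<le> w c * (2 * (p c + q c)\<^sup>2)"
          by (intro mult_right_mono) auto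
        with True show ?thesis by (simp add: algebra_simps)
      qed simp
      finally show "w c * w l * (?D - p c * q l - q c * p l)\<^sup>2 \<le>
          2 * (if c = l then w c * (p c + q c)\<^sup>2 else 0)
          + (4 * ((w c * (p c)\<^sup>2) * (w l * (q l)\<^sup>2)) + 4 * ((w c * (q c)\<^sup>2) * (w l * (p l)\<^sup>2)))"
        by simp
    qed
    also have "\<dots> = 2 * B + (4 * (U * V) + 4 * (V * U))"
      unfolding sum.distrib sum_distrib_left[symmetric] sum_product B_def U_def V_def
      using fin by simp
    also have "\<dots> \<le> 2 * B + 2 * B\<^sup>2" using UVB by (simp add: mult.commute)
    also have "\<dots> \<le> 10 * B"
      using mult_right_mono[OF B4 B0] by (simp add: power2_eq_square)
    finally show ?thesis .
  qed
  let ?d = "\<lambda>c. p c - q c"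
  show "(\<Sum>c\<in>I. \<Sum>l\<in>I. w c * w l *
        (((if c = l then p c + q c else 0) - p c * q l - q c * p l) * (?d c * ?d l)))
      \<le> 3 * sqrt B * E"
  proof -
    have "(\<Sum>c\<in>I. \<Sum>l\<in>I. w c * w l *
        (((if c = l then p c + q c else 0) - p c * q l - q c * p l) * (?d c * ?d l)))
      = (\<Sum>c\<in>I. \<Sum>l\<in>I. (if c = l then (w c)\<^sup>2 * (p c + q c) * (?d c)\<^sup>2 else 0)
         - (w c * p c * ?d c) * (w l * q l * ?d l) - (w c * q c * ?d c) * (w l * p l * ?d l))"
      by (intro sum.cong refl) (auto simp: algebra_simps power2_eq_square)
    also have "\<dots> = (\<Sum>c\<in>I. (w c)\<^sup>2 * (p c + q c) * (?d c)\<^sup>2)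
        - 2 * ((\<Sum>c\<in>I. w c * p c * ?d c) * (\<Sum>c\<in>I. w c * q c * ?d c))"
      using fin by (simp add: sum_subtractf sum_product[symmetric] mult.commute)
    finally have expand: "(\<Sum>c\<in>I. \<Sum>l\<in>I. w c * w l *
        (((if c = l then p c + q c else 0) - p c * q l - q c * p l) * (?d c * ?d l)))
      = (\<Sum>c\<in>I. (w c)\<^sup>2 * (p c + q c) * (?d c)\<^sup>2)
        - 2 * ((\<Sum>c\<in>I. w c * p c * ?d c) * (\<Sum>c\<in>I. w c * q c * ?d c))" .
    \<comment> \<open>Each \<open>w c * (p c + q c)\<close> is at most \<open>sqrt B\<close>: since
      \<open>w c \<le> 1\<close>, its square is at most the single summand of \<open>B\<close> at
      \<open>c\<close>.\<close>
    have "(\<Sum>c\<in>I. (w c)\<^sup>2 * (p c + q c) * (?d c)\<^sup>2) \<le> (\<Sum>c\<in>I. sqrt B * (w c * (?d c)\<^sup>2))"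
    proof (rule sum_mono)
      fix c assume c: "c \<in> I"
      have "(w c * (p c + q c))\<^sup>2 = w c * (w c * (p c + q c)\<^sup>2)"
        by (simp add: power2_eq_square)
      also have "\<dots> \<le> 1 * (w c * (p c + q c)\<^sup>2)"
        using w c by (intro mult_right_mono) auto
      also have "\<dots> \<le> B"
        unfolding B_def using member_le_sum[of c I "\<lambda>c. w c * (p c + q c)\<^sup>2"] w c fin by auto
      finally have "w c * (p c + q c) \<le> sqrt B"
        by (rule real_le_rsqrt)
      hence "w c * (p c + q c) * (w c * (?d c)\<^sup>2) \<le> sqrt B * (w c * (?d c)\<^sup>2)"
        using w c by (intro mult_right_mono) auto
      thus "(w c)\<^sup>2 * (p c + q c) * (?d c)\<^sup>2 \<le> sqrt B * (w c * (?d c)\<^sup>2)"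
        by (simp add: power2_eq_square algebra_simps)
    qed
    also have "\<dots> = sqrt B * E" by (simp add: E_def sum_distrib_left)
    finally have diag: "(\<Sum>c\<in>I. (w c)\<^sup>2 * (p c + q c) * (?d c)\<^sup>2) \<le> sqrt B * E" .
    \<comment> \<open>By \<open>- 2 * x * y \<le> x^2 + y^2\<close>, followed by weighted
      Cauchy-Schwarz for each square.\<close>
    have off: "- 2 * ((\<Sum>c\<in>I. w c * p c * ?d c) * (\<Sum>c\<in>I. w c * q c * ?d c)) \<le> B * E"
    proof -
      let ?x = "\<Sum>c\<in>I. w c * p c * ?d c" and ?y = "\<Sum>c\<in>I. w c * q c * ?d c"
      have "?x\<^sup>2 \<le> U * E" "?y\<^sup>2 \<le> V * E"
        unfolding U_def V_def E_def by (rule sum_mult_le_sqrt, rule w, simp)+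
      hence "- 2 * (?x * ?y) \<le> (U + V) * E"
        using zero_le_power2[of "?x + ?y"] by (simp add: power2_sum algebra_simps)
      also have "\<dots> \<le> B * E" using UV E0 by (intro mult_right_mono)
      finally show ?thesis .
    qed
    \<comment> \<open>The bound \<open>B \<le> 4\<close> enters here through
      \<open>B \<le> 2 * sqrt B\<close>; the diagonal and the off-diagonal part together give the
      factor 3.\<close>
    have "B * E \<le> 2 * sqrt B * E" using BsB E0 by (intro mult_right_mono)
    with expand diag off show ?thesis by linarith
  qed
qed

section \<open>First two moments of one signed indicator\<close>

lemma expct_of_bool: "expct p (\<lambda>x. of_bool (x = c)) = pmf p c"
proof -
  have "expct p (\<lambda>x. of_bool (x = c)) = expct p (indicator {c})"
    by (intro arg_cong[of _ _ "expct p"]) (auto simp: indicator_def)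
  thus ?thesis by (simp add: measure_pmf_single)
qed

lemma expct_diff_indicator:
  assumes "finite (set_pmf P)" "finite (set_pmf Q)"
  shows "expct (pair_pmf P Q) (\<lambda>z. of_bool (fst z = c) - of_bool (snd z = c)) = pmf P c - pmf Q c"
  using assms by (simp add: expct_diff expct_of_bool
      expectation_pair_pmf_fst[of _ _ "\<lambda>x. of_bool (x = c)"]
      expectation_pair_pmf_snd[of _ _ "\<lambda>x. of_bool (x = c)"])

text \<open>Of the four products, the two within one component vanish unless \<open>c = l\<close>,
  and the two mixed ones factorise by independence of the components.\<close>

lemma expct_diff_indicator_mult:
  assumes "finite (set_pmf P)" "finite (set_pmf Q)"
  shows "expct (pair_pmf P Q) (\<lambda>z. (of_bool (fst z = c) - of_bool (snd z = c))
      * (of_bool (fst z = l) - of_bool (snd z = l)))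
    = (if c = l then pmf P c + pmf Q c else 0) - pmf P c * pmf Q l - pmf Q c * pmf P l"
proof -
  have fin: "finite (set_pmf (pair_pmf P Q))" using assms by simp
  have "expct (pair_pmf P Q) (\<lambda>z. (of_bool (fst z = c) - of_bool (snd z = c))
      * (of_bool (fst z = l) - of_bool (snd z = l)))
    = expct (pair_pmf P Q) (\<lambda>z. of_bool (c = l) * of_bool (fst z = c)
        + of_bool (c = l) * of_bool (snd z = c)
        - of_bool (fst z = c) * of_bool (snd z = l) - of_bool (fst z = l) * of_bool (snd z = c))"
    by (intro arg_cong[of _ _ "expct (pair_pmf P Q)"]) auto
  also have "\<dots> = of_bool (c = l) * pmf P c + of_bool (c = l) * pmf Q c
      - pmf P c * pmf Q l - pmf P l * pmf Q c"
    using expct_pair_mult[OF assms, of "\<lambda>x. of_bool (x = c)" "\<lambda>x. of_bool (x = l)"]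
      expct_pair_mult[OF assms, of "\<lambda>x. of_bool (x = l)" "\<lambda>x. of_bool (x = c)"]
      expectation_pair_pmf_fst[of P Q "\<lambda>x. of_bool (x = c) :: real"]
      expectation_pair_pmf_snd[of P Q "\<lambda>x. of_bool (x = c) :: real"]
    by (simp add: expct_add[OF fin] expct_diff[OF fin] expct_of_bool)
  finally show ?thesis by auto
qed

section \<open>Mean, second moment and tails of the collision statistic for fixed weights\<close>

context
  fixes P Q :: "'c pmf" and I :: "'c set" and w :: "'c \<Rightarrow> real"
  assumes fin: "finite I" and P: "set_pmf P \<subseteq> I" and Q: "set_pmf Q \<subseteq> I"
    and w0: "\<And>c. 0 \<le> w c" and w1: "\<And>c. w c \<le> 1"
begin

lemma finite_supports: "finite (set_pmf P)" "finite (set_pmf Q)"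
  using fin P Q finite_subset by auto

lemma expct_collision_stat:
  "expct (pair_pmf (replicate_pmf m (pair_pmf P Q)) (replicate_pmf m (pair_pmf P Q)))
    (\<lambda>z. collision_stat I w (fst z) (snd z))
   = (real m)\<^sup>2 * (\<Sum>c\<in>I. w c * (pmf P c - pmf Q c)\<^sup>2)"
proof -
  have f: "finite (set_pmf (replicate_pmf m (pair_pmf P Q)))"
    by (intro finite_set_replicate_pmf) (simp add: finite_supports)
  have d: "expct (replicate_pmf m (pair_pmf P Q)) (diff_count c) = real m * (pmf P c - pmf Q c)" for c
    unfolding diff_count_def
    by (subst expct_replicate_sum) (simp_all add: finite_supports expct_diff_indicator)
  show ?thesis
    unfolding collision_stat_def
    by (simp add: expct_sum f expct_pair_mult d sum_distrib_left power2_eq_square algebra_simps)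
qed

text \<open>Expanding the square gives a double sum over cells \<open>c\<close>, \<open>l\<close>.
  As the two blocks are independent and identically distributed, each summand is the square of the
  one-block moment \<open>m * C c l + m * (m - 1) * d c * d l\<close>; its three parts are bounded
  by \<open>weighted_mass_bounds\<close> and by the squared mean.\<close>

lemma expct_collision_stat_square:
  defines "B \<equiv> (\<Sum>c\<in>I. w c * (pmf P c + pmf Q c)\<^sup>2)"
    and "E \<equiv> (\<Sum>c\<in>I. w c * (pmf P c - pmf Q c)\<^sup>2)"
  shows "expct (pair_pmf (replicate_pmf m (pair_pmf P Q)) (replicate_pmf m (pair_pmf P Q)))
    (\<lambda>z. (collision_stat I w (fst z) (snd z))\<^sup>2)
   \<le> ((real m)\<^sup>2 * E)\<^sup>2 + (10 * (real m)\<^sup>2 * B + 6 * (real m)^3 * sqrt B * E)"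
proof -
  let ?R = "replicate_pmf m (pair_pmf P Q)"
  define d where "d c = pmf P c - pmf Q c" for c
  define C where "C c l = (if c = l then pmf P c + pmf Q c else 0)
    - pmf P c * pmf Q l - pmf Q c * pmf P l" for c l
  have f: "finite (set_pmf ?R)"
    by (intro finite_set_replicate_pmf) (simp add: finite_supports)
  have d2: "expct ?R (\<lambda>zs. diff_count c zs * diff_count l zs)
      = real m * C c l + real m * (real m - 1) * (d c * d l)" for c l
    unfolding diff_count_def C_def d_def
    by (subst expct_replicate_sum_mult)
      (simp_all add: finite_supports expct_diff_indicator expct_diff_indicator_mult)
  have sums: "sum (pmf P) I = 1" "sum (pmf Q) I = 1"
    using sum_pmf_eq_1[OF fin P] sum_pmf_eq_1[OF fin Q] by auto
  note bounds = weighted_mass_bounds[OF fin, of w "pmf P" "pmf Q", OF w0 w1 pmf_nonneg sums(1)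
      pmf_nonneg sums(2), folded B_def E_def d_def C_def]
  have E: "E = (\<Sum>c\<in>I. w c * (d c)\<^sup>2)" by (simp add: E_def d_def)
  have E0: "0 \<le> E" unfolding E by (intro sum_nonneg mult_nonneg_nonneg w0) auto
  have "expct (pair_pmf ?R ?R) (\<lambda>z. (collision_stat I w (fst z) (snd z))\<^sup>2)
    = expct (pair_pmf ?R ?R) (\<lambda>z. \<Sum>c\<in>I. \<Sum>l\<in>I. w c * w l *
        ((diff_count c (fst z) * diff_count l (fst z)) * (diff_count c (snd z) * diff_count l (snd z))))"
    unfolding collision_stat_def power2_eq_square sum_product
    by (simp only: mult_ac)
  also have "\<dots> = (\<Sum>c\<in>I. \<Sum>l\<in>I. w c * w l *
      (real m * C c l + real m * (real m - 1) * (d c * d l))\<^sup>2)"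
    by (simp add: expct_sum f expct_pair_mult[OF f f, of "\<lambda>zs. diff_count _ zs * diff_count _ zs"
          "\<lambda>zs. diff_count _ zs * diff_count _ zs"] d2 power2_eq_square)
  also have "\<dots> = (\<Sum>c\<in>I. \<Sum>l\<in>I. (real m)\<^sup>2 * (w c * w l * (C c l)\<^sup>2)
      + 2 * (real m)\<^sup>2 * (real m - 1) * (w c * w l * (C c l * (d c * d l)))
      + (real m)\<^sup>2 * (real m - 1)\<^sup>2 * ((w c * (d c)\<^sup>2) * (w l * (d l)\<^sup>2)))"
    by (intro sum.cong refl) (simp add: power2_eq_square algebra_simps)
  also have "\<dots> = (real m)\<^sup>2 * (\<Sum>c\<in>I. \<Sum>l\<in>I. w c * w l * (C c l)\<^sup>2)
      + 2 * (real m)\<^sup>2 * (real m - 1) * (\<Sum>c\<in>I. \<Sum>l\<in>I. w c * w l * (C c l * (d c * d l)))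
      + (real m)\<^sup>2 * (real m - 1)\<^sup>2 * (E * E)"
    unfolding sum.distrib sum_distrib_left[symmetric] E sum_product by simp
  also have "\<dots> \<le> (real m)\<^sup>2 * (10 * B) + 6 * (real m)^3 * sqrt B * E + ((real m)\<^sup>2 * E)\<^sup>2"
  \<comment> \<open>The estimates multiply by \<open>real m - 1\<close>, which is negative for
    \<open>m = 0\<close>.\<close>
  proof (cases "m = 0")
    case False
    hence m: "real m \<ge> 1" by simp
    have "2 * (real m)\<^sup>2 * (real m - 1) * (\<Sum>c\<in>I. \<Sum>l\<in>I. w c * w l * (C c l * (d c * d l)))
        \<le> 2 * (real m)\<^sup>2 * (real m - 1) * (3 * sqrt B * E)"
      using bounds(4) m by (intro mult_left_mono) auto
    also have "\<dots> \<le> 2 * (real m)\<^sup>2 * real m * (3 * sqrt B * E)"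
      using m E0 bounds(1) by (intro mult_right_mono mult_left_mono) auto
    finally have 1: "2 * (real m)\<^sup>2 * (real m - 1) * (\<Sum>c\<in>I. \<Sum>l\<in>I. w c * w l * (C c l * (d c * d l)))
        \<le> 6 * (real m)^3 * sqrt B * E" by (simp add: power2_eq_square power3_eq_cube algebra_simps)
    have 2: "(real m)\<^sup>2 * (real m - 1)\<^sup>2 * (E * E) \<le> (real m)\<^sup>2 * (real m)\<^sup>2 * (E * E)"
      using m E0 by (intro mult_right_mono mult_left_mono power_mono) auto
    have 3: "(real m)\<^sup>2 * (\<Sum>c\<in>I. \<Sum>l\<in>I. w c * w l * (C c l)\<^sup>2) \<le> (real m)\<^sup>2 * (10 * B)"
      using bounds(3) by (intro mult_left_mono) auto
    from 1 2 3 show ?thesis by (simp add: power2_eq_square algebra_simps)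
  qed simp
  finally show ?thesis by (simp add: algebra_simps)
qed

text \<open>Chebyshev's inequality with the threshold at half of the smallest mean
  \<open>m^2 * e\<close> of the far case. The mean is 0 if \<open>P = Q\<close>, and in the far case
  falling below the threshold is a deviation by at least half the mean.\<close>

lemma collision_stat_tail:
  assumes B: "(\<Sum>c\<in>I. w c * (pmf P c + pmf Q c)\<^sup>2) \<le> b"
    and E0: "0 < e" and d: "0 < \<delta>" "\<delta> \<le> 1"
    and m: "100 * sqrt b \<le> real m * \<delta> * e" "0 < m"
  defines "R \<equiv> pair_pmf (replicate_pmf m (pair_pmf P Q)) (replicate_pmf m (pair_pmf P Q))"
  shows "P = Q \<Longrightarrow>
      prb R {z. (real m)\<^sup>2 * e / 2 \<le> collision_stat I w (fst z) (snd z)} \<le> \<delta>"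
    and "e \<le> (\<Sum>c\<in>I. w c * (pmf P c - pmf Q c)\<^sup>2) \<Longrightarrow>
      prb R {z. collision_stat I w (fst z) (snd z) < (real m)\<^sup>2 * e / 2} \<le> \<delta>"
proof -
  define E where "E = (\<Sum>c\<in>I. w c * (pmf P c - pmf Q c)\<^sup>2)"
  define B where "B = (\<Sum>c\<in>I. w c * (pmf P c + pmf Q c)\<^sup>2)"
  let ?Z = "\<lambda>z. collision_stat I w (fst z) (snd z)"
  have f: "finite (set_pmf R)"
    unfolding R_def by (simp add: finite_set_replicate_pmf finite_supports)
  have B0: "0 \<le> B" unfolding B_def by (intro sum_nonneg mult_nonneg_nonneg w0) auto
  have b0: "0 \<le> b" "B \<le> b" using B B0 by (auto simp: B_def)
  have key: "prb R {z. a \<le> \<bar>?Z z - (real m)\<^sup>2 * E\<bar>}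
      \<le> (10 * (real m)\<^sup>2 * B + 6 * (real m)^3 * sqrt B * E) / a\<^sup>2" if "0 < a" for a
    using that expct_collision_stat[of m] expct_collision_stat_square[of m]
    by (intro chebyshev_pmf[OF f]) (simp_all add: R_def E_def B_def)
  have rB: "100 * sqrt B \<le> real m * \<delta> * e"
    using m(1) b0 by (meson mult_left_mono order_trans real_sqrt_le_mono zero_le_numeral)
  \<comment> \<open>Used with \<open>F = e\<close> when the distributions agree and with
    \<open>F = E\<close> when they are far apart.\<close>
  have ve: "10 * (real m)\<^sup>2 * B + 6 * (real m)^3 * sqrt B * F \<le> \<delta> * ((real m)\<^sup>2 * F / 2)\<^sup>2"
    if "e \<le> F" for F
  proof -
    let ?u = "sqrt B" let ?M = "real m"
    have F0: "0 < F" using that E0 by simp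
    have mF: "?M * \<delta> * e \<le> ?M * \<delta> * F"
      using that d by (intro mult_left_mono) auto
    have u: "100 * ?u \<le> ?M * \<delta> * F" using rB mF by simp
    have u0: "0 \<le> ?u" using B0 by simp
    have "(100 * ?u)\<^sup>2 \<le> (?M * \<delta> * F)\<^sup>2"
      using u u0 by (intro power_mono) auto
    moreover have "(100 * ?u)\<^sup>2 = 10000 * B" using B0 by (simp add: power_mult_distrib)
    ultimately have "10000 * B \<le> (?M * \<delta> * F)\<^sup>2" by simp
    also have "\<dots> = \<delta> * (\<delta> * (?M * F)\<^sup>2)" by (simp add: power2_eq_square)
    also have "\<dots> \<le> 1 * (\<delta> * (?M * F)\<^sup>2)" using d by (intro mult_right_mono) auto
    finally have "10000 * B \<le> \<delta> * (?M * F)\<^sup>2" by simp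
    hence "?M\<^sup>2 * (10000 * B) \<le> ?M\<^sup>2 * (\<delta> * (?M * F)\<^sup>2)" by (intro mult_left_mono) auto
    moreover have "?M^3 * F * (100 * ?u) \<le> ?M^3 * F * (?M * \<delta> * F)"
      using u F0 by (intro mult_left_mono) auto
    \<comment> \<open>With \<open>X = \<delta> * (m^2 * F)^2\<close>, the two variance terms are at
      most \<open>10 * X / 10000\<close> and \<open>6 * X / 100\<close>, together below the required
      \<open>X / 4\<close>.\<close>
    ultimately have "10000 * (?M\<^sup>2 * B) \<le> \<delta> * (?M\<^sup>2 * F)\<^sup>2"
      "100 * (?M^3 * ?u * F) \<le> \<delta> * (?M\<^sup>2 * F)\<^sup>2"
      by (simp_all add: power2_eq_square power3_eq_cube algebra_simps)
    moreover have "\<delta> * (?M\<^sup>2 * F / 2)\<^sup>2 = \<delta> * (?M\<^sup>2 * F)\<^sup>2 / 4" by (simp add: power2_eq_square)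
    moreover have "0 \<le> \<delta> * (?M\<^sup>2 * F)\<^sup>2" using d by simp
    ultimately show ?thesis by linarith
  qed
  show "prb R {z. (real m)\<^sup>2 * e / 2 \<le> ?Z z} \<le> \<delta>" if "P = Q"
  proof -
    have "E = 0" by (simp add: E_def that)
    have pos: "0 < (real m)\<^sup>2 * e / 2" using m E0 by simp
    have "prb R {z. (real m)\<^sup>2 * e / 2 \<le> ?Z z}
        \<le> prb R {z. (real m)\<^sup>2 * e / 2 \<le> \<bar>?Z z - (real m)\<^sup>2 * E\<bar>}"
      using \<open>E = 0\<close> by (intro measure_pmf.finite_measure_mono) auto
    also have "\<dots> \<le> 10 * (real m)\<^sup>2 * B / ((real m)\<^sup>2 * e / 2)\<^sup>2"
      using key[OF pos] \<open>E = 0\<close> by simp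
    also have "10 * (real m)\<^sup>2 * B \<le> \<delta> * ((real m)\<^sup>2 * e / 2)\<^sup>2"
    proof -
      have "0 \<le> 6 * (real m)^3 * sqrt B * e" using E0 B0 by simp
      with ve[of e] show ?thesis by linarith
    qed
    hence "10 * (real m)\<^sup>2 * B / ((real m)\<^sup>2 * e / 2)\<^sup>2 \<le> \<delta>"
      using pos m(2) by (subst pos_divide_le_eq) auto
    finally show ?thesis .
  qed
  show "prb R {z. ?Z z < (real m)\<^sup>2 * e / 2} \<le> \<delta>"
    if "e \<le> (\<Sum>c\<in>I. w c * (pmf P c - pmf Q c)\<^sup>2)"
  proof -
    have le: "e \<le> E" using that by (simp add: E_def)
    have pos: "0 < (real m)\<^sup>2 * E / 2" using m E0 le by simp
    have "(real m)\<^sup>2 * e \<le> (real m)\<^sup>2 * E" using le by (intro mult_left_mono) auto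
    hence "prb R {z. ?Z z < (real m)\<^sup>2 * e / 2}
        \<le> prb R {z. (real m)\<^sup>2 * E / 2 \<le> \<bar>?Z z - (real m)\<^sup>2 * E\<bar>}"
      using pos by (intro measure_pmf.finite_measure_mono) (auto simp: abs_if mult.commute[of E])
    also have "\<dots> \<le> (10 * (real m)\<^sup>2 * B + 6 * (real m)^3 * sqrt B * E) / ((real m)\<^sup>2 * E / 2)\<^sup>2"
      by (rule key[OF pos])
    also have "\<dots> \<le> \<delta>"
      using pos m(2) ve[OF le] by (subst pos_divide_le_eq) auto
    finally show ?thesis .
  qed
qed

end

text \<open>Union bound over two stages: either the first stage lands in the exceptional set
  \<open>S\<close>, or the second stage fails with probability at most \<open>b\<close>. Nonnegative
  integrals avoid any condition on the support of \<open>p\<close>.\<close>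

lemma prob_bind_le:
  assumes "0 \<le> b" "\<And>x. x \<in> set_pmf p \<Longrightarrow> x \<notin> S \<Longrightarrow> prb (f x) A \<le> b"
  shows "prb (bind_pmf p f) A \<le> prb p S + b"
proof -
  have "emeasure (bind_pmf p f) A = (\<integral>\<^sup>+x. emeasure (f x) A \<partial>p)"
    unfolding measure_pmf_bind
    by (rule emeasure_bind[where N = "count_space UNIV"]) (auto simp: space_subprob_algebra
        intro!: measure_pmf.subprob_space_axioms measurable_measure_pmf)
  also have "\<dots> \<le> (\<integral>\<^sup>+x. indicator S x + ennreal b \<partial>p)"
  proof (rule nn_integral_mono_AE, rule AE_pmfI)
    fix x assume x: "x \<in> set_pmf p"
    show "emeasure (f x) A \<le> indicator S x + ennreal b"
    proof (cases "x \<in> S")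
      case True
      have "emeasure (f x) A \<le> 1" by (rule measure_pmf.emeasure_le_1)
      also have "1 \<le> 1 + ennreal b" by simp
      finally show ?thesis using True by simp
    next
      case False
      thus ?thesis using assms(2)[OF x False]
        by (simp add: measure_pmf.emeasure_eq_measure ennreal_leI)
    qed
  qed
  also have "\<dots> = ennreal (prb p S + b)"
    using assms(1) by (subst nn_integral_add) (auto simp: measure_pmf.emeasure_eq_measure)
  finally show ?thesis
    using assms(1) by (simp add: measure_pmf.emeasure_eq_measure flip: ennreal_plus)
qed

section \<open>Weights obtained from a counting sample\<close>

lemma weight_pos: "0 < weight ws c"
  by (simp add: weight_def)

lemma weight_nonneg: "0 \<le> weight ws c"
  by (simp add: weight_def)

lemma weight_le_1: "weight ws c \<le> 1"
  by (simp add: weight_def field_simps)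

lemma sum_count_le: "finite I \<Longrightarrow> (\<Sum>c\<in>I. real (length (filter (\<lambda>z. f z = c) ws))) \<le> real (length ws)"
proof (induction ws)
  case (Cons a ws)
  have "(\<Sum>c\<in>I. real (length (filter (\<lambda>z. f z = c) (a # ws))))
      = (\<Sum>c\<in>I. of_bool (f a = c) + real (length (filter (\<lambda>z. f z = c) ws)))"
    by (intro sum.cong) auto
  also have "\<dots> \<le> (\<Sum>c\<in>I. of_bool (f a = c)) + real (length ws)"
    using Cons by (simp add: sum.distrib)
  also have "(\<Sum>c\<in>I. of_bool (f a = c)) \<le> (1 :: real)"
    using Cons.prems by (auto simp: of_bool_def)
  finally show ?case by simp
qed simp

text \<open>The reciprocal of a weight is one plus the two counts, so each cell is charged once and
  each sampled pair at most twice.\<close>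

lemma sum_inverse_weight_le:
  assumes "finite I"
  shows "(\<Sum>c\<in>I. 1 / weight ws c) \<le> real (card I) + 2 * real (length ws)"
proof -
  have "(\<Sum>c\<in>I. 1 / weight ws c) = real (card I)
      + (\<Sum>c\<in>I. real (length (filter (\<lambda>z. fst z = c) ws)))
      + (\<Sum>c\<in>I. real (length (filter (\<lambda>z. snd z = c) ws)))"
    by (simp add: weight_def sum.distrib)
  also have "\<dots> \<le> real (card I) + real (length ws) + real (length ws)"
    by (intro add_mono sum_count_le assms) simp
  finally show ?thesis by simp
qed

text \<open>Cauchy-Schwarz after writing \<open>\<bar>d c\<bar>\<close> as
  \<open>w c * \<bar>d c\<bar> * (1 / w c)\<close>. It turns an l1 gap between distributions into a
  lower bound on the mean of the statistic.\<close>

lemma l1_le_weighted_l2: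
  fixes d :: "'c \<Rightarrow> real"
  assumes "finite I" "\<And>c. c \<in> I \<Longrightarrow> 0 < w c"
  shows "(\<Sum>c\<in>I. \<bar>d c\<bar>)\<^sup>2 \<le> (\<Sum>c\<in>I. w c * (d c)\<^sup>2) * (\<Sum>c\<in>I. 1 / w c)"
proof -
  have "(\<Sum>c\<in>I. \<bar>d c\<bar>) = (\<Sum>c\<in>I. w c * \<bar>d c\<bar> * (1 / w c))"
    using assms by (intro sum.cong) force+
  moreover have "(\<Sum>c\<in>I. w c * \<bar>d c\<bar> * (1 / w c))\<^sup>2
      \<le> (\<Sum>c\<in>I. w c * \<bar>d c\<bar>\<^sup>2) * (\<Sum>c\<in>I. w c * (1 / w c)\<^sup>2)"
    using assms by (intro sum_mult_le_sqrt) (simp add: less_imp_le)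
  moreover have "(\<Sum>c\<in>I. w c * (1 / w c)\<^sup>2) = (\<Sum>c\<in>I. 1 / w c)"
    using assms by (intro sum.cong refl) (simp add: power2_eq_square less_imp_neq[symmetric])
  ultimately show ?thesis by simp
qed

text \<open>A heavy cell is counted often and so receives a small weight: by
  \<open>expct_inverse_count\<close>, one factor \<open>pmf P c\<close> times the expected weight of
  \<open>c\<close> is at most \<open>1 / (k + 1)\<close>. The remaining factors sum to a
  constant.\<close>

lemma expct_weighted_mass_le:
  assumes fin: "finite I" and P: "set_pmf P \<subseteq> I" and Q: "set_pmf Q \<subseteq> I"
  shows "expct (replicate_pmf k (pair_pmf P Q)) (\<lambda>ws. \<Sum>c\<in>I. weight ws c * (pmf P c + pmf Q c)\<^sup>2)
    \<le> 4 / (real k + 1)"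
proof -
  have f: "finite (set_pmf (pair_pmf P Q))" using finite_subset[OF P fin] finite_subset[OF Q fin] by simp
  note fR = finite_set_replicate_pmf[OF f, of k]
  let ?R = "replicate_pmf k (pair_pmf P Q)"
  have pr: "prb (pair_pmf P Q) {z. fst z = c} = pmf P c" "prb (pair_pmf P Q) {z. snd z = c} = pmf Q c" for c
  proof -
    have "prb (map_pmf fst (pair_pmf P Q)) {c} = pmf P c"
      by (simp only: map_fst_pair_pmf measure_pmf_single)
    thus "prb (pair_pmf P Q) {z. fst z = c} = pmf P c" by (simp add: vimage_def)
    have "prb (map_pmf snd (pair_pmf P Q)) {c} = pmf Q c"
      by (simp only: map_snd_pair_pmf measure_pmf_single)
    thus "prb (pair_pmf P Q) {z. snd z = c} = pmf Q c" by (simp add: vimage_def)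
  qed
  have w1: "pmf P c * expct ?R (\<lambda>ws. weight ws c) \<le> 1 / (real k + 1)" for c
  proof -
    have "pmf P c * expct ?R (\<lambda>ws. weight ws c)
      \<le> pmf P c * expct ?R (\<lambda>ws. 1 / real (Suc (length (filter (\<lambda>z. fst z = c) ws))))"
      by (intro mult_left_mono expct_mono fR) (auto simp: weight_def intro!: divide_left_mono)
    also have "\<dots> \<le> 1 / real (Suc k)"
      using expct_inverse_count[OF f, of "\<lambda>z. fst z = c" k] by (simp only: pr)
    finally show ?thesis by (simp add: add.commute)
  qed
  have w2: "pmf Q c * expct ?R (\<lambda>ws. weight ws c) \<le> 1 / (real k + 1)" for c
  proof -
    have "pmf Q c * expct ?R (\<lambda>ws. weight ws c)
      \<le> pmf Q c * expct ?R (\<lambda>ws. 1 / real (Suc (length (filter (\<lambda>z. snd z = c) ws))))"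
      by (intro mult_left_mono expct_mono fR) (auto simp: weight_def intro!: divide_left_mono)
    also have "\<dots> \<le> 1 / real (Suc k)"
      using expct_inverse_count[OF f, of "\<lambda>z. snd z = c" k] by (simp only: pr)
    finally show ?thesis by (simp add: add.commute)
  qed
  have sums: "sum (pmf P) I = 1" "sum (pmf Q) I = 1"
    using sum_pmf_eq_1[OF fin P] sum_pmf_eq_1[OF fin Q] by auto
  have "expct ?R (\<lambda>ws. \<Sum>c\<in>I. weight ws c * (pmf P c + pmf Q c)\<^sup>2)
    = (\<Sum>c\<in>I. expct ?R (\<lambda>ws. weight ws c) * (pmf P c + pmf Q c)\<^sup>2)"
    by (simp add: expct_sum[OF fR])
  also have "\<dots> \<le> (\<Sum>c\<in>I. 2 * pmf P c * (1 / (real k + 1)) + 2 * pmf Q c * (1 / (real k + 1)))"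
  proof (rule sum_mono)
    fix c assume "c \<in> I"
    let ?W = "expct ?R (\<lambda>ws. weight ws c)"
    have W0: "0 \<le> ?W" by (intro integral_nonneg_AE AE_I2 weight_nonneg)
    have "(pmf P c + pmf Q c)\<^sup>2 \<le> 2 * (pmf P c)\<^sup>2 + 2 * (pmf Q c)\<^sup>2"
      using zero_le_power2[of "pmf P c - pmf Q c"] by (simp add: power2_eq_square algebra_simps)
    hence "?W * (pmf P c + pmf Q c)\<^sup>2 \<le> ?W * (2 * (pmf P c)\<^sup>2 + 2 * (pmf Q c)\<^sup>2)"
      using W0 by (intro mult_left_mono)
    also have "\<dots> = 2 * pmf P c * (pmf P c * ?W) + 2 * pmf Q c * (pmf Q c * ?W)"
      by (simp add: power2_eq_square algebra_simps)
    also have "\<dots> \<le> 2 * pmf P c * (1 / (real k + 1)) + 2 * pmf Q c * (1 / (real k + 1))"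
      by (intro add_mono mult_left_mono w1 w2) auto
    finally show "?W * (pmf P c + pmf Q c)\<^sup>2
        \<le> 2 * pmf P c * (1 / (real k + 1)) + 2 * pmf Q c * (1 / (real k + 1))" .
  qed
  also have "\<dots> = 4 / (real k + 1)"
    by (simp add: sum.distrib sums flip: sum_distrib_left sum_divide_distrib)
  finally show ?thesis .
qed

text \<open>The value \<open>True\<close> means that a difference was detected. The weights come
  from a separate sample, so that the statistic has fixed weights once \<open>ws\<close> is
  given.\<close>

definition l1_test :: "'c set \<Rightarrow> nat \<Rightarrow> nat \<Rightarrow> real \<Rightarrow> 'c pmf \<Rightarrow> 'c pmf \<Rightarrow> bool pmf" where
  "l1_test I k m \<tau> P Q = bind_pmf (replicate_pmf k (pair_pmf P Q)) (\<lambda>ws.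
     map_pmf (\<lambda>z. \<tau> \<le> collision_stat I (weight ws) (fst z) (snd z))
       (pair_pmf (replicate_pmf m (pair_pmf P Q)) (replicate_pmf m (pair_pmf P Q))))"

text \<open>Two sources of error, each of probability at most \<open>\<delta>\<close>: by Markov's
  inequality the weighted mass may exceed \<open>4 / (\<delta> * (k + 1))\<close>, and by
  Chebyshev's the statistic may then miss its threshold.\<close>

lemma l1_test_correct:
  assumes fin: "finite I" and P: "set_pmf P \<subseteq> I" and Q: "set_pmf Q \<subseteq> I"
    and \<eta>: "0 < \<eta>" and \<delta>: "0 < \<delta>" "\<delta> \<le> 1" and m0: "0 < m"
    and N: "card I \<le> N" "0 < N"
    and m: "100 * sqrt (4 / (\<delta> * (real k + 1))) \<le> real m * \<delta> * (\<eta>\<^sup>2 / (real N + 2 * real k))"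
  defines "\<tau> \<equiv> (real m)\<^sup>2 * (\<eta>\<^sup>2 / (real N + 2 * real k)) / 2"
  shows "P = Q \<Longrightarrow> prb (l1_test I k m \<tau> P Q) {True} \<le> 2 * \<delta>"
    and "\<eta> \<le> (\<Sum>c\<in>I. \<bar>pmf P c - pmf Q c\<bar>) \<Longrightarrow> prb (l1_test I k m \<tau> P Q) {False} \<le> 2 * \<delta>"
proof -
  let ?R = "replicate_pmf k (pair_pmf P Q)"
  define e where "e = \<eta>\<^sup>2 / (real N + 2 * real k)"
  define b where "b = 4 / (\<delta> * (real k + 1))"
  define S where "S = {ws. b \<le> (\<Sum>c\<in>I. weight ws c * (pmf P c + pmf Q c)\<^sup>2)}"
  have f: "finite (set_pmf (pair_pmf P Q))" using finite_subset[OF P fin] finite_subset[OF Q fin] by simp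
  have e0: "0 < e" using \<eta> N by (simp add: e_def)
  have b0: "0 < b" using \<delta> by (simp add: b_def)
  have "prb ?R S \<le> expct ?R (\<lambda>ws. \<Sum>c\<in>I. weight ws c * (pmf P c + pmf Q c)\<^sup>2) / b"
    unfolding S_def using b0
    by (intro markov_pmf finite_set_replicate_pmf[OF f] sum_nonneg mult_nonneg_nonneg weight_nonneg) auto
  also have "\<dots> \<le> (4 / (real k + 1)) / b"
    using b0 by (intro divide_right_mono expct_weighted_mass_le fin P Q) auto
  also have "\<dots> = \<delta>" using \<delta> by (simp add: b_def field_simps add_pos_nonneg)
  finally have S: "prb ?R S \<le> \<delta>" .
  have w: "0 \<le> weight ws c" "weight ws c \<le> 1" for ws :: "('c \<times> 'c) list" and c
    by (rule weight_nonneg weight_le_1)+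
  have m': "100 * sqrt b \<le> real m * \<delta> * e" using m by (simp add: b_def e_def)
  have \<tau>: "\<tau> = (real m)\<^sup>2 * e / 2" by (simp add: \<tau>_def e_def)
  note tail = collision_stat_tail[where w = "weight ws" for ws, OF fin P Q w(1) w(2) _ e0 \<delta> m' m0, folded \<tau>]
  show "prb (l1_test I k m \<tau> P Q) {True} \<le> 2 * \<delta>" if "P = Q"
  proof -
    have "prb (l1_test I k m \<tau> P Q) {True} \<le> prb ?R S + \<delta>"
      unfolding l1_test_def
      using \<delta> by (intro prob_bind_le)
        (auto simp: S_def vimage_def intro!: tail(1) that)
    with S show ?thesis by simp
  qed
  show "prb (l1_test I k m \<tau> P Q) {False} \<le> 2 * \<delta>" if far: "\<eta> \<le> (\<Sum>c\<in>I. \<bar>pmf P c - pmf Q c\<bar>)"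
  proof -
    have "prb (l1_test I k m \<tau> P Q) {False} \<le> prb ?R S + \<delta>"
      unfolding l1_test_def
    proof (rule prob_bind_le)
      fix ws assume ws: "ws \<in> set_pmf ?R" "ws \<notin> S"
      let ?E = "\<Sum>c\<in>I. weight ws c * (pmf P c - pmf Q c)\<^sup>2"
      \<comment> \<open>The lower bound on the mean holds for every \<open>ws\<close>, since it
        depends on the sample only through its length.\<close>
      have len: "length ws = k" using ws by (auto simp: set_replicate_pmf)
      have "\<eta>\<^sup>2 \<le> (\<Sum>c\<in>I. \<bar>pmf P c - pmf Q c\<bar>)\<^sup>2" using far \<eta> by (intro power_mono) auto
      also have "\<dots> \<le> ?E * (\<Sum>c\<in>I. 1 / weight ws c)"
        by (rule l1_le_weighted_l2[OF fin weight_pos])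
      also have "\<dots> \<le> ?E * (real N + 2 * real k)"
        using sum_inverse_weight_le[OF fin, of ws] N len w
        by (intro mult_left_mono sum_nonneg mult_nonneg_nonneg) auto
      finally have "e \<le> ?E" using N by (simp add: e_def pos_divide_le_eq)
      with ws show "prb (map_pmf (\<lambda>z. \<tau> \<le> collision_stat I (weight ws) (fst z) (snd z))
       (pair_pmf (replicate_pmf m (pair_pmf P Q)) (replicate_pmf m (pair_pmf P Q)))) {False} \<le> \<delta>"
        using tail(2)[of ws] by (simp add: S_def vimage_def not_le)
    qed (use \<delta> in simp)
    with S show ?thesis by simp
  qed
qed

text \<open>The test needs \<open>m\<close> of order \<open>N / (sqrt k * \<eta>^2)\<close>, up to
  powers of \<open>\<delta>\<close>. Equating this with \<open>k\<close> gives
  \<open>A = N powr (2/3) * \<eta> powr (-4/3)\<close>; capping \<open>k\<close> at \<open>N\<close>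
  keeps \<open>N + 2 * k\<close> of order \<open>N\<close> and accounts for the term
  \<open>sqrt N / \<eta>^2\<close>.\<close>

lemma l1_test_parameters:
  fixes N :: nat and \<eta> \<delta> :: real
  assumes N: "0 < N" and \<eta>: "0 < \<eta>" and \<delta>: "0 < \<delta>" "\<delta> \<le> 1"
  obtains k m :: nat where "0 < m"
    "100 * sqrt (4 / (\<delta> * (real k + 1))) \<le> real m * \<delta> * (\<eta>\<^sup>2 / (real N + 2 * real k))"
    "real k + 2 * real m
      \<le> 3 + 1201 * (sqrt (real N) / \<eta>\<^sup>2 + real N powr (2/3) * \<eta> powr (-4/3)) / \<delta>\<^sup>2"
proof -
  define A where "A = real N powr (2/3) * \<eta> powr (-4/3)"
  define \<kappa> where "\<kappa> = min (real N) A"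
  define M where "M = sqrt (real N) / \<eta>\<^sup>2 + A"
  define k where "k = nat \<lceil>\<kappa>\<rceil>"
  \<comment> \<open>The factor 600 is 200, from \<open>100 * sqrt 4\<close>, times 3, from
    \<open>N + 2 * k \<le> 3 * N\<close>.\<close>
  define m where "m = nat \<lceil>600 * M / \<delta>\<^sup>2\<rceil>"
  have A0: "0 < A" using N \<eta> by (simp add: A_def)
  have \<kappa>0: "0 < \<kappa>" using A0 N by (simp add: \<kappa>_def)
  have M0: "0 < M" using A0 \<eta> by (simp add: M_def add_nonneg_pos)
  have k1: "\<kappa> \<le> real k" by (simp add: k_def real_nat_ceiling_ge)
  have k2: "real k \<le> \<kappa> + 1" using \<kappa>0 unfolding k_def by linarith
  have k3: "k \<le> N" unfolding k_def \<kappa>_def by linarith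
  have m1: "600 * M / \<delta>\<^sup>2 \<le> real m" by (simp add: m_def real_nat_ceiling_ge)
  have m2: "real m \<le> 600 * M / \<delta>\<^sup>2 + 1"
  proof -
    have "0 \<le> 600 * M / \<delta>\<^sup>2" using M0 by simp
    thus ?thesis unfolding m_def by linarith
  qed
  have \<delta>2: "\<delta>\<^sup>2 \<le> 1" "0 < \<delta>\<^sup>2" using \<delta> by (auto simp: power_le_one)
  have m0: "0 < real m" using m1 M0 \<delta>2 by (smt (verit) divide_pos_pos)
  \<comment> \<open>If \<open>\<kappa> = N\<close>, the left side is the first summand of
    \<open>M\<close>; otherwise \<open>\<kappa> = A\<close> and it equals \<open>A\<close>.\<close>
  have key: "real N / (sqrt \<kappa> * \<eta>\<^sup>2) \<le> M"
  proof (cases "real N \<le> A")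
    case True
    hence "\<kappa> = real N" by (simp add: \<kappa>_def)
    hence "real N / (sqrt \<kappa> * \<eta>\<^sup>2) = sqrt (real N) / \<eta>\<^sup>2"
      by (simp add: real_div_sqrt flip: divide_divide_eq_left)
    thus ?thesis using A0 by (simp add: M_def)
  next
    case False
    hence "sqrt \<kappa> = sqrt A" by (simp add: \<kappa>_def)
    also have "\<dots> = A powr (1/2)" using A0 by (simp add: powr_half_sqrt)
    also have "\<dots> = real N powr (1/3) * \<eta> powr (-2/3)"
      using N \<eta> unfolding A_def by (simp add: powr_mult powr_powr)
    finally have "sqrt \<kappa> * \<eta>\<^sup>2 = real N powr (1/3) * (\<eta> powr (-2/3) * \<eta> powr 2)"
      using \<eta> by (simp add: powr_numeral)
    also have "\<eta> powr (-2/3) * \<eta> powr 2 = \<eta> powr (4/3)"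
      by (simp flip: powr_add)
    finally have "real N / (sqrt \<kappa> * \<eta>\<^sup>2) = real N powr 1 / real N powr (1/3) / \<eta> powr (4/3)"
      using N by simp
    also have "real N powr 1 / real N powr (1/3) = real N powr (2/3)"
      by (subst powr_diff[symmetric]) simp
    also have "real N powr (2/3) / \<eta> powr (4/3) = A"
      by (simp add: A_def powr_minus field_simps)
    finally show ?thesis using \<eta> by (simp add: M_def)
  qed
  show thesis
  proof (rule that[of m k])
    show "0 < m" using m0 by simp
    have "0 \<le> sqrt (real N) / \<eta>\<^sup>2" by simp
    hence "\<kappa> \<le> M" unfolding \<kappa>_def M_def by linarith
    hence "real k \<le> M + 1" using k2 by simp
    hence "real k + 2 * real m \<le> M + 1 + 2 * (600 * M / \<delta>\<^sup>2 + 1)"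
      by (intro add_mono mult_left_mono m2) auto
    moreover have "M \<le> M / \<delta>\<^sup>2" using M0 \<delta>2 by (simp add: field_simps)
    ultimately have "real k + 2 * real m \<le> 3 + 1201 * (M / \<delta>\<^sup>2)" by simp
    thus "real k + 2 * real m
      \<le> 3 + 1201 * (sqrt (real N) / \<eta>\<^sup>2 + real N powr (2/3) * \<eta> powr (-4/3)) / \<delta>\<^sup>2"
      by (simp add: M_def A_def)
    \<comment> \<open>As \<open>\<delta> \<le> 1\<close>, replacing \<open>\<delta>\<close> by its
      square under the root costs little and lets the root be evaluated.\<close>
    have "sqrt (4 / (\<delta> * (real k + 1))) \<le> sqrt (4 / (\<delta>\<^sup>2 * \<kappa>))"
    proof (intro real_sqrt_le_mono divide_left_mono)
      show "\<delta>\<^sup>2 * \<kappa> \<le> \<delta> * (real k + 1)"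
        using \<delta> k1 \<kappa>0 by (intro mult_mono) (auto simp: power2_eq_square mult_left_le)
    qed (use \<delta> \<kappa>0 in auto)
    also have "\<dots> = 2 / (\<delta> * sqrt \<kappa>)"
      using \<delta> by (simp add: real_sqrt_divide real_sqrt_mult)
    finally have 1: "100 * sqrt (4 / (\<delta> * (real k + 1))) \<le> 200 / (\<delta> * sqrt \<kappa>)" by simp
    also have "\<dots> = 200 * (real N / (sqrt \<kappa> * \<eta>\<^sup>2)) / \<delta> * (\<eta>\<^sup>2 / real N)"
      using N \<eta> by (simp add: field_simps)
    also have "\<dots> \<le> 200 * M / \<delta> * (\<eta>\<^sup>2 / real N)"
      using key \<delta> by (intro mult_right_mono divide_right_mono mult_left_mono) auto
    also have "\<dots> = (600 * M / \<delta>\<^sup>2) * \<delta> * (\<eta>\<^sup>2 / (3 * real N))"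
      using \<delta> N by (simp add: field_simps power2_eq_square)
    also have "\<dots> \<le> real m * \<delta> * (\<eta>\<^sup>2 / (3 * real N))"
      using m1 \<delta> by (intro mult_right_mono) auto
    also have "\<dots> \<le> real m * \<delta> * (\<eta>\<^sup>2 / (real N + 2 * real k))"
      using k3 \<delta> N by (intro mult_left_mono divide_left_mono) auto
    finally show "100 * sqrt (4 / (\<delta> * (real k + 1)))
        \<le> real m * \<delta> * (\<eta>\<^sup>2 / (real N + 2 * real k))" .
  qed
qed

section \<open>Couplings that respect nested partitions\<close>

lemma exists_max_level_pair:
  fixes A :: "'a set" and B :: "'b set" and F :: "'a \<Rightarrow> 'b \<Rightarrow> nat"
  assumes "a \<in> A" "b \<in> B" "\<And>x y. F x y \<le> n"
  obtains x y where "x \<in> A" "y \<in> B" "\<And>x' y'. x' \<in> A \<Longrightarrow> y' \<in> B \<Longrightarrow> F x' y' \<le> F x y"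
proof -
  let ?S = "{F x y | x y. x \<in> A \<and> y \<in> B}"
  have fin: "finite ?S" by (rule finite_subset[of _ "{..n}"]) (use assms(3) in auto)
  have "?S \<noteq> {}" using assms by auto
  from Max_in[OF fin this] obtain x y where xy: "x \<in> A" "y \<in> B" "Max ?S = F x y" by auto
  show thesis
  proof (rule that[OF xy(1,2)])
    fix x' y' assume "x' \<in> A" "y' \<in> B"
    thus "F x' y' \<le> F x y" unfolding xy(3)[symmetric] using fin by (intro Max_ge) auto
  qed
qed

text \<open>Greedy matching: move mass between a pair of points that agree on as many levels as possible. On
  every level where the pair disagrees, its two cells then carry mass of only one of the two
  distributions, so the \<open>\<ell>\<^sub>1\<close> distance on that level drops by twice the mass moved.\<close>

lemma multilevel_transport:
  fixes P Q :: "'a \<Rightarrow> real" and h :: "nat \<Rightarrow> 'a \<Rightarrow> 'b"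
  assumes fin: "finite X"
    and nested: "\<forall>j\<le>L. \<forall>i\<le>j. \<forall>x\<in>X. \<forall>y\<in>X. h j x = h j y \<longrightarrow> h i x = h i y"
    and nonneg: "\<And>x. 0 \<le> P x" "\<And>x. 0 \<le> Q x"
    and mass: "sum P X = sum Q X"
  shows "\<exists>\<pi>. (\<forall>x y. 0 \<le> \<pi> x y) \<and> (\<forall>x\<in>X. (\<Sum>y\<in>X. \<pi> x y) = P x) \<and> (\<forall>y\<in>X. (\<Sum>x\<in>X. \<pi> x y) = Q y) \<and>
    (\<forall>i\<le>L. 2 * (\<Sum>x\<in>X. \<Sum>y\<in>X. if h i x = h i y then 0 else \<pi> x y)
       \<le> (\<Sum>c\<in>h i ` X. \<bar>\<Sum>x\<in>X. if h i x = c then P x - Q x else 0\<bar>))"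
  using nonneg mass
\<comment> \<open>Moving \<open>min (P x) (Q y)\<close> empties at least one of the two points, so
  the total size of the supports decreases.\<close>
proof (induction "card {x\<in>X. 0 < P x} + card {x\<in>X. 0 < Q x}" arbitrary: P Q rule: less_induct)
  case less
  note P0 = less.prems(1) and Q0 = less.prems(2) and mass = less.prems(3)
  show ?case
  proof (cases "\<exists>x\<in>X. 0 < P x")
    case False
    hence P: "P x = 0" if "x \<in> X" for x using P0[of x] that by force
    hence "sum Q X = 0" using mass by simp
    hence Q: "Q x = 0" if "x \<in> X" for x
      using sum_nonneg_eq_0_iff[OF fin, of Q] Q0 that by auto
    show ?thesis by (rule exI[of _ "\<lambda>_ _. 0"]) (auto simp: P Q intro: sum_nonneg)
  next
    case True
    then obtain x0 where x0: "x0 \<in> X" "0 < P x0" by auto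
    have "0 < sum P X" using sum_pos2[of X x0 P] fin x0 P0 by simp
    hence "\<exists>y\<in>X. 0 < Q y" using mass sum_nonpos[of X Q] by (force simp: not_less)
    then obtain y0 where y0: "y0 \<in> X" "0 < Q y0" by auto
    \<comment> \<open>By nestedness, the levels on which two points of \<open>X\<close> agree form
      an initial segment, so their number measures the depth of agreement.\<close>
    define F where "F x y = card {i. i \<le> L \<and> h i x = h i y}" for x y
    have Fle: "F x y \<le> L + 1" for x y
      unfolding F_def using card_mono[of "{..L}" "{i. i \<le> L \<and> h i x = h i y}"] by auto
    obtain x y where "x \<in> {x\<in>X. 0 < P x}" "y \<in> {y\<in>X. 0 < Q y}"
      and max': "\<And>x' y'. x' \<in> {x\<in>X. 0 < P x} \<Longrightarrow> y' \<in> {y\<in>X. 0 < Q y} \<Longrightarrow> F x' y' \<le> F x y"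
      by (rule exists_max_level_pair[of x0 "{x\<in>X. 0 < P x}" y0 "{y\<in>X. 0 < Q y}" F, OF _ _ Fle])
        (use x0 y0 in auto)
    hence x: "x \<in> X" "0 < P x" and y: "y \<in> X" "0 < Q y"
      and max: "\<And>x' y'. x' \<in> X \<Longrightarrow> 0 < P x' \<Longrightarrow> y' \<in> X \<Longrightarrow> 0 < Q y' \<Longrightarrow> F x' y' \<le> F x y" by auto
    \<comment> \<open>A pair agreeing on a level \<open>i\<close> where the chosen pair disagrees
      would, by nestedness, also agree on every level where the chosen pair agrees, contradicting
      maximality.\<close>
    have sep: "h i x' \<noteq> h i y'"
      if i: "i \<le> L" "h i x \<noteq> h i y" and x': "x' \<in> X" "0 < P x'" and y': "y' \<in> X" "0 < Q y'" for i x' y'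
    proof
      assume eq: "h i x' = h i y'"
      have "{j. j \<le> L \<and> h j x = h j y} \<subset> {j. j \<le> L \<and> h j x' = h j y'}"
      proof (rule psubsetI)
        show "{j. j \<le> L \<and> h j x = h j y} \<subseteq> {j. j \<le> L \<and> h j x' = h j y'}"
        proof safe
          fix j assume j: "j \<le> L" "h j x = h j y"
          hence "j < i" using nested x y i by (meson not_le_imp_less)
          thus "h j x' = h j y'" using nested i x' y' eq by (meson less_imp_le)
        qed
        show "{j. j \<le> L \<and> h j x = h j y} \<noteq> {j. j \<le> L \<and> h j x' = h j y'}" using i eq by blast
      qed
      hence "F x y < F x' y'" unfolding F_def by (intro psubset_card_mono) auto
      with max[OF x' y'] show False by simp
    qed
    define t where "t = min (P x) (Q y)"
    have t: "0 < t" "t \<le> P x" "t \<le> Q y" using x y by (auto simp: t_def)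
    define P' where "P' = P(x := P x - t)"
    define Q' where "Q' = Q(y := Q y - t)"
    have P'0: "0 \<le> P' z" and Q'0: "0 \<le> Q' z" for z
      using P0 Q0 t by (auto simp: P'_def Q'_def)
    have P'eq: "P' z = P z - (if z = x then t else 0)" and Q'eq: "Q' z = Q z - (if z = y then t else 0)" for z
      by (auto simp: P'_def Q'_def)
    have mass': "sum P' X = sum Q' X"
      using x y fin mass by (simp add: P'eq Q'eq sum_subtractf)
    have subP: "{z\<in>X. 0 < P' z} \<subseteq> {z\<in>X. 0 < P z}" and subQ: "{z\<in>X. 0 < Q' z} \<subseteq> {z\<in>X. 0 < Q z}"
      using t x y by (auto simp: P'_def Q'_def split: if_splits)
    have leP: "card {z\<in>X. 0 < P' z} \<le> card {z\<in>X. 0 < P z}"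
      and leQ: "card {z\<in>X. 0 < Q' z} \<le> card {z\<in>X. 0 < Q z}"
      using subP subQ fin by (auto intro!: card_mono)
    have "card {z\<in>X. 0 < P' z} + card {z\<in>X. 0 < Q' z} < card {z\<in>X. 0 < P z} + card {z\<in>X. 0 < Q z}"
    proof (cases "P x \<le> Q y")
      case True
      hence "x \<notin> {z\<in>X. 0 < P' z}" by (simp add: P'_def t_def)
      hence "{z\<in>X. 0 < P' z} \<subset> {z\<in>X. 0 < P z}" using subP x by auto
      hence "card {z\<in>X. 0 < P' z} < card {z\<in>X. 0 < P z}" using fin by (intro psubset_card_mono) auto
      thus ?thesis using leQ by simp
    next
      case False
      hence "y \<notin> {z\<in>X. 0 < Q' z}" by (simp add: Q'_def t_def)
      hence "{z\<in>X. 0 < Q' z} \<subset> {z\<in>X. 0 < Q z}" using subQ y by auto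
      hence "card {z\<in>X. 0 < Q' z} < card {z\<in>X. 0 < Q z}" using fin by (intro psubset_card_mono) auto
      thus ?thesis using leP by simp
    qed
    from less.hyps[OF this P'0 Q'0 mass'] obtain \<pi> where
      \<pi>0: "\<And>a b. 0 \<le> \<pi> a b"
      and \<pi>P: "\<And>a. a \<in> X \<Longrightarrow> (\<Sum>b\<in>X. \<pi> a b) = P' a"
      and \<pi>Q: "\<And>b. b \<in> X \<Longrightarrow> (\<Sum>a\<in>X. \<pi> a b) = Q' b"
      and \<pi>h: "\<And>i. i \<le> L \<Longrightarrow> 2 * (\<Sum>a\<in>X. \<Sum>b\<in>X. if h i a = h i b then 0 else \<pi> a b)
        \<le> (\<Sum>c\<in>h i ` X. \<bar>\<Sum>a\<in>X. if h i a = c then P' a - Q' a else 0\<bar>)" by (elim exE conjE) blast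
    define \<pi>' where "\<pi>' a b = \<pi> a b + (if a = x then if b = y then t else 0 else 0)" for a b
    have "2 * (\<Sum>a\<in>X. \<Sum>b\<in>X. if h i a = h i b then 0 else \<pi>' a b)
       \<le> (\<Sum>c\<in>h i ` X. \<bar>\<Sum>a\<in>X. if h i a = c then P a - Q a else 0\<bar>)" if i: "i \<le> L" for i
    proof -
      define D where "D c = (\<Sum>a\<in>X. if h i a = c then P a - Q a else 0)" for c
      have split: "(if h i a = c then P' a - Q' a else 0) = (if h i a = c then P a - Q a else 0)
          - (if a = x then (if h i x = c then t else 0) else 0)
          + (if a = y then (if h i y = c then t else 0) else 0)" for a c
        by (auto simp: P'eq Q'eq)
      have D': "(\<Sum>a\<in>X. if h i a = c then P' a - Q' a else 0)
        = D c - (if h i x = c then t else 0) + (if h i y = c then t else 0)" for c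
        unfolding split sum.distrib sum_subtractf D_def using fin x y by simp
      have "(\<Sum>a\<in>X. \<Sum>b\<in>X. if h i a = h i b then 0 else \<pi>' a b)
        = (\<Sum>a\<in>X. \<Sum>b\<in>X. (if h i a = h i b then 0 else \<pi> a b)
            + (if a = x then if b = y then (if h i x = h i y then 0 else t) else 0 else 0))"
        by (intro sum.cong refl) (auto simp: \<pi>'_def)
      also have "\<dots> = (\<Sum>a\<in>X. \<Sum>b\<in>X. if h i a = h i b then 0 else \<pi> a b)
          + (if h i x = h i y then 0 else t)"
      proof -
        have "(\<Sum>a\<in>X. \<Sum>b\<in>X. if a = x then if b = y then (if h i x = h i y then 0 else t) else 0 else 0)
          = (\<Sum>a\<in>X. if a = x then (\<Sum>b\<in>X. if b = y then (if h i x = h i y then 0 else t) else 0) else 0)"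
          by (intro sum.cong refl) auto
        thus ?thesis using fin x y by (simp add: sum.distrib)
      qed
      finally have lhs: "2 * (\<Sum>a\<in>X. \<Sum>b\<in>X. if h i a = h i b then 0 else \<pi>' a b)
        \<le> (\<Sum>c\<in>h i ` X. \<bar>D c - (if h i x = c then t else 0) + (if h i y = c then t else 0)\<bar>)
          + (if h i x = h i y then 0 else 2 * t)"
        using \<pi>h[OF i] unfolding D' by auto
      show ?thesis
      proof (cases "h i x = h i y")
        case True
        with lhs show ?thesis by (simp add: D_def)
      next
        case False
        \<comment> \<open>By \<open>sep\<close>, the cell of \<open>x\<close> contains no mass of
          \<open>Q\<close>, so the signed difference there is the mass of \<open>P\<close>, at least
          \<open>t\<close>. The cell of \<open>y\<close> is treated symmetrically.\<close>
        have Dx: "t \<le> D (h i x)"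
        proof -
          have "t \<le> (\<Sum>a\<in>X. if h i a = h i x then P a else 0)"
          proof -
            have "P x \<le> (\<Sum>a\<in>X. if h i a = h i x then P a else 0)"
              using member_le_sum[of x X "\<lambda>a. if h i a = h i x then P a else 0"] x fin P0 by auto
            with t show ?thesis by simp
          qed
          also have "\<dots> = D (h i x)" unfolding D_def
          proof (intro sum.cong refl)
            fix a assume a: "a \<in> X"
            have "Q a = 0" if "h i a = h i x"
              using sep[OF i False x a] that Q0[of a] by force
            thus "(if h i a = h i x then P a else 0) = (if h i a = h i x then P a - Q a else 0)" by simp
          qed
          finally show ?thesis .
        qed
        have Dy: "D (h i y) \<le> - t"
        proof -
          have "t \<le> (\<Sum>a\<in>X. if h i a = h i y then Q a else 0)"
          proof -
            have "Q y \<le> (\<Sum>a\<in>X. if h i a = h i y then Q a else 0)"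
              using member_le_sum[of y X "\<lambda>a. if h i a = h i y then Q a else 0"] y fin Q0 by auto
            with t show ?thesis by simp
          qed
          also have "\<dots> = - D (h i y)" unfolding D_def sum_negf[symmetric]
          proof (intro sum.cong refl)
            fix a assume a: "a \<in> X"
            have "P a = 0" if "h i a = h i y"
              using sep[OF i False a _ y] that P0[of a] by force
            thus "(if h i a = h i y then Q a else 0) = - (if h i a = h i y then P a - Q a else 0)" by simp
          qed
          finally show ?thesis by simp
        qed
        \<comment> \<open>The cells of \<open>x\<close> and \<open>y\<close> differ, so no cell
          receives both corrections, and each correction lowers an absolute value by exactly
          \<open>t\<close>.\<close>
        have "(\<Sum>c\<in>h i ` X. \<bar>D c - (if h i x = c then t else 0) + (if h i y = c then t else 0)\<bar>)
          = (\<Sum>c\<in>h i ` X. \<bar>D c\<bar> - (if h i x = c then t else 0) - (if h i y = c then t else 0))"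
          using Dx Dy t False by (intro sum.cong refl) auto
        also have "\<dots> = (\<Sum>c\<in>h i ` X. \<bar>D c\<bar>) - t - t"
          using fin x y by (simp add: sum_subtractf)
        finally show ?thesis using lhs False by (simp add: D_def)
      qed
    qed
    moreover have "(\<Sum>b\<in>X. \<pi>' a b) = P a" if "a \<in> X" for a
      using \<pi>P[OF that] fin y by (cases "a = x") (auto simp: \<pi>'_def sum.distrib P'eq)
    moreover have "(\<Sum>a\<in>X. \<pi>' a b) = Q b" if "b \<in> X" for b
      using \<pi>Q[OF that] fin x by (cases "b = y") (auto simp: \<pi>'_def sum.distrib Q'eq)
    moreover have "0 \<le> \<pi>' a b" for a b using \<pi>0[of a b] t by (simp add: \<pi>'_def)
    ultimately show ?thesis by (intro exI[of _ \<pi>'] conjI allI ballI impI)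
  qed
qed

text \<open>The transport plan has total mass 1, so after extension by zero it is the mass function
  of a \<open>pmf\<close>. Its marginals agree with \<open>\<mu>\<close> and \<open>\<nu>\<close>
  also off \<open>X\<close>, where all of them vanish.\<close>

lemma multilevel_coupling:
  fixes \<mu> \<nu> :: "'a pmf" and h :: "nat \<Rightarrow> 'a \<Rightarrow> 'b"
  assumes fin: "finite X" and \<mu>: "set_pmf \<mu> \<subseteq> X" and \<nu>: "set_pmf \<nu> \<subseteq> X"
    and nested: "\<forall>j\<le>L. \<forall>i\<le>j. \<forall>x\<in>X. \<forall>y\<in>X. h j x = h j y \<longrightarrow> h i x = h i y"
  obtains \<pi> where "\<pi> \<in> couplings \<mu> \<nu>" "set_pmf \<pi> \<subseteq> X \<times> X"
    "\<And>i. i \<le> L \<Longrightarrow> 2 * prb \<pi> {(x, y). h i x \<noteq> h i y}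
       \<le> (\<Sum>c\<in>h i ` X. \<bar>pmf (map_pmf (h i) \<mu>) c - pmf (map_pmf (h i) \<nu>) c\<bar>)"
proof -
  have mass: "sum (pmf \<mu>) X = sum (pmf \<nu>) X"
    using sum_pmf_eq_1[OF fin \<mu>] sum_pmf_eq_1[OF fin \<nu>] by simp
  obtain f where f0: "\<And>x y. 0 \<le> f x y"
    and fP: "\<And>x. x \<in> X \<Longrightarrow> (\<Sum>y\<in>X. f x y) = pmf \<mu> x"
    and fQ: "\<And>y. y \<in> X \<Longrightarrow> (\<Sum>x\<in>X. f x y) = pmf \<nu> y"
    and fh: "\<And>i. i \<le> L \<Longrightarrow> 2 * (\<Sum>x\<in>X. \<Sum>y\<in>X. if h i x = h i y then 0 else f x y)
       \<le> (\<Sum>c\<in>h i ` X. \<bar>\<Sum>x\<in>X. if h i x = c then pmf \<mu> x - pmf \<nu> x else 0\<bar>)"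
    using multilevel_transport[of X L h "pmf \<mu>" "pmf \<nu>", OF fin nested pmf_nonneg pmf_nonneg mass]
    by (elim exE conjE) blast
  define g where "g z = (if z \<in> X \<times> X then f (fst z) (snd z) else 0)" for z
  have g0: "0 \<le> g z" for z by (simp add: g_def f0)
  have total: "(\<Sum>z\<in>X \<times> X. g z) = 1"
  proof -
    have "(\<Sum>z\<in>X \<times> X. g z) = (\<Sum>x\<in>X. \<Sum>y\<in>X. f x y)"
      unfolding sum.cartesian_product by (intro sum.cong refl) (auto simp: g_def)
    also have "\<dots> = (\<Sum>x\<in>X. pmf \<mu> x)" using fP by (intro sum.cong refl) auto
    finally show ?thesis using sum_pmf_eq_1[OF fin \<mu>] by simp
  qed
  have "(\<integral>\<^sup>+z. ennreal (g z) \<partial>count_space UNIV) = (\<Sum>z\<in>X \<times> X. ennreal (g z))"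
    using fin by (intro nn_integral_count_space') (simp_all add: g_def)
  also have "\<dots> = 1" using g0 total by (simp add: sum_ennreal)
  finally have one: "(\<integral>\<^sup>+z. ennreal (g z) \<partial>count_space UNIV) = 1" .
  define \<pi> where "\<pi> = embed_pmf g"
  have pmf_\<pi>: "pmf \<pi> z = g z" for z
    unfolding \<pi>_def using g0 one by (rule pmf_embed_pmf)
  have sub: "set_pmf \<pi> \<subseteq> X \<times> X"
    by (auto simp: set_pmf_eq pmf_\<pi> g_def split: if_splits)
  have prob: "prb \<pi> A = (\<Sum>x\<in>X. \<Sum>y\<in>X. if (x, y) \<in> A then f x y else 0)" for A
  proof -
    have "prb \<pi> A = expct \<pi> (indicator A)" by simp
    also have "\<dots> = (\<Sum>z\<in>X \<times> X. g z * indicator A z)"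
      using fin sub by (subst expct_superset[of "X \<times> X"]) (auto simp: pmf_\<pi>)
    also have "\<dots> = (\<Sum>x\<in>X. \<Sum>y\<in>X. if (x, y) \<in> A then f x y else 0)"
      unfolding sum.cartesian_product by (intro sum.cong refl) (auto simp: g_def indicator_def)
    finally show ?thesis .
  qed
  have level: "pmf (map_pmf u \<rho>) c = (\<Sum>x\<in>X. if u x = c then pmf \<rho> x else 0)"
    if "set_pmf \<rho> \<subseteq> X" for u :: "'a \<Rightarrow> 'c" and c and \<rho> :: "'a pmf"
  proof -
    have "pmf (map_pmf u \<rho>) c = expct \<rho> (indicator (u -` {c}))"
      by (simp add: pmf_map)
    also have "\<dots> = (\<Sum>x\<in>X. if u x = c then pmf \<rho> x else 0)"
      unfolding expct_superset[OF fin that] by (intro sum.cong refl) (auto simp: indicator_def)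
    finally show ?thesis .
  qed
  show thesis
  proof (rule that[OF _ sub])
    have "pmf (map_pmf fst \<pi>) x = pmf \<mu> x" for x
    proof (cases "x \<in> X")
      case True
      have "pmf (map_pmf fst \<pi>) x = (\<Sum>a\<in>X. \<Sum>b\<in>X. if a = x then f a b else 0)"
        unfolding pmf_map prob by (intro sum.cong refl) auto
      also have "\<dots> = (\<Sum>a\<in>X. if a = x then \<Sum>b\<in>X. f a b else 0)" by (intro sum.cong) auto
      finally show ?thesis using True fin fP by simp
    next
      case False
      have "x \<notin> set_pmf (map_pmf fst \<pi>)" "x \<notin> set_pmf \<mu>" using False sub \<mu> by auto
      thus ?thesis by (simp only: set_pmf_iff) simp
    qed
    moreover have "pmf (map_pmf snd \<pi>) y = pmf \<nu> y" for y
    proof (cases "y \<in> X")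
      case True
      have "pmf (map_pmf snd \<pi>) y = (\<Sum>a\<in>X. \<Sum>b\<in>X. if b = y then f a b else 0)"
        unfolding pmf_map prob by (intro sum.cong refl) auto
      also have "\<dots> = (\<Sum>b\<in>X. if b = y then \<Sum>a\<in>X. f a b else 0)"
        by (subst sum.swap) (intro sum.cong, auto)
      finally show ?thesis using True fin fQ by simp
    next
      case False
      have "y \<notin> set_pmf (map_pmf snd \<pi>)" "y \<notin> set_pmf \<nu>" using False sub \<nu> by auto
      thus ?thesis by (simp only: set_pmf_iff) simp
    qed
    ultimately show "\<pi> \<in> couplings \<mu> \<nu>" unfolding couplings_def by (auto intro: pmf_eqI)
  next
    fix i assume i: "i \<le> L"
    have "prb \<pi> {(x, y). h i x \<noteq> h i y} = (\<Sum>x\<in>X. \<Sum>y\<in>X. if h i x = h i y then 0 else f x y)"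
      unfolding prob by (intro sum.cong refl) auto
    moreover have "(\<Sum>x\<in>X. if h i x = c then pmf \<mu> x - pmf \<nu> x else 0)
        = pmf (map_pmf (h i) \<mu>) c - pmf (map_pmf (h i) \<nu>) c" for c
      unfolding level[OF \<mu>] level[OF \<nu>] sum_subtractf[symmetric] by (intro sum.cong refl) auto
    ultimately show "2 * prb \<pi> {(x, y). h i x \<noteq> h i y}
       \<le> (\<Sum>c\<in>h i ` X. \<bar>pmf (map_pmf (h i) \<mu>) c - pmf (map_pmf (h i) \<nu>) c\<bar>)"
      using fh[OF i] by simp
  qed
qed

section \<open>Connected cells of the grid\<close>

text \<open>Closeness in the unnormalised l_infinity norm. Cells and dyadic boxes are measured in
  it, because it controls the normalised lp metric for every \<open>p \<ge> 1\<close>.\<close>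

definition coord_close :: "nat \<Rightarrow> real \<Rightarrow> (nat \<Rightarrow> nat) \<Rightarrow> (nat \<Rightarrow> nat) \<Rightarrow> bool" where
  "coord_close d r x y \<longleftrightarrow> (\<forall>i\<in>{1..d}. \<bar>real (x i) - real (y i)\<bar> \<le> r)"

lemma coord_close_sym: "coord_close d r x y \<Longrightarrow> coord_close d r y x"
  by (auto simp: coord_close_def abs_minus_commute)

lemma coord_close_trans:
  assumes "coord_close d r x y" "coord_close d s y z"
  shows "coord_close d (r + s) x z"
  unfolding coord_close_def
proof
  fix i assume "i \<in> {1..d}"
  hence "\<bar>real (x i) - real (y i)\<bar> \<le> r" "\<bar>real (y i) - real (z i)\<bar> \<le> s"
    using assms by (auto simp: coord_close_def)
  thus "\<bar>real (x i) - real (z i)\<bar> \<le> r + s" by linarith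
qed

lemma coord_close_mono: "coord_close d r x y \<Longrightarrow> r \<le> s \<Longrightarrow> coord_close d s x y"
  by (force simp: coord_close_def)

lemma finite_grid [simp]: "finite (grid n d)"
  by (simp add: grid_def finite_PiE)

lemma grid_range: "x \<in> grid n d \<Longrightarrow> i \<in> {1..d} \<Longrightarrow> 1 \<le> x i \<and> x i \<le> n"
  by (auto simp: grid_def PiE_def Pi_def)

lemma coord_close_grid: "x \<in> grid n d \<Longrightarrow> y \<in> grid n d \<Longrightarrow> coord_close d (real n) x y"
  unfolding coord_close_def using grid_range by (smt (verit) of_nat_0_le_iff of_nat_le_iff)

lemma lp_dist_nonneg: "0 \<le> lp_dist p n d x y"
  by (simp add: lp_dist_def)

text \<open>Each of the \<open>d\<close> summands is at most \<open>r powr p\<close>, and the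
  normalising factor \<open>d powr (1 / p)\<close> cancels their number.\<close>

lemma lp_dist_le_coord:
  assumes "1 \<le> p" "1 \<le> d" "1 \<le> n" "coord_close d r x y" 
  shows "lp_dist p n d x y \<le> r / real n"
proof -
  have "1 \<in> {1..d}" using assms by simp
  hence r0: "0 \<le> r" using assms(4) unfolding coord_close_def by force
  have "(\<Sum>i=1..d. \<bar>real (x i) - real (y i)\<bar> powr p) \<le> (\<Sum>i=1..d. r powr p)"
    using assms by (intro sum_mono powr_mono2) (auto simp: coord_close_def)
  hence "(\<Sum>i=1..d. \<bar>real (x i) - real (y i)\<bar> powr p) powr (1/p) \<le> (real d * r powr p) powr (1/p)"
    using assms by (intro powr_mono2) (auto intro: sum_nonneg)
  also have "\<dots> = real d powr (1/p) * r"
    using r0 assms by (simp add: powr_mult powr_powr)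
  finally have "lp_dist p n d x y \<le> (real d powr (1/p) * r) / (real d powr (1/p) * real n)"
    unfolding lp_dist_def by (intro divide_right_mono) auto
  also have "\<dots> = r / real n" using assms by simp
  finally show ?thesis .
qed

text \<open>A single coordinate is at most the unnormalised p-norm. The factor
  \<open>d powr (1 / p)\<close> lost here is the one by which the admissible \<open>\<Delta>\<close>
  is divided.\<close>

lemma coord_close_of_lp_dist:
  assumes "1 \<le> p" "1 \<le> d" "1 \<le> n" "lp_dist p n d x y \<le> D"
  shows "coord_close d (D * real d powr (1/p) * real n) x y"
  unfolding coord_close_def
proof
  fix i assume i: "i \<in> {1..d}"
  let ?S = "\<Sum>i=1..d. \<bar>real (x i) - real (y i)\<bar> powr p"
  have "\<bar>real (x i) - real (y i)\<bar> powr p \<le> ?S"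
    by (rule member_le_sum[OF i, of "\<lambda>i. \<bar>real (x i) - real (y i)\<bar> powr p"]) auto
  hence "(\<bar>real (x i) - real (y i)\<bar> powr p) powr (1/p) \<le> ?S powr (1/p)"
    using assms by (intro powr_mono2) auto
  hence "\<bar>real (x i) - real (y i)\<bar> \<le> ?S powr (1/p)" using assms by (simp add: powr_powr)
  also have "\<dots> = lp_dist p n d x y * (real d powr (1/p) * real n)"
    using assms by (simp add: lp_dist_def)
  also have "\<dots> \<le> D * (real d powr (1/p) * real n)"
    using assms by (intro mult_right_mono) auto
  finally show "\<bar>real (x i) - real (y i)\<bar> \<le> D * real d powr (1/p) * real n" by (simp add: mult.assoc)
qed

lemma le_diam:
  assumes "finite S" "x \<in> S" "y \<in> S"
  shows "\<rho> x y \<le> diam \<rho> S"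
proof -
  have "(\<lambda>(x, y). \<rho> x y) (x, y) \<le> (SUP (x, y)\<in>S \<times> S. \<rho> x y)"
    using assms by (intro cSUP_upper) (auto intro!: bdd_above_finite)
  thus ?thesis by (simp add: diam_def)
qed

section \<open>Cells and labels of a clustering\<close>

lemma clustering_cell:
  assumes "K \<in> clusterings X" "x \<in> X"
  shows "cell_of K x \<in> fst K" "x \<in> cell_of K x" "label K x \<in> cell_of K x"
proof -
  from assms have part: "partition_on X (fst K)" and rep: "\<forall>A\<in>fst K. snd K A \<in> A"
    by (auto simp: clusterings_def)
  have "\<exists>!A. A \<in> fst K \<and> x \<in> A"
  proof (rule ex_ex1I)
    show "\<exists>A. A \<in> fst K \<and> x \<in> A" using partition_onD1[OF part] assms(2) by blast
    show "A = B" if "A \<in> fst K \<and> x \<in> A" "B \<in> fst K \<and> x \<in> B" for A B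
      using disjointD[OF partition_onD2[OF part], of A B] that by blast
  qed
  from theI'[OF this] have *: "cell_of K x \<in> fst K \<and> x \<in> cell_of K x"
    unfolding cell_of_def .
  thus "cell_of K x \<in> fst K" "x \<in> cell_of K x" "label K x \<in> cell_of K x"
    using rep by (auto simp: label_def)
qed

lemma clustering_cell_eq:
  assumes "K \<in> clusterings X" "A \<in> fst K" "x \<in> A"
  shows "cell_of K x = A"
proof -
  from assms have part: "partition_on X (fst K)" by (auto simp: clusterings_def)
  hence "x \<in> X" using assms by (auto simp: partition_on_def)
  from clustering_cell[OF assms(1) this] show ?thesis
    using disjointD[OF partition_onD2[OF part], of A "cell_of K x"] assms by blast
qed

lemma clustering_cell_subset: "K \<in> clusterings X \<Longrightarrow> x \<in> X \<Longrightarrow> cell_of K x \<subseteq> X"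
  using clustering_cell(1)[of K X x] by (auto simp: clusterings_def partition_on_def)

lemma label_in: "K \<in> clusterings X \<Longrightarrow> x \<in> X \<Longrightarrow> label K x \<in> X"
  by (rule subsetD[OF clustering_cell_subset clustering_cell(3)])

text \<open>A representative lies in its own cell, so points with equal labels share a cell. One
  label query thus decides whether a point belongs to the cell of a given sample.\<close>

lemma label_eq_iff:
  assumes "K \<in> clusterings X" "x \<in> X" "z \<in> X"
  shows "label K z = label K x \<longleftrightarrow> z \<in> cell_of K x"
proof
  assume "label K z = label K x"
  with clustering_cell[OF assms(1,2)] clustering_cell[OF assms(1,3)]
  have "label K z \<in> cell_of K x" "label K z \<in> cell_of K z" by auto
  hence "cell_of K z = cell_of K x"
    using clustering_cell_eq[OF assms(1)] clustering_cell[OF assms(1,2)] clustering_cell[OF assms(1,3)]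
    by metis
  thus "z \<in> cell_of K x" using clustering_cell[OF assms(1,3)] by simp
next
  assume "z \<in> cell_of K x"
  hence "cell_of K z = cell_of K x"
    using clustering_cell_eq[OF assms(1)] clustering_cell[OF assms(1,2)] by blast
  thus "label K z = label K x" by (simp add: label_def)
qed

text \<open>For \<open>y\<close> in the grid this is the outer vertex boundary, in the grid graph,
  of the l_infinity ball of radius \<open>r\<close> around \<open>y\<close>. Corners of the larger
  cube are absent, as no grid edge leads to them from the ball.\<close>

definition shell :: "nat \<Rightarrow> nat \<Rightarrow> nat \<Rightarrow> (nat \<Rightarrow> nat) \<Rightarrow> (nat \<Rightarrow> nat) set" where
  "shell n d r y = {z \<in> grid n d. \<exists>j\<in>{1..d}. \<bar>int (z j) - int (y j)\<bar> = int r + 1 \<and>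
     (\<forall>i\<in>{1..d} - {j}. \<bar>int (z i) - int (y i)\<bar> \<le> int r)}"

lemma finite_shell [simp]: "finite (shell n d r y)"
  by (rule finite_subset[of _ "grid n d"]) (auto simp: shell_def)

text \<open>There are \<open>d\<close> choices of the exceptional coordinate, two values for it and
  \<open>2 * r + 1\<close> values for each of the others.\<close>

lemma card_shell_le: "card (shell n d r y) \<le> 2 * d * (2 * r + 1) ^ (d - 1)"
proof -
  \<comment> \<open>Truncated subtraction does no harm: every natural number at the required
    distance is still covered, and the ranges do not grow.\<close>
  define F where "F j = (\<Pi>\<^sub>E i\<in>{1..d}. if i = j then {y j + (r + 1), y j - (r + 1)}
      else {y i - r..y i + r})" for j
  have "shell n d r y \<subseteq> (\<Union>j\<in>{1..d}. F j)"
  proof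
    fix z assume "z \<in> shell n d r y"
    then obtain j where z: "z \<in> grid n d" and j: "j \<in> {1..d}"
      "\<bar>int (z j) - int (y j)\<bar> = int r + 1"
      and i: "\<And>i. i \<in> {1..d} - {j} \<Longrightarrow> \<bar>int (z i) - int (y i)\<bar> \<le> int r"
      by (auto simp: shell_def)
    have "z \<in> F j"
      unfolding F_def
    proof (rule PiE_I)
      fix k assume k: "k \<in> {1..d}"
      show "z k \<in> (if k = j then {y j + (r + 1), y j - (r + 1)} else {y k - r..y k + r})"
      proof (cases "k = j")
        case True
        thus ?thesis using j(2) by auto
      next
        case False
        thus ?thesis using i[of k] k by auto
      qed
    qed (use z in \<open>auto simp: grid_def PiE_def extensional_def\<close>)
    thus "z \<in> (\<Union>j\<in>{1..d}. F j)" using j by auto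
  qed
  hence "card (shell n d r y) \<le> card (\<Union>j\<in>{1..d}. F j)"
    by (intro card_mono) (auto simp: F_def intro!: finite_PiE)
  also have "\<dots> \<le> (\<Sum>j\<in>{1..d}. card (F j))" by (intro card_UN_le) auto
  also have "\<dots> \<le> (\<Sum>j\<in>{1..d}. 2 * (2 * r + 1) ^ (d - 1))"
  proof (intro sum_mono)
    fix j assume j: "j \<in> {1..d}"
    have "card (F j) = (\<Prod>i\<in>{1..d}. card (if i = j then {y j + (r + 1), y j - (r + 1)}
      else {y i - r..y i + r}))"
      unfolding F_def by (intro card_PiE) auto
    also have "\<dots> = card {y j + (r + 1), y j - (r + 1)} * (\<Prod>i\<in>{1..d} - {j}. card {y i - r..y i + r})"
      using j by (subst prod.remove[of _ j]) auto
    also have "\<dots> \<le> 2 * (\<Prod>i\<in>{1..d} - {j}. 2 * r + 1)"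
      by (intro mult_mono prod_mono) (auto simp: card_insert_if)
    also have "\<dots> = 2 * (2 * r + 1) ^ (d - 1)" using j by simp
    finally show "card (F j) \<le> 2 * (2 * r + 1) ^ (d - 1)" .
  qed
  finally show ?thesis by simp
qed

lemma grid_edge_one_coord:
  assumes "(u, v) \<in> grid_edges n d"
  obtains j where "j \<in> {1..d}" "\<bar>int (u j) - int (v j)\<bar> = 1"
    "\<And>i. i \<in> {1..d} \<Longrightarrow> i \<noteq> j \<Longrightarrow> u i = v i"
proof -
  have sum1: "(\<Sum>i=1..d. \<bar>int (u i) - int (v i)\<bar>) = 1"
    using assms by (simp add: grid_edges_def)
  hence "\<exists>j\<in>{1..d}. \<bar>int (u j) - int (v j)\<bar> \<noteq> 0"
    by (metis (no_types, lifting) sum.neutral zero_neq_one)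
  then obtain j where j: "j \<in> {1..d}" "\<bar>int (u j) - int (v j)\<bar> \<noteq> 0" by blast
  have rest: "(\<Sum>i=1..d. \<bar>int (u i) - int (v i)\<bar>)
      = \<bar>int (u j) - int (v j)\<bar> + (\<Sum>i\<in>{1..d} - {j}. \<bar>int (u i) - int (v i)\<bar>)"
    using j by (intro sum.remove) auto
  have ge: "0 \<le> (\<Sum>i\<in>{1..d} - {j}. \<bar>int (u i) - int (v i)\<bar>)" by (intro sum_nonneg) auto
  hence j1: "\<bar>int (u j) - int (v j)\<bar> = 1"
    and 0: "(\<Sum>i\<in>{1..d} - {j}. \<bar>int (u i) - int (v i)\<bar>) = 0" using rest sum1 j by linarith+
  from 0 have "\<forall>i\<in>{1..d} - {j}. \<bar>int (u i) - int (v i)\<bar> = 0"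
    by (subst (asm) sum_nonneg_eq_0_iff) auto
  with j j1 show thesis by (intro that[of j]) auto
qed

text \<open>A path in \<open>A\<close> from \<open>y\<close> to \<open>x\<close> starts inside the
  ball and changes one coordinate by one in each step, so its first point outside the ball would lie
  in the shell.\<close>

lemma connected_avoiding_shell_close:
  assumes conn: "grid_connected n d A" and A: "A \<subseteq> grid n d" and y: "y \<in> A" and x: "x \<in> A"
    and miss: "A \<inter> shell n d r y = {}"
  shows "coord_close d (real r) x y"
proof -
  have "(y, x) \<in> (grid_edges n d \<inter> A \<times> A)\<^sup>*"
    using conn x y by (auto simp: grid_connected_def)
  hence "\<forall>i\<in>{1..d}. \<bar>int (x i) - int (y i)\<bar> \<le> int r"
  proof (induction rule: rtrancl_induct)
    case (step u v)
    hence uv: "(u, v) \<in> grid_edges n d" "v \<in> A" by auto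
    from grid_edge_one_coord[OF uv(1)] obtain j where j: "j \<in> {1..d}" "\<bar>int (u j) - int (v j)\<bar> = 1"
      and eq: "\<And>i. i \<in> {1..d} \<Longrightarrow> i \<noteq> j \<Longrightarrow> u i = v i" by blast
    have others: "\<bar>int (v i) - int (y i)\<bar> \<le> int r" if "i \<in> {1..d}" "i \<noteq> j" for i
      using step.IH that eq[OF that] by force
    have "\<bar>int (v j) - int (y j)\<bar> \<le> int r"
    proof (rule ccontr)
      assume "\<not> ?thesis"
      moreover have "\<bar>int (u j) - int (y j)\<bar> \<le> int r" using step.IH j by blast
      ultimately have "\<bar>int (v j) - int (y j)\<bar> = int r + 1" using j(2) by linarith
      hence "v \<in> shell n d r y" unfolding shell_def
        using others j(1) uv A by (intro CollectI conjI bexI[of _ j] ballI) auto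
      thus False using miss uv by blast
    qed
    thus ?case using others by blast
  qed simp
  hence "\<forall>i\<in>{1..d}. real_of_int \<bar>int (x i) - int (y i)\<bar> \<le> real_of_int (int r)"
    by (simp only: of_int_le_iff)
  thus ?thesis by (simp add: coord_close_def)
qed

text \<open>Phrased through labels only, so that querying the shell around a sampled representative
  \<open>y\<close> decides it.\<close>

definition bad_label :: "nat \<Rightarrow> nat \<Rightarrow> nat \<Rightarrow> (nat \<Rightarrow> nat) clustering \<Rightarrow> (nat \<Rightarrow> nat) \<Rightarrow> bool" where
  "bad_label n d r K y \<longleftrightarrow> y \<in> label K ` shell n d r y"

lemma bad_label_iff:
  assumes "K \<in> clusterings (grid n d)" "x \<in> grid n d"
  shows "bad_label n d r K (label K x) \<longleftrightarrow> cell_of K x \<inter> shell n d r (label K x) \<noteq> {}"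
proof -
  have "bad_label n d r K (label K x)
      \<longleftrightarrow> (\<exists>z\<in>shell n d r (label K x). label K z = label K x)"
    by (auto simp: bad_label_def image_iff eq_commute)
  also have "\<dots> \<longleftrightarrow> (\<exists>z\<in>shell n d r (label K x). z \<in> cell_of K x)"
    using label_eq_iff[OF assms] by (auto simp: shell_def)
  finally show ?thesis by blast
qed

lemma good_label_close:
  assumes K: "K \<in> CONN n d" and x: "x \<in> grid n d" and good: "\<not> bad_label n d r K (label K x)"
  shows "coord_close d (real r) x (label K x)"
proof -
  have K': "K \<in> clusterings (grid n d)" and conn: "\<forall>A\<in>fst K. grid_connected n d A"
    using K by (auto simp: CONN_def)
  show ?thesis
    using good bad_label_iff[OF K' x] clustering_cell[OF K' x] conn clustering_cell_subset[OF K' x]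
    by (intro connected_avoiding_shell_close[of n d "cell_of K x"]) auto
qed

text \<open>A cell that meets the shell has a point differing from its representative by
  \<open>r + 1 > \<epsilon> * n / 8\<close> in some coordinate, whereas diameter at most
  \<open>\<Delta>\<close> allows only \<open>\<epsilon> * n / 8\<close>.\<close>

lemma small_cell_good:
  assumes K: "K \<in> clusterings (grid n d)" and x: "x \<in> grid n d"
    and p: "1 \<le> p" "1 \<le> d" "1 \<le> n"
    and \<Delta>: "\<Delta> \<le> 1 / (8 * real d powr (1 / p)) * \<epsilon>"
    and small: "diam (lp_dist p n d) (cell_of K x) \<le> \<Delta>"
    and r: "r = nat \<lfloor>\<epsilon> * real n / 8\<rfloor>"
  shows "\<not> bad_label n d r K (label K x)"
proof
  assume "bad_label n d r K (label K x)"
  then obtain z where z: "z \<in> cell_of K x" "z \<in> shell n d r (label K x)"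
    using bad_label_iff[OF K x] by blast
  have "finite (cell_of K x)"
    using clustering_cell_subset[OF K x] finite_grid finite_subset by blast
  hence "lp_dist p n d z (label K x) \<le> diam (lp_dist p n d) (cell_of K x)"
    using z clustering_cell(3)[OF K x] by (intro le_diam)
  hence "lp_dist p n d z (label K x) \<le> 1 / (8 * real d powr (1 / p)) * \<epsilon>"
    using small \<Delta> by simp
  from coord_close_of_lp_dist[OF p this]
  have "coord_close d (\<epsilon> * real n / 8) z (label K x)" using p by simp
  moreover from z obtain j where j: "j \<in> {1..d}" "\<bar>int (z j) - int (label K x j)\<bar> = int r + 1"
    by (auto simp: shell_def)
  moreover have "real_of_int \<bar>int (z j) - int (label K x j)\<bar> = \<bar>real (z j) - real (label K x j)\<bar>"
    by simp
  ultimately have "real_of_int \<bar>int (z j) - int (label K x j)\<bar> \<le> \<epsilon> * real n / 8"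
    unfolding coord_close_def by (simp only:)
  hence "real r + 1 \<le> \<epsilon> * real n / 8" unfolding j(2) by simp
  thus False unfolding r by linarith
qed

section \<open>Dyadic cells and the earth mover's distance\<close>

text \<open>Coordinates are shifted to start at 0, scaled by \<open>2 ^ i / n\<close> and rounded
  down. This treats all \<open>n\<close> alike, powers of two or not; boxes may be empty once
  \<open>2 ^ i\<close> exceeds \<open>n\<close>.\<close>

definition dyadic_cell :: "nat \<Rightarrow> nat \<Rightarrow> nat \<Rightarrow> (nat \<Rightarrow> nat) \<Rightarrow> nat \<Rightarrow> nat" where
  "dyadic_cell n d i x = (\<lambda>j\<in>{1..d}. (2 ^ i * (x j - 1)) div n)"

definition dyadic_cells :: "nat \<Rightarrow> nat \<Rightarrow> (nat \<Rightarrow> nat) set" where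
  "dyadic_cells d i = {1..d} \<rightarrow>\<^sub>E {..<2 ^ i}"

lemma finite_dyadic_cells [simp]: "finite (dyadic_cells d i)"
  by (simp add: dyadic_cells_def finite_PiE)

lemma card_dyadic_cells: "card (dyadic_cells d i) = 2 ^ (i * d)"
  by (simp add: dyadic_cells_def card_PiE power_mult)

lemma dyadic_cell_in:
  assumes "x \<in> grid n d"
  shows "dyadic_cell n d i x \<in> dyadic_cells d i"
proof -
  have "2 ^ i * (x j - 1) < 2 ^ i * n" if "j \<in> {1..d}" for j
    using grid_range[OF assms that] by (intro mult_strict_left_mono) auto
  thus ?thesis by (auto simp: dyadic_cell_def dyadic_cells_def intro!: less_mult_imp_div_less)
qed

text \<open>Iterated floors: dividing the index at level \<open>j\<close> by
  \<open>2 ^ (j - i)\<close> yields the index at level \<open>i\<close>.\<close>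

lemma dyadic_cell_nested:
  assumes "i \<le> j" "dyadic_cell n d j x = dyadic_cell n d j y"
  shows "dyadic_cell n d i x = dyadic_cell n d i y"
proof -
  have *: "(2 ^ i * a) div n = ((2 ^ j * a) div n) div 2 ^ (j - i)" for a :: nat
  proof -
    have "(2 ^ j * a) div n div 2 ^ (j - i) = (2 ^ i * a * 2 ^ (j - i)) div (n * 2 ^ (j - i))"
      using assms(1) by (simp add: div_mult2_eq mult_ac flip: power_add)
    thus ?thesis by simp
  qed
  have "(2 ^ i * (x k - 1)) div n = (2 ^ i * (y k - 1)) div n" if "k \<in> {1..d}" for k
    using fun_cong[OF assms(2), of k] that unfolding *[of "x k - 1"] *[of "y k - 1"]
    by (simp add: dyadic_cell_def)
  thus ?thesis by (auto simp: dyadic_cell_def restrict_def)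
qed

text \<open>Equal quotients by \<open>n\<close> leave only the remainders to differ, by less than
  \<open>n\<close>, and the scaling by \<open>2 ^ i\<close> is undone at the end.\<close>

lemma same_dyadic_cell_close:
  assumes "1 \<le> n" "x \<in> grid n d" "y \<in> grid n d" "dyadic_cell n d i x = dyadic_cell n d i y"
  shows "coord_close d (real n / 2 ^ i) x y"
  unfolding coord_close_def
proof
  fix j assume j: "j \<in> {1..d}"
  let ?a = "x j - 1" and ?b = "y j - 1"
  have eq: "(2 ^ i * ?a) div n = (2 ^ i * ?b) div n"
    using fun_cong[OF assms(4), of j] j by (simp add: dyadic_cell_def)
  have "\<bar>real (2 ^ i * ?a) - real (2 ^ i * ?b)\<bar> \<le> real n"
  proof -
    have "2 ^ i * ?a = n * ((2 ^ i * ?a) div n) + (2 ^ i * ?a) mod n" by simp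
    moreover have "2 ^ i * ?b = n * ((2 ^ i * ?a) div n) + (2 ^ i * ?b) mod n"
      unfolding eq by simp
    moreover have "(2 ^ i * ?a) mod n < n" "(2 ^ i * ?b) mod n < n" using assms by auto
    ultimately show ?thesis by linarith
  qed
  moreover have "real (2 ^ i * ?a) - real (2 ^ i * ?b) = 2 ^ i * (real (x j) - real (y j))"
    using grid_range[OF assms(2) j] grid_range[OF assms(3) j] by (simp add: of_nat_diff algebra_simps)
  ultimately have "\<bar>2 ^ i * (real (x j) - real (y j))\<bar> \<le> real n" by (simp only:)
  thus "\<bar>real (x j) - real (y j)\<bar> \<le> real n / 2 ^ i"
    by (simp add: abs_mult pos_le_divide_eq mult.commute flip: right_diff_distrib)
qed

text \<open>Induction on \<open>L\<close>. Agreement on the new level bounds the distance directly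
  by \<open>n / 2 ^ Suc L\<close>; under disagreement the new summand and the new tail add up to the
  old tail \<open>1 / 2 ^ L\<close>, so the bound is unchanged.\<close>

lemma dyadic_distance_bound:
  assumes "1 \<le> n" "x \<in> grid n d" "y \<in> grid n d"
  shows "coord_close d (real n * (1 / 2 ^ L
    + (\<Sum>i=1..L. if dyadic_cell n d i x = dyadic_cell n d i y then 0 else 1 / 2 ^ i))) x y"
proof (induction L)
  case 0
  show ?case using coord_close_grid assms by simp
next
  case (Suc L)
  show ?case
  proof (cases "dyadic_cell n d (Suc L) x = dyadic_cell n d (Suc L) y")
    case True
    have "0 \<le> (\<Sum>i=1..Suc L. if dyadic_cell n d i x = dyadic_cell n d i y then 0 else 1 / 2 ^ i :: real)"
      by (intro sum_nonneg) auto
    hence "real n * (1 / 2 ^ Suc L) \<le> real n * (1 / 2 ^ Suc L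
      + (\<Sum>i=1..Suc L. if dyadic_cell n d i x = dyadic_cell n d i y then 0 else 1 / 2 ^ i))"
      by (intro mult_left_mono) auto
    moreover have "coord_close d (real n * (1 / 2 ^ Suc L)) x y"
      using same_dyadic_cell_close[OF assms True] by simp
    ultimately show ?thesis by (rule coord_close_mono[rotated])
  next
    case False
    hence eq: "1 / 2 ^ Suc L + (\<Sum>i=1..Suc L. if dyadic_cell n d i x = dyadic_cell n d i y then 0 else 1 / 2 ^ i)
      = (1 / 2 ^ L + (\<Sum>i=1..L. if dyadic_cell n d i x = dyadic_cell n d i y then 0 else 1 / 2 ^ i) :: real)"
      by simp
    show ?thesis unfolding eq by (rule Suc.IH)
  qed
qed

section \<open>Upper bounds on the earth mover's distance\<close>

lemma EMD_le_expct:
  assumes "\<pi> \<in> couplings \<mu> \<nu>" "\<And>x y. 0 \<le> \<rho> x y"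
  shows "EMD \<rho> \<mu> \<nu> \<le> expct \<pi> (\<lambda>(x, y). \<rho> x y)"
  unfolding EMD_def
proof (rule cINF_lower[OF _ assms(1)])
  show "bdd_below ((\<lambda>\<pi>. expct \<pi> (\<lambda>(x, y). \<rho> x y)) ` couplings \<mu> \<nu>)"
    using assms(2) by (intro bdd_belowI2[where m = 0] integral_nonneg_AE AE_I2) (auto split: prod.split)
qed

text \<open>The product coupling suffices, since the normalised metric is at most 1 on the grid.
  This settles the case \<open>\<epsilon> > 1\<close>.\<close>

lemma EMD_le_1:
  assumes "1 \<le> p" "1 \<le> d" "1 \<le> n" "set_pmf \<mu> \<subseteq> grid n d" "set_pmf \<nu> \<subseteq> grid n d"
  shows "EMD (lp_dist p n d) \<mu> \<nu> \<le> 1"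
proof -
  have fin: "finite (set_pmf (pair_pmf \<mu> \<nu>))"
    using assms finite_grid finite_subset by (metis finite_SigmaI set_pair_pmf)
  have "EMD (lp_dist p n d) \<mu> \<nu> \<le> expct (pair_pmf \<mu> \<nu>) (\<lambda>(x, y). lp_dist p n d x y)"
    by (intro EMD_le_expct lp_dist_nonneg) (simp add: couplings_def map_fst_pair_pmf map_snd_pair_pmf)
  also have "\<dots> \<le> expct (pair_pmf \<mu> \<nu>) (\<lambda>_. 1)"
  proof (rule expct_mono[OF fin], clarify)
    fix x y assume "(x, y) \<in> set_pmf (pair_pmf \<mu> \<nu>)"
    hence "coord_close d (real n) x y" using assms by (intro coord_close_grid) auto
    from lp_dist_le_coord[OF assms(1-3) this] show "lp_dist p n d x y \<le> 1" using assms by simp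
  qed
  finally show ?thesis by simp
qed

text \<open>The original distributions are coupled along the dyadic cells of their labels. A pair
  with good labels pays \<open>\<epsilon> / 8\<close> for each passage between point and label and
  the dyadic bound between the labels; a pair with a bad label pays at most 1. The unequal bounds on
  bad mass are what the two gates of \<open>emd_tester\<close> guarantee.\<close>

lemma EMD_le_of_levels:
  assumes p: "1 \<le> p" "1 \<le> d" "1 \<le> n" and \<epsilon>: "0 < \<epsilon>"
    and K: "K \<in> CONN n d" and \<mu>: "set_pmf \<mu> \<subseteq> grid n d" and \<nu>: "set_pmf \<nu> \<subseteq> grid n d"
    and r: "real r \<le> \<epsilon> * real n / 8"
    and bad\<mu>: "prb (map_pmf (label K) \<mu>) {y. bad_label n d r K y} \<le> \<epsilon> / 64"
    and bad\<nu>: "prb (map_pmf (label K) \<nu>) {y. bad_label n d r K y} \<le> \<epsilon> / 16"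
    and L: "0 < L" "16 / \<epsilon> \<le> 2 ^ L"
    and levels: "\<And>i. i \<in> {1..L} \<Longrightarrow>
      (\<Sum>c\<in>dyadic_cells d i. \<bar>pmf (map_pmf (dyadic_cell n d i) (map_pmf (label K) \<mu>)) c
         - pmf (map_pmf (dyadic_cell n d i) (map_pmf (label K) \<nu>)) c\<bar>) \<le> \<epsilon> * 2 ^ i / (4 * real L)"
  shows "EMD (lp_dist p n d) \<mu> \<nu> \<le> \<epsilon>"
proof -
  let ?X = "grid n d"
  let ?bad = "\<lambda>x. if bad_label n d r K (label K x) then 1 else 0 :: real"
  have K': "K \<in> clusterings ?X" using K by (simp add: CONN_def)
  define h where "h i x = dyadic_cell n d i (label K x)" for i x
  have nested: "\<forall>j\<le>L. \<forall>i\<le>j. \<forall>x\<in>?X. \<forall>y\<in>?X. h j x = h j y \<longrightarrow> h i x = h i y"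
    unfolding h_def using dyadic_cell_nested by blast
  obtain \<pi> where \<pi>: "\<pi> \<in> couplings \<mu> \<nu>" and sub: "set_pmf \<pi> \<subseteq> ?X \<times> ?X"
    and h\<pi>: "\<And>i. i \<le> L \<Longrightarrow> 2 * prb \<pi> {(x, y). h i x \<noteq> h i y}
       \<le> (\<Sum>c\<in>h i ` ?X. \<bar>pmf (map_pmf (h i) \<mu>) c - pmf (map_pmf (h i) \<nu>) c\<bar>)"
    using multilevel_coupling[OF finite_grid \<mu> \<nu> nested] by blast
  have fin: "finite (set_pmf \<pi>)" using sub finite_grid finite_subset by (metis finite_SigmaI)
  have fst: "map_pmf fst \<pi> = \<mu>" and snd: "map_pmf snd \<pi> = \<nu>" using \<pi> by (auto simp: couplings_def)
  have lev: "prb \<pi> {(x, y). h i x \<noteq> h i y} \<le> \<epsilon> * 2 ^ i / (8 * real L)" if i: "i \<in> {1..L}" for i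
  proof -
    have "(\<Sum>c\<in>h i ` ?X. \<bar>pmf (map_pmf (h i) \<mu>) c - pmf (map_pmf (h i) \<nu>) c\<bar>)
      \<le> (\<Sum>c\<in>dyadic_cells d i. \<bar>pmf (map_pmf (h i) \<mu>) c - pmf (map_pmf (h i) \<nu>) c\<bar>)"
      using label_in[OF K'] dyadic_cell_in by (intro sum_mono2) (auto simp: h_def)
    also have "\<dots> \<le> \<epsilon> * 2 ^ i / (4 * real L)"
    proof -
      have "h i = dyadic_cell n d i \<circ> label K" by (auto simp: h_def)
      thus ?thesis using levels[OF i] by (simp only: pmf.map_comp)
    qed
    finally show ?thesis using h\<pi>[of i] i by simp
  qed
  have good: "coord_close d (\<epsilon> * real n / 8) x (label K x)"
    if "x \<in> ?X" "\<not> bad_label n d r K (label K x)" for x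
    using good_label_close[OF K that] r by (rule coord_close_mono)
  have pointwise: "lp_dist p n d x y \<le> \<epsilon> / 4 + ?bad x + ?bad y + (1 / 2 ^ L
      + (\<Sum>i=1..L. if h i x = h i y then 0 else 1 / 2 ^ i))" (is "_ \<le> ?rhs x y")
    if xy: "x \<in> ?X" "y \<in> ?X" for x y
  proof (cases "bad_label n d r K (label K x) \<or> bad_label n d r K (label K y)")
    case True
    have "lp_dist p n d x y \<le> 1" using lp_dist_le_coord[OF p coord_close_grid[OF xy]] p by simp
    moreover have "0 \<le> (\<Sum>i=1..L. if h i x = h i y then 0 else 1 / 2 ^ i :: real)"
      by (intro sum_nonneg) auto
    moreover have "0 \<le> 1 / (2 ^ L :: real)" "1 \<le> ?bad x + ?bad y" using True by auto
    ultimately show ?thesis using \<epsilon> by linarith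
  next
    case False
    have "coord_close d (\<epsilon> * real n / 8 + real n * (1 / 2 ^ L
      + (\<Sum>i=1..L. if h i x = h i y then 0 else 1 / 2 ^ i)) + \<epsilon> * real n / 8) x y"
      unfolding h_def using False xy label_in[OF K'] p(3)
      by (intro coord_close_trans[OF coord_close_trans[OF good dyadic_distance_bound] coord_close_sym[OF good]])
        auto
    from lp_dist_le_coord[OF p this] show ?thesis
      using False p by (simp add: add_divide_distrib)
  qed
  have ebad: "expct \<pi> (\<lambda>z. ?bad (f z)) = prb (map_pmf (label K) (map_pmf f \<pi>)) {y. bad_label n d r K y}" for f
  proof -
    have "expct \<pi> (\<lambda>z. ?bad (f z)) = expct \<pi> (indicator {z. bad_label n d r K (label K (f z))})"
      by (intro arg_cong[of _ _ "expct \<pi>"]) (auto simp: indicator_def)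
    thus ?thesis by (simp add: vimage_def)
  qed
  have elev: "expct \<pi> (\<lambda>z. if h i (fst z) = h i (snd z) then 0 else 1 / 2 ^ i)
      = prb \<pi> {(x, y). h i x \<noteq> h i y} / 2 ^ i" for i
  proof -
    have "expct \<pi> (\<lambda>z. if h i (fst z) = h i (snd z) then 0 else 1 / 2 ^ i)
      = expct \<pi> (\<lambda>z. indicator {(x, y). h i x \<noteq> h i y} z * (1 / 2 ^ i))"
      by (intro arg_cong[of _ _ "expct \<pi>"]) (auto simp: indicator_def)
    thus ?thesis by simp
  qed
  have "EMD (lp_dist p n d) \<mu> \<nu> \<le> expct \<pi> (\<lambda>(x, y). lp_dist p n d x y)"
    by (intro EMD_le_expct \<pi> lp_dist_nonneg)
  also have "\<dots> \<le> expct \<pi> (\<lambda>z. ?rhs (fst z) (snd z))"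
  proof (rule expct_mono[OF fin])
    fix z assume "z \<in> set_pmf \<pi>"
    hence "fst z \<in> ?X" "snd z \<in> ?X" using sub by auto
    from pointwise[OF this] show "(case z of (x, y) \<Rightarrow> lp_dist p n d x y) \<le> ?rhs (fst z) (snd z)"
      by (simp only: case_prod_beta)
  qed
  also have "\<dots> = \<epsilon> / 4 + expct \<pi> (\<lambda>z. ?bad (fst z)) + expct \<pi> (\<lambda>z. ?bad (snd z))
      + (1 / 2 ^ L + (\<Sum>i=1..L. expct \<pi> (\<lambda>z. if h i (fst z) = h i (snd z) then 0 else 1 / 2 ^ i)))"
    by (simp only: expct_add[OF fin] expct_sum[OF fin]) simp
  \<comment> \<open>A disagreement on level \<open>i\<close> costs \<open>1 / 2 ^ i\<close>, which
    cancels the factor \<open>2 ^ i\<close> in its probability; all \<open>L\<close> levels together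
    contribute \<open>\<epsilon> / 8\<close>.\<close>
  also have "\<dots> \<le> \<epsilon> / 4 + \<epsilon> / 64 + \<epsilon> / 16 + (\<epsilon> / 16 + (\<Sum>i=1..L. \<epsilon> / (8 * real L)))"
  proof (intro add_mono sum_mono)
    show "expct \<pi> (\<lambda>z. ?bad (fst z)) \<le> \<epsilon> / 64" "expct \<pi> (\<lambda>z. ?bad (snd z)) \<le> \<epsilon> / 16"
      unfolding ebad fst snd by (rule bad\<mu> bad\<nu>)+
    show "1 / 2 ^ L \<le> \<epsilon> / 16" using L \<epsilon> by (simp add: field_simps)
    fix i assume i: "i \<in> {1..L}"
    show "expct \<pi> (\<lambda>z. if h i (fst z) = h i (snd z) then 0 else 1 / 2 ^ i) \<le> \<epsilon> / (8 * real L)"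
      unfolding elev using lev[OF i] by (simp add: field_simps)
  qed simp
  also have "\<dots> \<le> \<epsilon>" using \<epsilon> L by simp
  finally show ?thesis .
qed

section \<open>Building blocks of algorithms\<close>

lemma within_budget_mono:
  "within_budget X T m q \<Longrightarrow> m \<le> m' \<Longrightarrow> q \<le> q' \<Longrightarrow> within_budget X T m' q'"
proof (induction T arbitrary: m q m' q')
  case (Flip P)
  have "within_budget X T m' q'" if "T \<in> set_pmf P" for T
    using Flip.prems(1) that by (intro Flip.IH[OF that _ Flip.prems(2,3)]) simp
  thus ?case by simp
next
  case (Sample i f)
  show ?case
  proof (simp, intro ballI)
    fix y assume "y \<in> X"
    hence "within_budget X (f y) (m - 1) q" using Sample.prems(1) by simp
    thus "within_budget X (f y) (m' - 1) q'"
      by (rule Sample.IH[OF rangeI]) (use Sample.prems(2,3) in simp_all)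
  qed
next
  case (Query x f)
  have "within_budget X (f y) m' (q' - 1)" if "y \<in> X" for y
  proof -
    have "within_budget X (f y) m (q - 1)" using Query.prems(1) that by simp
    thus ?thesis by (rule Query.IH[OF rangeI]) (use Query.prems(2,3) in simp_all)
  qed
  thus ?case using Query.prems by simp
qed auto

text \<open>Samples come in pairs, one from each distribution, so \<open>m\<close> rounds cost
  \<open>2 * m\<close> calls, also where only one component is used as in
  \<open>hit_gate\<close>.\<close>

primrec draw_pairs :: "nat \<Rightarrow> (('a \<times> 'a) list \<Rightarrow> (bool, 'a) alg) \<Rightarrow> (bool, 'a) alg" where
  "draw_pairs 0 f = f []"
| "draw_pairs (Suc m) f =
     Sample True (\<lambda>x. Sample False (\<lambda>y. draw_pairs m (\<lambda>zs. f ((x, y) # zs))))"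

definition label_pairs :: "'a clustering \<Rightarrow> (bool \<Rightarrow> 'a pmf) \<Rightarrow> ('a \<times> 'a) pmf" where
  "label_pairs K D = pair_pmf (map_pmf (label K) (D True)) (map_pmf (label K) (D False))"

lemma run_draw_pairs:
  "run K D (draw_pairs m f) = bind_pmf (replicate_pmf m (label_pairs K D)) (\<lambda>zs. run K D (f zs))"
proof (induction m arbitrary: f)
  case (Suc m)
  then show ?case
    by (simp add: label_pairs_def pair_pmf_def bind_assoc_pmf bind_return_pmf)
qed (simp add: bind_return_pmf)

lemma within_budget_draw_pairs:
  assumes "\<And>zs. set zs \<subseteq> X \<times> X \<Longrightarrow> length zs = m \<Longrightarrow> within_budget X (f zs) (M - 2 * real m) Q"
  shows "within_budget X (draw_pairs m f) M Q"
  using assms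
proof (induction m arbitrary: f M)
  case (Suc m)
  show ?case
  proof (simp, intro ballI)
    fix x y assume xy: "x \<in> X" "y \<in> X"
    show "within_budget X (draw_pairs m (\<lambda>zs. f ((x, y) # zs))) (M - 2) Q"
    proof (rule Suc.IH)
      fix zs assume "set zs \<subseteq> X \<times> X" "length zs = m"
      thus "within_budget X (f ((x, y) # zs)) (M - 2 - 2 * real m) Q"
        using Suc.prems[of "(x, y) # zs"] xy by (simp add: algebra_simps)
    qed
  qed
qed simp

primrec ask_labels :: "'a list \<Rightarrow> ('a list \<Rightarrow> ('i, 'a) alg) \<Rightarrow> ('i, 'a) alg" where
  "ask_labels [] f = f []"
| "ask_labels (x # xs) f = Query x (\<lambda>a. ask_labels xs (\<lambda>as. f (a # as)))"

lemma run_ask_labels: "run K D (ask_labels xs f) = run K D (f (map (label K) xs))"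
  by (induction xs arbitrary: f) auto

lemma within_budget_ask_labels:
  assumes "set xs \<subseteq> X" "\<And>as. within_budget X (f as) M (Q - real (length xs))"
  shows "within_budget X (ask_labels xs f) M Q"
  using assms
proof (induction xs arbitrary: f Q)
  case (Cons x xs)
  have "within_budget X (ask_labels xs (\<lambda>as. f (a # as))) M (Q - 1)" for a
    using Cons.prems(2)[of "a # _"] Cons.prems(1)
    by (intro Cons.IH) (auto simp: algebra_simps)
  thus ?case using Cons.prems by simp
qed simp

primrec count_hits ::
  "('a \<Rightarrow> 'a list) \<Rightarrow> 'a list \<Rightarrow> (nat \<Rightarrow> ('i, 'a) alg) \<Rightarrow> ('i, 'a) alg" where
  "count_hits sh [] f = f 0"
| "count_hits sh (y # ys) f = ask_labels (sh y) (\<lambda>as.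
     count_hits sh ys (\<lambda>c. f (if y \<in> set as then Suc c else c)))"

lemma run_count_hits:
  "run K D (count_hits sh ys f)
    = run K D (f (length (filter (\<lambda>y. y \<in> label K ` set (sh y)) ys)))"
  by (induction ys arbitrary: f) (auto simp: run_ask_labels)

lemma within_budget_count_hits:
  assumes "\<And>y. y \<in> set ys \<Longrightarrow> set (sh y) \<subseteq> X" "\<And>y. y \<in> set ys \<Longrightarrow> real (length (sh y)) \<le> s"
    and "\<And>c. within_budget X (f c) M (Q - real (length ys) * s)"
  shows "within_budget X (count_hits sh ys f) M Q"
  using assms
proof (induction ys arbitrary: f Q)
  case (Cons y ys)
  have "within_budget X (count_hits sh ys (\<lambda>c. f (if y \<in> set as then Suc c else c)))
      M (Q - real (length (sh y)))" for as
    using Cons.prems(3) Cons.prems(2)[of y] Cons.prems(1,2)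
    by (intro Cons.IH) (auto intro!: within_budget_mono[OF Cons.prems(3)] simp: algebra_simps)
  thus ?case using Cons.prems(1) by (auto intro: within_budget_ask_labels)
qed simp

section \<open>Gates: tests that may stop the run with a verdict\<close>

definition hit_gate ::
  "('a \<Rightarrow> 'a list) \<Rightarrow> nat \<Rightarrow> real \<Rightarrow> ('a \<times> 'a \<Rightarrow> 'a) \<Rightarrow> verdict \<Rightarrow> (bool, 'a) alg \<Rightarrow> (bool, 'a) alg" where
  "hit_gate sh t \<theta> sel v U = draw_pairs t (\<lambda>zs. count_hits sh (map sel zs)
     (\<lambda>c. if \<theta> \<le> real c then Output v else U))"

text \<open>Distribution-level counterpart of \<open>hit_gate\<close> and \<open>l1_gate\<close>; it
  reduces their error analysis to that of the Boolean test \<open>R\<close>.\<close>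

definition gate :: "bool pmf \<Rightarrow> verdict \<Rightarrow> verdict pmf \<Rightarrow> verdict pmf" where
  "gate R v q = bind_pmf R (\<lambda>b. if b then return_pmf v else q)"

lemma run_hit_gate:
  "run K D (hit_gate sh t \<theta> sel v U) = gate
     (map_pmf (\<lambda>zs. \<theta> \<le> real (length (filter (\<lambda>z. sel z \<in> label K ` set (sh (sel z))) zs)))
       (replicate_pmf t (label_pairs K D))) v (run K D U)"
  by (simp add: hit_gate_def gate_def run_draw_pairs run_count_hits bind_map_pmf filter_map o_def
      if_distrib[of "run K D"] cong: if_cong)

lemma within_budget_hit_gate:
  assumes "\<And>y. y \<in> X \<Longrightarrow> set (sh y) \<subseteq> X" "\<And>y. y \<in> X \<Longrightarrow> real (length (sh y)) \<le> s"
    and sel: "sel = fst \<or> sel = snd" and "0 \<le> s"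
    and U: "within_budget X U (M - 2 * real t) (Q - real t * s)" "2 * real t \<le> M" "real t * s \<le> Q"
  shows "within_budget X (hit_gate sh t \<theta> sel v U) M Q"
  unfolding hit_gate_def
proof (rule within_budget_draw_pairs)
  fix zs assume zs: "set zs \<subseteq> X \<times> X" "length zs = t"
  have "set (map sel zs) \<subseteq> X" using zs sel by auto
  thus "within_budget X (count_hits sh (map sel zs) (\<lambda>c. if \<theta> \<le> real c then Output v else U))
      (M - 2 * real t) Q"
    using assms zs by (intro within_budget_count_hits[where s = s]) (auto simp: subset_iff)
qed

lemma gate_le: "prb (gate R v q) V \<le> prb R {True} + prb q V"
  unfolding gate_def by (intro prob_bind_le) auto

text \<open>Stopping with a verdict outside \<open>V\<close> only removes probability from
  \<open>V\<close>.\<close>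

lemma gate_pass_le: "v \<notin> V \<Longrightarrow> prb (gate R v q) V \<le> prb q V"
  using prob_bind_le[of "prb q V" R "{}" "\<lambda>b. if b then return_pmf v else q" V] by (auto simp: gate_def)

text \<open>A verdict in \<open>V\<close> can be reached only by passing the gate, which requires
  its test to return \<open>False\<close>.\<close>

lemma gate_block_le: "v \<notin> V \<Longrightarrow> prb (gate R v q) V \<le> prb R {False}"
  using prob_bind_le[of 0 R "{False}" "\<lambda>b. if b then return_pmf v else q" V] by (auto simp: gate_def)

definition l1_gate ::
  "'c set \<Rightarrow> ('a \<Rightarrow> 'c) \<Rightarrow> nat \<Rightarrow> nat \<Rightarrow> real \<Rightarrow> (bool, 'a) alg \<Rightarrow> (bool, 'a) alg" where
  "l1_gate I g k m \<tau> U = draw_pairs k (\<lambda>ws. draw_pairs m (\<lambda>zs. draw_pairs m (\<lambda>zs'.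
     if \<tau> \<le> collision_stat I (weight (map (map_prod g g) ws)) (map (map_prod g g) zs) (map (map_prod g g) zs')
     then Output Reject else U)))"

lemma replicate_map_pmf: "replicate_pmf m (map_pmf f p) = map_pmf (map f) (replicate_pmf m p)"
  by (induction m) (simp_all add: map_bind_pmf bind_map_pmf)

lemma pair_map_prod_pmf: "pair_pmf (map_pmf g P) (map_pmf g Q) = map_pmf (map_prod g g) (pair_pmf P Q)"
  unfolding map_pair[symmetric] by (intro map_pmf_cong) auto

lemma run_l1_gate:
  "run K D (l1_gate I g k m \<tau> U) = gate
     (l1_test I k m \<tau> (map_pmf g (map_pmf (label K) (D True))) (map_pmf g (map_pmf (label K) (D False))))
     Reject (run K D U)"
proof -
  have "pair_pmf (map_pmf g (map_pmf (label K) (D True))) (map_pmf g (map_pmf (label K) (D False)))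
    = map_pmf (map_prod g g) (label_pairs K D)"
    unfolding pair_map_prod_pmf label_pairs_def ..
  thus ?thesis
    unfolding l1_gate_def gate_def l1_test_def
    by (simp add: run_draw_pairs replicate_map_pmf pair_pmf_def bind_assoc_pmf bind_return_pmf
        bind_map_pmf map_bind_pmf if_distrib[of "run K D"] cong: if_cong)
qed

lemma within_budget_l1_gate:
  assumes "within_budget X U (M - 2 * (real k + 2 * real m)) Q" "2 * (real k + 2 * real m) \<le> M" "0 \<le> Q"
  shows "within_budget X (l1_gate I g k m \<tau> U) M Q"
  unfolding l1_gate_def
  using assms by (intro within_budget_draw_pairs) (auto simp: algebra_simps)

definition l1_gates ::
  "(nat \<Rightarrow> 'c set) \<Rightarrow> (nat \<Rightarrow> 'a \<Rightarrow> 'c) \<Rightarrow> (nat \<Rightarrow> nat) \<Rightarrow> (nat \<Rightarrow> nat) \<Rightarrow> (nat \<Rightarrow> real)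
    \<Rightarrow> nat list \<Rightarrow> (bool, 'a) alg" where
  "l1_gates I g k m \<tau> is = foldr (\<lambda>i. l1_gate (I i) (g i) (k i) (m i) (\<tau> i)) is (Output Accept)"

lemma within_budget_l1_gates:
  assumes "\<And>i. i \<in> set is \<Longrightarrow> 2 * (real (k i) + 2 * real (m i)) \<le> s"
    and "real (length is) * s \<le> M" "0 \<le> Q"
  shows "within_budget X (l1_gates I g k m \<tau> is) M Q"
  using assms
proof (induction "is" arbitrary: M)
  case (Cons i "is")
  let ?c = "2 * (real (k i) + 2 * real (m i))"
  have c: "?c \<le> s" using Cons.prems by simp
  hence s0: "0 \<le> s" by (rule order_trans[rotated]) simp
  have M: "s + real (length is) * s \<le> M" using Cons.prems by (simp add: algebra_simps)
  have "within_budget X (l1_gates I g k m \<tau> is) (M - ?c) Q"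
  proof (rule Cons.IH)
    show "real (length is) * s \<le> M - ?c" using c M by linarith
  qed (use Cons.prems in auto)
  moreover have "?c \<le> M" using c M s0 by (smt (verit) mult_nonneg_nonneg of_nat_0_le_iff)
  ultimately show ?case using Cons.prems(3)
    by (simp add: l1_gates_def within_budget_l1_gate)
qed (simp add: l1_gates_def)

section \<open>Errors of a sequence of level tests\<close>

context
  fixes K :: "'a clustering" and D :: "bool \<Rightarrow> 'a pmf" and I :: "nat \<Rightarrow> 'c set"
    and g :: "nat \<Rightarrow> 'a \<Rightarrow> 'c" and k m :: "nat \<Rightarrow> nat" and \<tau> :: "nat \<Rightarrow> real"
begin

private abbreviation R where
  "R i \<equiv> l1_test (I i) (k i) (m i) (\<tau> i)
     (map_pmf (g i) (map_pmf (label K) (D True))) (map_pmf (g i) (map_pmf (label K) (D False)))"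

lemma run_l1_gates_Cons:
  "run K D (l1_gates I g k m \<tau> (i # is)) = gate (R i) Reject (run K D (l1_gates I g k m \<tau> is))"
  by (simp add: l1_gates_def run_l1_gate)

lemma l1_gates_reject:
  assumes "\<And>i. i \<in> set is \<Longrightarrow> prb (R i) {True} \<le> e"
  shows "prb (run K D (l1_gates I g k m \<tau> is)) {Reject} \<le> real (length is) * e"
  using assms
proof (induction "is")
  case (Cons i "is")
  have "prb (run K D (l1_gates I g k m \<tau> (i # is))) {Reject}
      \<le> prb (R i) {True} + prb (run K D (l1_gates I g k m \<tau> is)) {Reject}"
    unfolding run_l1_gates_Cons by (rule gate_le)
  also have "\<dots> \<le> e + real (length is) * e"
    using Cons by (intro add_mono) auto
  finally show ?case by (simp add: algebra_simps)
qed (simp add: l1_gates_def)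

text \<open>One level that detects the difference suffices, because the other gates can only turn
  acceptance into rejection.\<close>

lemma l1_gates_accept:
  assumes "i \<in> set is" "prb (R i) {False} \<le> e"
  shows "prb (run K D (l1_gates I g k m \<tau> is)) {Accept} \<le> e"
  using assms
proof (induction "is")
  case (Cons j "is")
  show ?case
  proof (cases "i = j")
    case True
    have "prb (run K D (l1_gates I g k m \<tau> (j # is))) {Accept} \<le> prb (R j) {False}"
      unfolding run_l1_gates_Cons by (intro gate_block_le) auto
    thus ?thesis using Cons True by simp
  next
    case False
    have "prb (run K D (l1_gates I g k m \<tau> (j # is))) {Accept}
      \<le> prb (run K D (l1_gates I g k m \<tau> is)) {Accept}"
      unfolding run_l1_gates_Cons by (intro gate_pass_le) auto
    thus ?thesis using Cons False by simp
  qed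
qed simp

lemma l1_gates_cluster_reject:
  "prb (run K D (l1_gates I g k m \<tau> is)) {Cluster_Reject} \<le> 0"
proof (induction "is")
  case (Cons i "is")
  have "prb (run K D (l1_gates I g k m \<tau> (i # is))) {Cluster_Reject}
      \<le> prb (run K D (l1_gates I g k m \<tau> is)) {Cluster_Reject}"
    unfolding run_l1_gates_Cons by (intro gate_pass_le) auto
  with Cons show ?case by simp
qed (simp add: l1_gates_def)

end

text \<open>Chebyshev's inequality for a count with mean \<open>t * \<beta>\<close> and variance at
  most its mean. The threshold \<open>2 * a * t\<close> exceeds the mean by at least
  \<open>a * t\<close> if \<open>\<beta> \<le> a\<close> and is at most half the mean if
  \<open>\<beta> \<ge> 4 * a\<close>; both errors are then at most
  \<open>1 / (a * t)\<close>.\<close>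

lemma
  fixes A :: "'a \<Rightarrow> bool"
  assumes fin: "finite (set_pmf p)" and a: "0 < a" "24 \<le> a * real t"
  defines "\<beta> \<equiv> prb p {z. A z}"
  shows count_test_few: "\<beta> \<le> a \<Longrightarrow>
      prb (replicate_pmf t p) {zs. 2 * a * real t \<le> real (length (filter A zs))} \<le> 1 / 24"
    and count_test_many: "4 * a \<le> \<beta> \<Longrightarrow>
      prb (replicate_pmf t p) {zs. real (length (filter A zs)) < 2 * a * real t} \<le> 1 / 24"
proof -
  let ?R = "replicate_pmf t p" and ?X = "\<lambda>zs. real (length (filter A zs))"
  note finR = finite_set_replicate_pmf[OF fin, of t]
  have X: "?X zs = (\<Sum>z\<leftarrow>zs. indicator {z. A z} z)" for zs by (induction zs) auto
  have ind: "expct p (\<lambda>z. indicator {z. A z} z * indicator {z. A z} z) = \<beta>"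
  proof -
    have "expct p (\<lambda>z. indicator {z. A z} z * indicator {z. A z} z) = expct p (indicator {z. A z})"
      by (intro arg_cong[of _ _ "expct p"]) (auto simp: indicator_def)
    thus ?thesis by (simp add: \<beta>_def)
  qed
  have \<beta>0: "0 \<le> \<beta>" by (simp add: \<beta>_def)
  have t0: "0 < real t" using a by (cases t) auto
  have m1: "expct ?R ?X = real t * \<beta>"
    unfolding X expct_replicate_sum[OF fin] by (simp add: \<beta>_def)
  have m2: "expct ?R (\<lambda>zs. (?X zs)\<^sup>2) \<le> (real t * \<beta>)\<^sup>2 + real t * \<beta>"
  proof -
    have "expct ?R (\<lambda>zs. (?X zs)\<^sup>2) = real t * \<beta> + real t * (real t - 1) * (\<beta> * \<beta>)"
      unfolding X power2_eq_square expct_replicate_sum_mult[OF fin] ind by (simp add: \<beta>_def)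
    also have "\<dots> \<le> real t * \<beta> + real t * real t * (\<beta> * \<beta>)"
      using \<beta>0 by (intro add_left_mono mult_right_mono mult_left_mono) auto
    finally show ?thesis by (simp add: power2_eq_square algebra_simps)
  qed
  note cheb = chebyshev_pmf[OF finR m1 m2]
  show "prb ?R {zs. 2 * a * real t \<le> ?X zs} \<le> 1 / 24" if "\<beta> \<le> a"
  proof -
    have pos: "0 < a * real t" using a by simp
    have \<beta>a: "real t * \<beta> \<le> a * real t" using that t0 by (simp add: mult.commute)
    have "prb ?R {zs. 2 * a * real t \<le> ?X zs} \<le> prb ?R {zs. a * real t \<le> \<bar>?X zs - real t * \<beta>\<bar>}"
      using \<beta>a by (intro measure_pmf.finite_measure_mono) (auto simp: abs_if)
    also have "\<dots> \<le> real t * \<beta> / (a * real t)\<^sup>2" by (rule cheb[OF pos])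
    also have "\<dots> \<le> a * real t / (a * real t)\<^sup>2" using \<beta>a by (intro divide_right_mono) auto
    also have "\<dots> = 1 / (a * real t)" using pos by (simp add: power2_eq_square)
    also have "\<dots> \<le> 1 / 24" using a by (intro divide_left_mono) auto
    finally show ?thesis .
  qed
  show "prb ?R {zs. ?X zs < 2 * a * real t} \<le> 1 / 24" if "4 * a \<le> \<beta>"
  proof -
    have \<beta>a: "4 * (a * real t) \<le> real t * \<beta>" using that t0 by (simp add: mult.commute)
    hence pos: "0 < real t * \<beta> / 2" using a by simp
    have "prb ?R {zs. ?X zs < 2 * a * real t} \<le> prb ?R {zs. real t * \<beta> / 2 \<le> \<bar>?X zs - real t * \<beta>\<bar>}"
      using \<beta>a by (intro measure_pmf.finite_measure_mono) (auto simp: abs_if mult.commute[of \<beta>])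
    also have "\<dots> \<le> real t * \<beta> / (real t * \<beta> / 2)\<^sup>2" by (rule cheb[OF pos])
    also have "\<dots> = 4 / (real t * \<beta>)" using pos by (simp add: power2_eq_square)
    also have "\<dots> \<le> 4 / (4 * 24)" using a \<beta>a by (intro divide_left_mono) auto
    finally show ?thesis by simp
  qed
qed

primrec simulate :: "'a pmf \<Rightarrow> (bool, 'a) alg \<Rightarrow> (unit, 'a) alg" where
  "simulate \<nu> (Output v) = Output v"
| "simulate \<nu> (Flip P) = Flip (map_pmf (simulate \<nu>) P)"
| "simulate \<nu> (Sample i f) = (if i then Sample () (\<lambda>y. simulate \<nu> (f y))
     else Flip (map_pmf (\<lambda>x. Query x (\<lambda>y. simulate \<nu> (f y))) \<nu>))"
| "simulate \<nu> (Query x f) = Query x (\<lambda>y. simulate \<nu> (f y))"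

text \<open>Drawing a point from \<open>\<nu>\<close> internally and querying its label has the law
  of a clustered sample from \<open>\<nu>\<close>.\<close>

lemma run_simulate:
  "run K (\<lambda>_. \<mu>) (simulate \<nu> T) = run K (\<lambda>i. if i then \<mu> else \<nu>) T"
proof (induction T)
  case (Flip P)
  have "map_pmf (\<lambda>T. run K (\<lambda>_. \<mu>) (simulate \<nu> T)) P = map_pmf (run K (\<lambda>i. if i then \<mu> else \<nu>)) P"
    using Flip by (intro map_pmf_cong) auto
  thus ?case by (simp add: pmf.map_comp o_def)
next
  case (Sample i f)
  then show ?case by (simp add: pmf.map_comp o_def bind_map_pmf)
qed auto

text \<open>A simulated sample exchanges one sample call for one label query, so at most
  \<open>m\<close> queries are added.\<close>

lemma within_budget_simulate:
  assumes "set_pmf \<nu> \<subseteq> X"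
  shows "within_budget X T m q \<Longrightarrow> within_budget X (simulate \<nu> T) m (q + m)"
proof (induction T arbitrary: m q)
  case (Sample i f)
  have sim: "within_budget X (simulate \<nu> (f y)) (m - 1) (q + m - 1)" if "y \<in> X" for y
    using Sample.IH[of "f y" "m - 1" q] Sample.prems that by (simp add: add_diff_eq)
  have "within_budget X (simulate \<nu> (f y)) (m - 1) (q + m)" if "y \<in> X" for y
    by (rule within_budget_mono[OF sim[OF that]]) simp_all
  moreover have "within_budget X (simulate \<nu> (f y)) m (q + m - 1)" if "y \<in> X" for y
    by (rule within_budget_mono[OF sim[OF that]]) simp_all
  ultimately show ?case using assms by auto
next
  case (Query x f)
  have "within_budget X (simulate \<nu> (f y)) m (q + m - 1)" if "y \<in> X" for y
    using Query.IH[of "f y" m "q - 1"] Query.prems that by (simp add: add.commute add_diff_eq)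
  thus ?case using Query.prems by simp
qed auto

section \<open>The tester\<close>

definition shell_list :: "nat \<Rightarrow> nat \<Rightarrow> nat \<Rightarrow> (nat \<Rightarrow> nat) \<Rightarrow> (nat \<Rightarrow> nat) list" where
  "shell_list n d r y = (SOME xs. set xs = shell n d r y \<and> distinct xs)"

lemma set_shell_list: "set (shell_list n d r y) = shell n d r y"
  and length_shell_list_le: "length (shell_list n d r y) \<le> 2 * d * (2 * r + 1) ^ (d - 1)"
proof -
  have "set (shell_list n d r y) = shell n d r y \<and> distinct (shell_list n d r y)"
    unfolding shell_list_def using finite_distinct_list[OF finite_shell] by (rule someI_ex)
  thus "set (shell_list n d r y) = shell n d r y"
    and "length (shell_list n d r y) \<le> 2 * d * (2 * r + 1) ^ (d - 1)"
    using card_shell_le[of n d r y] distinct_card by metis+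
qed

text \<open>The constant is \<open>24 * 256\<close>, so that \<open>count_test_few\<close> and
  \<open>count_test_many\<close> apply with \<open>a = \<epsilon> / 256\<close>, and also with the
  larger \<open>a = \<epsilon> / 64\<close>.\<close>

definition hit_samples :: "real \<Rightarrow> nat" where
  "hit_samples \<epsilon> = nat \<lceil>6144 / \<epsilon>\<rceil>"

lemma hit_samples_bounds:
  assumes "0 < \<epsilon>"
  shows "6144 / \<epsilon> \<le> real (hit_samples \<epsilon>)" "real (hit_samples \<epsilon>) \<le> 6144 / \<epsilon> + 1"
proof -
  have "0 < 6144 / \<epsilon>" using assms by simp
  thus "6144 / \<epsilon> \<le> real (hit_samples \<epsilon>)" "real (hit_samples \<epsilon>) \<le> 6144 / \<epsilon> + 1"
    unfolding hit_samples_def by linarith+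
qed

text \<open>The first gate separates bad mass at most \<open>\<epsilon> / 256\<close> from at least
  \<open>\<epsilon> / 64\<close>, the second \<open>\<epsilon> / 64\<close> from
  \<open>\<epsilon> / 16\<close>. The verdict \<open>v\<close> of the second gate is
  \<open>Cluster_Reject\<close> for equivalence and \<open>Reject\<close> for identity.\<close>

definition emd_tester ::
  "nat \<Rightarrow> nat \<Rightarrow> real \<Rightarrow> verdict \<Rightarrow> nat \<Rightarrow> (nat \<Rightarrow> nat) \<Rightarrow> (nat \<Rightarrow> nat) \<Rightarrow> (bool, nat \<Rightarrow> nat) alg" where
  "emd_tester n d \<epsilon> v L k m =
    (let t = hit_samples \<epsilon>; sh = shell_list n d (nat \<lfloor>\<epsilon> * real n / 8\<rfloor>) in
     hit_gate sh t (2 * (\<epsilon> / 256) * real t) fst Cluster_Reject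
      (hit_gate sh t (2 * (\<epsilon> / 64) * real t) snd v
        (l1_gates (dyadic_cells d) (dyadic_cell n d) k m
          (\<lambda>i. (real (m i))\<^sup>2 * ((\<epsilon> * 2 ^ i / (4 * real L))\<^sup>2 / (real (2 ^ (i * d)) + 2 * real (k i))) / 2)
          [1..<Suc L])))"

lemma guard_const_le: "guard_const \<le> 1 / 256"
proof -
  have "exp 1 \<le> (24 :: real)" using exp_le by simp
  hence "1 \<le> ln (24 :: real)" by (simp add: ln_ge_iff)
  thus ?thesis by (simp add: guard_const_def field_simps)
qed

text \<open>By \<open>small_cell_good\<close>, bad labels arise only from cells of diameter above
  \<open>\<Delta>\<close>, whose mass the guard condition limits.\<close>

lemma small_diam_few_bad:
  assumes K: "K \<in> clusterings (grid n d)" and \<mu>: "set_pmf \<mu> \<subseteq> grid n d"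
    and p: "1 \<le> p" "1 \<le> d" "1 \<le> n" and \<epsilon>: "0 < \<epsilon>"
    and \<Delta>: "\<Delta> \<le> 1 / (8 * real d powr (1 / p)) * \<epsilon>"
    and small: "small_diam (lp_dist p n d) \<Delta> \<epsilon> K \<mu>"
  shows "prb (map_pmf (label K) \<mu>) {y. bad_label n d (nat \<lfloor>\<epsilon> * real n / 8\<rfloor>) K y} \<le> \<epsilon> / 256"
proof -
  have "prb (map_pmf (label K) \<mu>) {y. bad_label n d (nat \<lfloor>\<epsilon> * real n / 8\<rfloor>) K y}
    = prb \<mu> {x. bad_label n d (nat \<lfloor>\<epsilon> * real n / 8\<rfloor>) K (label K x)}"
    by (simp add: vimage_def)
  also have "\<dots> \<le> prb \<mu> {x. diam (lp_dist p n d) (cell_of K x) > \<Delta>}"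
  proof (rule measure_pmf.finite_measure_mono_AE)
    show "AE x in measure_pmf \<mu>. x \<in> {x. bad_label n d (nat \<lfloor>\<epsilon> * real n / 8\<rfloor>) K (label K x)}
        \<longrightarrow> x \<in> {x. diam (lp_dist p n d) (cell_of K x) > \<Delta>}"
    proof (rule AE_pmfI, safe)
      fix x assume "x \<in> set_pmf \<mu>" and bad: "bad_label n d (nat \<lfloor>\<epsilon> * real n / 8\<rfloor>) K (label K x)"
      hence "x \<in> grid n d" using \<mu> by auto
      from small_cell_good[OF K this p \<Delta> _ refl] bad
      show "diam (lp_dist p n d) (cell_of K x) > \<Delta>" by (meson not_le)
    qed
  qed simp
  also have "\<dots> \<le> guard_const * \<epsilon>" using small by (simp add: small_diam_def)
  also have "\<dots> \<le> \<epsilon> / 256" using mult_right_mono[OF guard_const_le, of \<epsilon>] \<epsilon> by simp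
  finally show ?thesis .
qed

text \<open>Each of the two gates and the block of level tests errs with probability at most
  \<open>1 / 24\<close>, and a union bound gives \<open>1 / 6\<close>. The second conclusion serves
  identity testing, where the guard concerns only the unknown distribution: the second gate then
  answers \<open>Reject\<close> and cannot cause \<open>Cluster_Reject\<close>.\<close>

lemma emd_tester_correct:
  fixes D :: "bool \<Rightarrow> (nat \<Rightarrow> nat) pmf"
  assumes p: "1 \<le> p" "1 \<le> d" "1 \<le> n" and \<epsilon>: "0 < \<epsilon>"
    and K: "K \<in> CONN n d" and D: "\<And>b. set_pmf (D b) \<subseteq> grid n d"
    and L: "0 < L" "16 / \<epsilon> \<le> 2 ^ L"
    and m0: "\<forall>i\<in>{1..L}. 0 < m i"
    and m: "\<forall>i\<in>{1..L}. 100 * sqrt (4 / (1 / (48 * real L) * (real (k i) + 1)))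
      \<le> real (m i) * (1 / (48 * real L))
        * ((\<epsilon> * 2 ^ i / (4 * real L))\<^sup>2 / (real (2 ^ (i * d)) + 2 * real (k i)))"
  defines "q v \<equiv> run K D (emd_tester n d \<epsilon> v L k m)"
    and "\<beta> b \<equiv> prb (map_pmf (label K) (D b)) {y. bad_label n d (nat \<lfloor>\<epsilon> * real n / 8\<rfloor>) K y}"
  shows "\<beta> True \<le> \<epsilon> / 256 \<Longrightarrow> \<beta> False \<le> \<epsilon> / 256 \<Longrightarrow> prb (q v) {Cluster_Reject} \<le> 1 / 6"
    and "\<beta> True \<le> \<epsilon> / 256 \<Longrightarrow> prb (q Reject) {Cluster_Reject} \<le> 1 / 6"
    and "D True = D False \<Longrightarrow> prb (q v) {Reject} \<le> 1 / 6"
    and "v \<noteq> Accept \<Longrightarrow> EMD (lp_dist p n d) (D True) (D False) > \<epsilon> \<Longrightarrow> prb (q v) {Accept} \<le> 1 / 6"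
proof -
  define r where "r = nat \<lfloor>\<epsilon> * real n / 8\<rfloor>"
  define t where "t = hit_samples \<epsilon>"
  define P where "P b = map_pmf (label K) (D b)" for b
  define \<eta> where "\<eta> i = \<epsilon> * 2 ^ i / (4 * real L)" for i
  define \<tau> where "\<tau> i = (real (m i))\<^sup>2 * ((\<eta> i)\<^sup>2 / (real (2 ^ (i * d)) + 2 * real (k i))) / 2" for i
  define lev where "lev = run K D (l1_gates (dyadic_cells d) (dyadic_cell n d) k m \<tau> [1..<Suc L])"
  define hit where "hit a sel = map_pmf (\<lambda>zs. 2 * a * real t
      \<le> real (length (filter (\<lambda>z. bad_label n d r K (sel z)) zs))) (replicate_pmf t (label_pairs K D))"
    for a and sel :: "(nat \<Rightarrow> nat) \<times> (nat \<Rightarrow> nat) \<Rightarrow> nat \<Rightarrow> nat"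
  have q: "q v = gate (hit (\<epsilon> / 256) fst) Cluster_Reject (gate (hit (\<epsilon> / 64) snd) v lev)" for v
    unfolding q_def emd_tester_def Let_def run_hit_gate lev_def hit_def set_shell_list
      bad_label_def t_def r_def \<tau>_def \<eta>_def ..
  have K': "K \<in> clusterings (grid n d)" using K by (simp add: CONN_def)
  have Pset: "set_pmf (P b) \<subseteq> grid n d" for b
    unfolding P_def using D[of b] label_in[OF K'] by auto
  have finP: "finite (set_pmf (P b))" for b using Pset finite_grid by (rule finite_subset)
  have pairs: "label_pairs K D = pair_pmf (P True) (P False)" by (simp add: label_pairs_def P_def)
  have fin: "finite (set_pmf (label_pairs K D))" using finP by (simp add: pairs)
  have t: "24 \<le> \<epsilon> / 256 * real t" "24 \<le> \<epsilon> / 64 * real t"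
    using hit_samples_bounds(1)[OF \<epsilon>] \<epsilon> by (simp_all add: t_def field_simps)
  have "prb (map_pmf fst (label_pairs K D)) {y. bad_label n d r K y} = \<beta> True"
    unfolding pairs map_fst_pair_pmf by (simp add: \<beta>_def P_def r_def)
  hence \<beta>1: "prb (label_pairs K D) {z. bad_label n d r K (fst z)} = \<beta> True" by (simp add: vimage_def)
  have "prb (map_pmf snd (label_pairs K D)) {y. bad_label n d r K y} = \<beta> False"
    unfolding pairs map_snd_pair_pmf by (simp add: \<beta>_def P_def r_def)
  hence \<beta>2: "prb (label_pairs K D) {z. bad_label n d r K (snd z)} = \<beta> False" by (simp add: vimage_def)
  have few1: "prb (hit (\<epsilon> / 256) fst) {True} \<le> 1 / 24" if "\<beta> True \<le> \<epsilon> / 256"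
    using count_test_few[OF fin _ t(1), of "\<lambda>z. bad_label n d r K (fst z)"] that \<epsilon>
    by (simp add: hit_def vimage_def \<beta>1)
  have many1: "prb (hit (\<epsilon> / 256) fst) {False} \<le> 1 / 24" if "\<epsilon> / 64 \<le> \<beta> True"
    using count_test_many[OF fin _ t(1), of "\<lambda>z. bad_label n d r K (fst z)"] that \<epsilon>
    by (simp add: hit_def vimage_def \<beta>1 not_le)
  have few2: "prb (hit (\<epsilon> / 64) snd) {True} \<le> 1 / 24" if "\<beta> False \<le> \<epsilon> / 64"
    using count_test_few[OF fin _ t(2), of "\<lambda>z. bad_label n d r K (snd z)"] that \<epsilon>
    by (simp add: hit_def vimage_def \<beta>2)
  have many2: "prb (hit (\<epsilon> / 64) snd) {False} \<le> 1 / 24" if "\<epsilon> / 16 \<le> \<beta> False"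
    using count_test_many[OF fin _ t(2), of "\<lambda>z. bad_label n d r K (snd z)"] that \<epsilon>
    by (simp add: hit_def vimage_def \<beta>2 not_le)
  define R where "R i = l1_test (dyadic_cells d i) (k i) (m i) (\<tau> i)
     (map_pmf (dyadic_cell n d i) (P True)) (map_pmf (dyadic_cell n d i) (P False))" for i
  have sets: "set_pmf (map_pmf (dyadic_cell n d i) (P b)) \<subseteq> dyadic_cells d i" for i b
    using Pset[of b] dyadic_cell_in by auto
  \<comment> \<open>Each of the \<open>L\<close> level tests errs with probability at most
    \<open>2 / (48 * L)\<close>, in total \<open>1 / 24\<close>.\<close>
  have \<delta>: "0 < 1 / (48 * real L)" "1 / (48 * real L) \<le> 1" using L by auto
  have \<eta>0: "0 < \<eta> i" for i using \<epsilon> L by (simp add: \<eta>_def)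
  have N: "card (dyadic_cells d i) \<le> 2 ^ (i * d)" "0 < (2 :: nat) ^ (i * d)" for i
    by (simp_all add: card_dyadic_cells)
  note l1 = l1_test_correct[OF finite_dyadic_cells sets[of _ True] sets[of _ False] \<eta>0 \<delta> m0[rule_format] N m[rule_format, folded \<eta>_def],
      folded \<tau>_def, folded R_def]
  have lev_reject: "prb lev {Reject} \<le> 1 / 24" if "D True = D False"
  proof -
    have "prb lev {Reject} \<le> real (length [1..<Suc L]) * (2 * (1 / (48 * real L)))"
      unfolding lev_def
      by (rule l1_gates_reject) (use l1(1) that in \<open>auto simp: R_def P_def\<close>)
    thus ?thesis using L by simp
  qed
  have lev_accept: "prb lev {Accept} \<le> 1 / 24"
    if i: "i \<in> {1..L}" and far: "\<eta> i \<le> (\<Sum>c\<in>dyadic_cells d i.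
      \<bar>pmf (map_pmf (dyadic_cell n d i) (P True)) c - pmf (map_pmf (dyadic_cell n d i) (P False)) c\<bar>)" for i
  proof -
    have "prb lev {Accept} \<le> 2 * (1 / (48 * real L))"
      unfolding lev_def
      by (rule l1_gates_accept[of i]) (use l1(2)[OF i i far] i in \<open>auto simp: R_def P_def\<close>)
    also have "\<dots> \<le> 1 / 24" using L by simp
    finally show ?thesis .
  qed
  have lev_cr: "prb lev {Cluster_Reject} \<le> 0"
    unfolding lev_def by (rule l1_gates_cluster_reject)
  show "prb (q v) {Cluster_Reject} \<le> 1 / 6" if "\<beta> True \<le> \<epsilon> / 256" "\<beta> False \<le> \<epsilon> / 256"
  proof -
    have "\<beta> False \<le> \<epsilon> / 64" using that \<epsilon> by simp
    hence "prb (gate (hit (\<epsilon> / 64) snd) v lev) {Cluster_Reject} \<le> 1 / 24 + 0"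
      using gate_le[of "hit (\<epsilon> / 64) snd" v lev "{Cluster_Reject}"] few2 lev_cr by simp
    thus ?thesis
      using gate_le[of "hit (\<epsilon> / 256) fst" Cluster_Reject "gate (hit (\<epsilon> / 64) snd) v lev" "{Cluster_Reject}"]
        few1[OF that(1)] by (simp add: q)
  qed
  show "prb (q Reject) {Cluster_Reject} \<le> 1 / 6" if "\<beta> True \<le> \<epsilon> / 256"
  proof -
    have "prb (gate (hit (\<epsilon> / 64) snd) Reject lev) {Cluster_Reject} \<le> 0"
      using gate_pass_le[of Reject "{Cluster_Reject}" "hit (\<epsilon> / 64) snd" lev] lev_cr by simp
    thus ?thesis
      using gate_le[of "hit (\<epsilon> / 256) fst" Cluster_Reject "gate (hit (\<epsilon> / 64) snd) Reject lev" "{Cluster_Reject}"]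
        few1[OF that] by (simp add: q)
  qed
  show "prb (q v) {Reject} \<le> 1 / 6" if eq: "D True = D False"
  \<comment> \<open>Above \<open>\<epsilon> / 64\<close> the first gate stops the run, with a
    verdict other than \<open>Reject\<close>. Below it, equality of the distributions makes the
    second gate unlikely to fire.\<close>
  proof (cases "\<beta> True \<le> \<epsilon> / 64")
    case True
    hence "\<beta> False \<le> \<epsilon> / 64" using eq by (simp add: \<beta>_def)
    hence "prb (gate (hit (\<epsilon> / 64) snd) v lev) {Reject} \<le> 1 / 24 + 1 / 24"
      using gate_le[of "hit (\<epsilon> / 64) snd" v lev "{Reject}"] few2 lev_reject[OF eq] by simp
    thus ?thesis
      using gate_pass_le[of Cluster_Reject "{Reject}" "hit (\<epsilon> / 256) fst" "gate (hit (\<epsilon> / 64) snd) v lev"]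
      by (simp add: q)
  next
    case False
    thus ?thesis
      using gate_block_le[of Cluster_Reject "{Reject}" "hit (\<epsilon> / 256) fst" "gate (hit (\<epsilon> / 64) snd) v lev"]
        many1 by (simp add: q)
  qed
  show "prb (q v) {Accept} \<le> 1 / 6" if v: "v \<noteq> Accept" and far: "EMD (lp_dist p n d) (D True) (D False) > \<epsilon>"
  proof -
    have first: "prb (q v) {Accept} \<le> prb (hit (\<epsilon> / 256) fst) {False}"
      "prb (q v) {Accept} \<le> prb (gate (hit (\<epsilon> / 64) snd) v lev) {Accept}"
      unfolding q by (rule gate_block_le gate_pass_le; simp)+
    have second: "prb (gate (hit (\<epsilon> / 64) snd) v lev) {Accept} \<le> prb (hit (\<epsilon> / 64) snd) {False}"
      "prb (gate (hit (\<epsilon> / 64) snd) v lev) {Accept} \<le> prb lev {Accept}"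
      using v by (intro gate_block_le gate_pass_le; simp)+
    consider "\<epsilon> / 64 \<le> \<beta> True" | "\<epsilon> / 16 \<le> \<beta> False" | "\<beta> True \<le> \<epsilon> / 64" "\<beta> False \<le> \<epsilon> / 16" by linarith
    thus ?thesis
    proof cases
      case 1
      thus ?thesis using many1 first(1) by simp
    next
      case 2
      thus ?thesis using many2 first(2) second(1) by simp
    next
      case 3
      have "real r \<le> \<epsilon> * real n / 8" unfolding r_def using \<epsilon> by (intro of_nat_floor) simp
      from EMD_le_of_levels[OF p \<epsilon> K D[of True] D[of False] this _ _ L, folded r_def P_def \<eta>_def] far 3
      \<comment> \<open>With little bad mass on both sides, the contrapositive of
        \<open>EMD_le_of_levels\<close> yields a level on which the distributions differ.\<close>
      have "\<exists>i\<in>{1..L}. \<eta> i < (\<Sum>c\<in>dyadic_cells d i. \<bar>pmf (map_pmf (dyadic_cell n d i) (P True)) c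
          - pmf (map_pmf (dyadic_cell n d i) (P False)) c\<bar>)"
        unfolding \<beta>_def P_def[symmetric] r_def[symmetric] by (meson not_le)
      then obtain i where "i \<in> {1..L}" "\<eta> i < (\<Sum>c\<in>dyadic_cells d i.
          \<bar>pmf (map_pmf (dyadic_cell n d i) (P True)) c
          - pmf (map_pmf (dyadic_cell n d i) (P False)) c\<bar>)" by blast
      hence "prb lev {Accept} \<le> 1 / 24" by (intro lev_accept) auto
      thus ?thesis using first(2) second(2) by simp
    qed
  qed
qed

lemma within_budget_emd_tester:
  assumes \<epsilon>: "0 < \<epsilon>"
    and s: "\<forall>i\<in>{1..L}. 2 * (real (k i) + 2 * real (m i)) \<le> s"
    and M: "4 * real (hit_samples \<epsilon>) + real L * s \<le> M" and s0: "0 \<le> s"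
    and Q: "2 * (real (hit_samples \<epsilon>) * real (2 * d * (2 * nat \<lfloor>\<epsilon> * real n / 8\<rfloor> + 1) ^ (d - 1))) \<le> Q"
  shows "within_budget (grid n d) (emd_tester n d \<epsilon> v L k m) M Q"
proof -
  let ?t = "real (hit_samples \<epsilon>)" and ?S = "real (2 * d * (2 * nat \<lfloor>\<epsilon> * real n / 8\<rfloor> + 1) ^ (d - 1))"
  have sh: "set (shell_list n d r y) \<subseteq> grid n d" for r y
    by (auto simp: set_shell_list shell_def)
  have len: "real (length (shell_list n d (nat \<lfloor>\<epsilon> * real n / 8\<rfloor>) y)) \<le> ?S" for y
    using length_shell_list_le by (simp only: of_nat_le_iff)
  have S0: "0 \<le> ?S" "0 \<le> ?t * ?S" by simp_all
  have Ls: "0 \<le> real L * s" using s0 by simp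
  show ?thesis
    unfolding emd_tester_def Let_def
  proof (intro within_budget_hit_gate[where s = ?S] sh len S0(1) within_budget_l1_gates[where s = s])
    show "2 * ?t \<le> M" "2 * ?t \<le> M - 2 * ?t" "real (length [1..<Suc L]) * s \<le> M - 2 * ?t - 2 * ?t"
      using M Ls by simp_all
    show "?t * ?S \<le> Q" "?t * ?S \<le> Q - ?t * ?S" "0 \<le> Q - ?t * ?S - ?t * ?S"
      using Q S0(2) by linarith+
    show "2 * (real (k i) + 2 * real (m i)) \<le> s" if "i \<in> set [1..<Suc L]" for i
      using s that by auto
  qed simp_all
qed

section \<open>Sample and query complexity\<close>

text \<open>For \<open>x = 2 ^ i\<close>, a negative power of \<open>x\<close> is at most 1, and a
  positive one is largest at the finest scale \<open>32 / \<epsilon>\<close>; one bound thus covers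
  all levels.\<close>

lemma powr_scale_bound:
  fixes d :: nat
  assumes \<epsilon>: "0 < \<epsilon>" "\<epsilon> \<le> 1" and x: "1 \<le> x" "x \<le> 32 / \<epsilon>"
    and s: "s \<le> real d" and R: "e + max 0 s \<le> R"
  shows "\<epsilon> powr (- e) * x powr s \<le> 32 ^ d * \<epsilon> powr (- R)"
proof -
  let ?u = "max 0 s"
  have "x powr s \<le> x powr ?u" using x by (intro powr_mono) auto
  also have "\<dots> \<le> (32 / \<epsilon>) powr ?u" using x by (intro powr_mono2) auto
  also have "\<dots> = 32 powr ?u * \<epsilon> powr (- ?u)" using \<epsilon> by (simp add: powr_divide powr_minus_divide)
  also have "32 powr ?u \<le> 32 powr real d" using s by (intro powr_mono) auto
  finally have "x powr s \<le> 32 ^ d * \<epsilon> powr (- ?u)" by (simp add: powr_realpow mult_right_mono)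
  hence "\<epsilon> powr (- e) * x powr s \<le> \<epsilon> powr (- e) * (32 ^ d * \<epsilon> powr (- ?u))"
    by (intro mult_left_mono) auto
  also have "\<dots> = 32 ^ d * \<epsilon> powr (- e + - ?u)" by (simp only: powr_add mult_ac)
  also have "\<epsilon> powr (- e + - ?u) \<le> \<epsilon> powr (- R)"
    using \<epsilon> R by (intro powr_mono') auto
  finally show ?thesis by simp
qed

text \<open>With \<open>x = 2 ^ i\<close>, the terms are
  \<open>\<epsilon> powr (-2) * x powr (d/2 - 2)\<close> and
  \<open>\<epsilon> powr (-4/3) * x powr (2*d/3 - 4/3)\<close> up to powers of \<open>L\<close>. At
  the extreme scales their exponents of \<open>1 / \<epsilon>\<close> are \<open>max 2 (d/2)\<close>
  and \<open>max (4/3) (2*d/3)\<close>, both at most \<open>max 2 (2*d/3)\<close>.\<close>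

lemma level_sample_bound:
  fixes d L i :: nat and \<epsilon> :: real
  assumes \<epsilon>: "0 < \<epsilon>" "\<epsilon> \<le> 1" and d: "1 \<le> d" and L: "2 ^ L \<le> 32 / \<epsilon>" and i: "i \<in> {1..L}"
  defines "\<eta> \<equiv> \<epsilon> * 2 ^ i / (4 * real L)" and "N \<equiv> real (2 ^ (i * d))"
    and "U \<equiv> 32 ^ d * \<epsilon> powr (- max 2 (2 * real d / 3))"
  shows "sqrt N / \<eta>\<^sup>2 + N powr (2/3) * \<eta> powr (-4/3) \<le> 32 * (real L)\<^sup>2 * U"
proof -
  define x :: real where "x = 2 ^ i"
  have L1: "1 \<le> real L" using i by auto
  have "x \<le> 2 ^ L" unfolding x_def using i by (intro power_increasing) auto
  with L have x: "1 \<le> x" "x \<le> 32 / \<epsilon>" by (simp add: x_def, linarith)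
  have x0: "0 < x" using x by simp
  have N: "N = x powr real d" using x0 by (simp add: N_def x_def power_mult powr_realpow)
  have \<eta>: "\<eta> = \<epsilon> * x / (4 * real L)" by (simp add: \<eta>_def x_def)
  have U0: "0 \<le> U" by (simp add: U_def)
  have "sqrt N / \<eta>\<^sup>2 = x powr (real d / 2) / (\<epsilon> powr 2 * x powr 2) * (16 * (real L)\<^sup>2)"
    using x0 \<epsilon> L1 by (simp add: N \<eta> powr_half_sqrt[symmetric] powr_powr power_divide power_mult_distrib
        powr_numeral field_simps)
  also have "x powr (real d / 2) / (\<epsilon> powr 2 * x powr 2) = \<epsilon> powr (- 2) * x powr (real d / 2 - 2)"
    by (simp only: powr_diff powr_minus_divide) simp
  also have "\<dots> \<le> U" unfolding U_def by (rule powr_scale_bound[OF \<epsilon> x]) (auto simp: max_def)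
  finally have 1: "sqrt N / \<eta>\<^sup>2 \<le> 16 * (real L)\<^sup>2 * U"
    by (simp add: mult_right_mono mult.commute)
  have "N powr (2/3) * \<eta> powr (-4/3)
      = (\<epsilon> powr (-(4/3)) * x powr (2 * real d / 3 - 4 / 3)) * (4 * real L) powr (4/3)"
  proof -
    have "N powr (2/3) = x powr (2 * real d / 3)" by (simp add: N powr_powr mult.commute)
    moreover have "\<eta> powr (-4/3) = \<epsilon> powr (-(4/3)) * x powr (-(4/3)) * (4 * real L) powr (4/3)"
      using x0 \<epsilon> L1 by (simp add: \<eta> powr_divide powr_mult powr_minus_divide)
    moreover have "x powr (2 * real d / 3) * x powr (-(4/3)) = x powr (2 * real d / 3 - 4 / 3)"
      by (simp flip: powr_add)
    ultimately show ?thesis by (simp add: mult_ac)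
  qed
  also have "\<dots> \<le> U * (4 * real L) powr 2"
  proof (rule mult_mono)
    show "\<epsilon> powr (-(4/3)) * x powr (2 * real d / 3 - 4 / 3) \<le> U"
      unfolding U_def by (rule powr_scale_bound[OF \<epsilon> x]) (auto simp: max_def)
    show "(4 * real L) powr (4/3) \<le> (4 * real L) powr 2" using L1 by (intro powr_mono) auto
  qed (use U0 in auto)
  also have "\<dots> = 16 * (real L)\<^sup>2 * U" using L1 by (simp add: powr_numeral power_mult_distrib)
  finally show ?thesis using 1 by simp
qed

text \<open>The depth \<open>L\<close> is the least natural number with
  \<open>16 / \<epsilon> \<le> 2 ^ L\<close>. The fifth power of the logarithm consists of
  \<open>L^2\<close> from the gap per level, \<open>L^2\<close> from the failure probability per
  level and \<open>L\<close> from the number of levels.\<close>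

lemma emd_tester_parameters:
  fixes d :: nat and \<epsilon> :: real
  assumes \<epsilon>: "0 < \<epsilon>" "\<epsilon> \<le> 1" and d: "1 \<le> d"
  obtains L :: nat and k m :: "nat \<Rightarrow> nat" and s :: real where
    "0 < L" "16 / \<epsilon> \<le> 2 ^ L" "\<forall>i\<in>{1..L}. 0 < m i"
    "\<forall>i\<in>{1..L}. 100 * sqrt (4 / (1 / (48 * real L) * (real (k i) + 1)))
      \<le> real (m i) * (1 / (48 * real L))
        * ((\<epsilon> * 2 ^ i / (4 * real L))\<^sup>2 / (real (2 ^ (i * d)) + 2 * real (k i)))"
    "\<forall>i\<in>{1..L}. 2 * (real (k i) + 2 * real (m i)) \<le> s" "0 \<le> s"
    "4 * real (hit_samples \<epsilon>) + real L * s \<le> sample_bound 5 (3 * 10^8 * 7776) 5 d \<epsilon>"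
proof -
  define L where "L = nat \<lceil>log 2 (16 / \<epsilon>)\<rceil>"
  have log16: "log 2 (16 / \<epsilon>) = 4 + log 2 (1 / \<epsilon>)"
  proof -
    have "log 2 (16 :: real) = 4" using log_pow_cancel[of 2 4] by simp
    moreover have "log 2 (16 / \<epsilon>) = log 2 16 + log 2 (1 / \<epsilon>)"
      using \<epsilon> log_mult_pos[of 16 "1 / \<epsilon>" 2] by simp
    ultimately show ?thesis by simp
  qed
  have log0: "0 \<le> log 2 (1 / \<epsilon>)" using \<epsilon> by (intro zero_le_log_cancel_iff[THEN iffD2]) auto
  have L1: "log 2 (16 / \<epsilon>) \<le> real L" "real L \<le> log 2 (16 / \<epsilon>) + 1" 
    using log16 log0 unfolding L_def by linarith+
  have L0: "0 < L" using L1 log16 log0 by (cases L) auto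
  have "2 powr (log 2 (16 / \<epsilon>)) \<le> 2 powr real L" using L1 by (intro powr_mono) auto
  hence L2: "16 / \<epsilon> \<le> 2 ^ L" using \<epsilon> by (simp add: powr_realpow)
  have "2 powr real L \<le> 2 powr (log 2 (16 / \<epsilon>) + 1)" using L1 by (intro powr_mono) auto
  hence L3: "2 ^ L \<le> 32 / \<epsilon>" using \<epsilon> by (simp add: powr_add powr_realpow)
  define l where "l = log 2 (2 + 1 / \<epsilon>)"
  have l1: "1 \<le> l" unfolding l_def using \<epsilon> by (subst le_log_iff) (auto intro: add_pos_pos)
  have "log 2 (1 / \<epsilon>) \<le> l" unfolding l_def using \<epsilon> by (subst log_le_cancel_iff) (auto intro: add_pos_pos)
  hence Ll: "real L \<le> 6 * l" using L1 log16 l1 by linarith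
  define U where "U = 32 ^ d * \<epsilon> powr (- max 2 (2 * real d / 3))"
  have inv: "1 / \<epsilon> \<le> U"
  proof -
    have "1 / \<epsilon> = 1 * \<epsilon> powr (- 1)" using \<epsilon> by (simp add: powr_minus_divide)
    also have "\<dots> \<le> 32 ^ d * \<epsilon> powr (- max 2 (2 * real d / 3))"
      using \<epsilon> by (intro mult_mono powr_mono') auto
    finally show ?thesis by (simp add: U_def)
  qed
  have U1: "1 \<le> U" by (rule order_trans[OF _ inv]) (use \<epsilon> in auto)
  have L1': "1 \<le> real L" using L0 by simp
  have \<delta>: "0 < 1 / (48 * real L)" "1 / (48 * real L) \<le> 1" using L0 by auto
  define s where "s = 2 * (10 ^ 8 * (real L)^4 * U)"
  have "\<exists>k m :: nat. 0 < m \<and> 100 * sqrt (4 / (1 / (48 * real L) * (real k + 1)))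
      \<le> real m * (1 / (48 * real L))
        * ((\<epsilon> * 2 ^ i / (4 * real L))\<^sup>2 / (real (2 ^ (i * d)) + 2 * real k))
      \<and> 2 * (real k + 2 * real m) \<le> s" if i: "i \<in> {1..L}" for i
  proof -
    let ?N = "2 ^ (i * d) :: nat" and ?\<eta> = "\<epsilon> * 2 ^ i / (4 * real L)"
    have "0 < ?N" "0 < ?\<eta>" using \<epsilon> L0 by auto
    from l1_test_parameters[OF this \<delta>] obtain k m where km: "0 < m"
      "100 * sqrt (4 / (1 / (48 * real L) * (real k + 1))) \<le> real m * (1 / (48 * real L))
        * (?\<eta>\<^sup>2 / (real ?N + 2 * real k))"
      "real k + 2 * real m \<le> 3 + 1201 * (sqrt (real ?N) / ?\<eta>\<^sup>2
        + real ?N powr (2/3) * ?\<eta> powr (-4/3)) / (1 / (48 * real L))\<^sup>2" by blast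
    let ?M = "sqrt (real ?N) / ?\<eta>\<^sup>2 + real ?N powr (2/3) * ?\<eta> powr (-4/3)"
    have M: "?M \<le> 32 * (real L)\<^sup>2 * U"
      unfolding U_def by (rule level_sample_bound[OF \<epsilon> d L3 i])
    \<comment> \<open>The factor 2304 is \<open>48^2\<close>, from
      \<open>\<delta> = 1 / (48 * L)\<close>.\<close>
    have "real k + 2 * real m \<le> 3 + 1201 * ?M * (2304 * (real L)\<^sup>2)"
      using km(3) by (simp add: power_divide power_mult_distrib)
    also have "\<dots> \<le> 3 + 1201 * (32 * (real L)\<^sup>2 * U) * (2304 * (real L)\<^sup>2)"
      using M by (intro add_left_mono mult_right_mono mult_left_mono) auto
    also have "\<dots> = 3 + 88547328 * ((real L)^4 * U)"
      by (simp add: power4_eq_xxxx power2_eq_square)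
    also have "\<dots> \<le> 10 ^ 8 * (real L)^4 * U"
    proof -
      have "1 * 1 \<le> (real L)^4 * U" using U1 L1' by (intro mult_mono one_le_power) auto
      moreover have "10 ^ 8 * (real L)^4 * U = 100000000 * ((real L)^4 * U)" by simp
      ultimately show ?thesis by linarith
    qed
    finally have "2 * (real k + 2 * real m) \<le> s" by (simp add: s_def)
    with km show ?thesis by blast
  qed
  then obtain k m :: "nat \<Rightarrow> nat" where km: "\<forall>i\<in>{1..L}. 0 < m i"
    "\<forall>i\<in>{1..L}. 100 * sqrt (4 / (1 / (48 * real L) * (real (k i) + 1)))
      \<le> real (m i) * (1 / (48 * real L))
        * ((\<epsilon> * 2 ^ i / (4 * real L))\<^sup>2 / (real (2 ^ (i * d)) + 2 * real (k i)))"
    "\<forall>i\<in>{1..L}. 2 * (real (k i) + 2 * real (m i)) \<le> s" by metis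
  have s0: "0 \<le> s" using U1 by (simp add: s_def)
  have "4 * real (hit_samples \<epsilon>) \<le> 4 * (6144 / \<epsilon> + 1)" using hit_samples_bounds(2)[OF \<epsilon>(1)] by simp
  also have "\<dots> \<le> 24580 * U" using inv U1 by simp
  also have "\<dots> \<le> 24580 * ((real L)^5 * U)"
    using U1 L1' by (simp add: one_le_power mult_le_cancel_right1)
  finally have "4 * real (hit_samples \<epsilon>) + real L * s
      \<le> 24580 * ((real L)^5 * U) + 2 * 10^8 * ((real L)^5 * U)"
    by (simp add: s_def eval_nat_numeral algebra_simps)
  also have "\<dots> \<le> 3 * 10^8 * ((real L)^5 * U)"
    using U1 by simp
  \<comment> \<open>The estimate \<open>L \<le> 6 * l\<close> produces the factor
    \<open>6^5 = 7776\<close> of the constant.\<close>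
  also have "\<dots> \<le> 3 * 10^8 * ((6 * l)^5 * U)"
    using Ll U1 by (intro mult_left_mono mult_right_mono power_mono) auto
  also have "\<dots> = sample_bound 5 (3 * 10^8 * 7776) 5 d \<epsilon>"
  proof -
    have "2 powr (5 * real d) = (2 powr 5) powr real d" by (simp only: powr_powr)
    also have "\<dots> = 32 ^ d" by (simp add: powr_realpow)
    finally show ?thesis by (simp add: sample_bound_def U_def l_def power_mult_distrib)
  qed
  finally show thesis using that[OF L0 L2 km s0] by simp
qed

text \<open>Two gates query one shell per counted sample, and \<open>2 * r + 1\<close> is at most
  \<open>\<epsilon> * max n (1 / \<epsilon>)\<close>: through \<open>\<epsilon> * n\<close> if
  \<open>r \<ge> 1\<close>, and through the second argument of the maximum if
  \<open>r = 0\<close>.\<close>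

lemma query_count_bound:
  fixes d n :: nat and \<epsilon> :: real
  assumes \<epsilon>: "0 < \<epsilon>" "\<epsilon> \<le> 1" and d: "1 \<le> d" and n: "1 \<le> n"
  shows "2 * (real (hit_samples \<epsilon>) * real (2 * d * (2 * nat \<lfloor>\<epsilon> * real n / 8\<rfloor> + 1) ^ (d - 1)))
    \<le> query_bound 24580 (max (real n) (1 / \<epsilon>)) d \<epsilon>"
proof -
  let ?r = "nat \<lfloor>\<epsilon> * real n / 8\<rfloor>" and ?n = "max (real n) (1 / \<epsilon>)"
  have en: "1 \<le> \<epsilon> * ?n" "\<epsilon> * real n \<le> \<epsilon> * ?n"
  proof -
    have "\<epsilon> * (1 / \<epsilon>) \<le> \<epsilon> * ?n" using \<epsilon> by (intro mult_left_mono) auto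
    thus "1 \<le> \<epsilon> * ?n" using \<epsilon> by simp
    show "\<epsilon> * real n \<le> \<epsilon> * ?n" using \<epsilon> by (intro mult_left_mono) auto
  qed
  have r: "real (2 * ?r + 1) \<le> \<epsilon> * ?n"
  proof (cases "?r = 0")
    case False
    have "real ?r \<le> \<epsilon> * real n / 8" using \<epsilon> by (intro of_nat_floor) simp
    moreover have "1 \<le> real ?r" using False by linarith
    ultimately have "real (2 * ?r + 1) \<le> \<epsilon> * real n" by simp
    with en show ?thesis by linarith
  qed (use en in simp)
  have t: "real (hit_samples \<epsilon>) \<le> 6145 / \<epsilon>"
  proof -
    have "real (hit_samples \<epsilon>) \<le> 6144 / \<epsilon> + 1" by (rule hit_samples_bounds(2)[OF \<epsilon>(1)])
    also have "1 \<le> 1 / \<epsilon>" using \<epsilon> by simp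
    finally show ?thesis by (simp add: add_divide_distrib[symmetric])
  qed
  have pw: "real (2 * ?r + 1) ^ (d - 1) \<le> (\<epsilon> * ?n) ^ (d - 1)"
    using r by (intro power_mono) auto
  have "2 * (real (hit_samples \<epsilon>) * real (2 * d * (2 * ?r + 1) ^ (d - 1)))
    = 2 * (real (hit_samples \<epsilon>) * (2 * real d * real (2 * ?r + 1) ^ (d - 1)))"
    by (simp only: of_nat_mult of_nat_power of_nat_numeral)
  also have "\<dots> \<le> 2 * (6145 / \<epsilon> * (2 * real d * (\<epsilon> * ?n) ^ (d - 1)))"
    using t pw \<epsilon> by (intro mult_left_mono mult_mono) auto
  also have "\<dots> = 24580 * (real d * (\<epsilon> ^ (d - 1) / \<epsilon>) * ?n ^ (d - 1))"
    by (simp add: power_mult_distrib)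
  also have "\<epsilon> ^ (d - 1) / \<epsilon> = \<epsilon> powr (real d - 2)"
  proof -
    have "\<epsilon> ^ (d - 1) = \<epsilon> powr (real d - 1)" using \<epsilon> d by (simp add: powr_realpow[symmetric] of_nat_diff)
    hence "\<epsilon> ^ (d - 1) / \<epsilon> = \<epsilon> powr (real d - 1) / \<epsilon> powr 1" using \<epsilon> by simp
    also have "\<dots> = \<epsilon> powr (real d - 1 - 1)" by (simp only: powr_diff)
    finally show ?thesis by simp
  qed
  finally show ?thesis by (simp add: query_bound_def)
qed

section \<open>Combining the bounds into both testers\<close>

lemma sample_bound_nonneg: "0 \<le> b \<Longrightarrow> 0 < \<epsilon> \<Longrightarrow> 0 \<le> sample_bound a b k d \<epsilon>"
  unfolding sample_bound_def
  by (intro mult_nonneg_nonneg zero_le_power) (auto simp: zero_le_log_cancel_iff add_pos_pos)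

lemma query_bound_nonneg: "0 \<le> C \<Longrightarrow> 0 \<le> n \<Longrightarrow> 0 \<le> query_bound C n d \<epsilon>"
  by (simp add: query_bound_def)

text \<open>With \<open>1 / \<epsilon>\<close> in place of \<open>n\<close>, the query bound is of
  order \<open>d / \<epsilon>\<close>, which the sample bound dominates. The query budget for
  identity testing contains the sample bound and can therefore be stated with \<open>n\<close>
  itself.\<close>

lemma query_bound_max_le:
  fixes d n :: nat and \<epsilon> :: real
  assumes \<epsilon>: "0 < \<epsilon>" "\<epsilon> \<le> 1" and d: "1 \<le> d" and b: "1 \<le> b" and C: "0 \<le> C"
  shows "query_bound C (max (real n) (1 / \<epsilon>)) d \<epsilon>
    \<le> query_bound C (real n) d \<epsilon> + C * sample_bound 5 b k d \<epsilon>"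
proof -
  have "max (real n) (1 / \<epsilon>) ^ (d - 1) \<le> real n ^ (d - 1) + (1 / \<epsilon>) ^ (d - 1)"
    using \<epsilon> by (auto simp: max_def)
  hence "query_bound C (max (real n) (1 / \<epsilon>)) d \<epsilon>
      \<le> C * (real d * \<epsilon> powr (real d - 2) * (real n ^ (d - 1) + (1 / \<epsilon>) ^ (d - 1)))"
    unfolding query_bound_def using C by (intro mult_left_mono) auto
  also have "\<dots> = query_bound C (real n) d \<epsilon> + C * (real d * (\<epsilon> powr (real d - 2) * (1 / \<epsilon>) ^ (d - 1)))"
    by (simp add: query_bound_def algebra_simps)
  also have "\<epsilon> powr (real d - 2) * (1 / \<epsilon>) ^ (d - 1) = \<epsilon> powr (- 1)"
  proof -
    have "(1 / \<epsilon>) ^ (d - 1) = 1 / \<epsilon> powr (real d - 1)"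
      using \<epsilon> d by (simp add: power_one_over powr_realpow[symmetric] of_nat_diff)
    also have "\<dots> = \<epsilon> powr (- (real d - 1))" by (simp only: powr_minus_divide)
    finally have "(1 / \<epsilon>) ^ (d - 1) = \<epsilon> powr (- (real d - 1))" .
    thus ?thesis by (simp flip: powr_add)
  qed
  also have "real d * \<epsilon> powr (- 1) \<le> sample_bound 5 b k d \<epsilon>"
  proof -
    have d32: "real d \<le> 2 powr (5 * real d)"
    proof -
      have "real d \<le> 2 ^ d" using of_nat_less_two_power[of d, where 'a = real] by simp
      also have "\<dots> = 2 powr real d" by (simp add: powr_realpow)
      also have "\<dots> \<le> 2 powr (5 * real d)" by (intro powr_mono) auto
      finally show ?thesis .
    qed
    have e1: "\<epsilon> powr (- 1) \<le> \<epsilon> powr (- max 2 (2 * real d / 3))"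
      using \<epsilon> by (intro powr_mono') auto
    have l1: "1 \<le> log 2 (2 + 1 / \<epsilon>) ^ k"
      using \<epsilon> by (intro one_le_power) (subst le_log_iff, auto intro: add_pos_pos)
    have "1 * \<epsilon> powr (- 1) * 1 \<le> b * \<epsilon> powr (- max 2 (2 * real d / 3)) * log 2 (2 + 1 / \<epsilon>) ^ k"
      using e1 l1 b by (intro mult_mono) auto
    thus ?thesis unfolding sample_bound_def using d32 by (intro mult_mono) auto
  qed
  finally show ?thesis using C by (simp add: mult_left_mono)
qed

lemma prob_verdicts:
  "prb q {Accept, Cluster_Reject} = 1 - prb q {Reject}"
  "prb q {Reject, Cluster_Reject} = 1 - prb q {Accept}"
proof -
  have "{Accept, Cluster_Reject} = UNIV - {Reject}" "{Reject, Cluster_Reject} = UNIV - {Accept}"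
    by (auto intro: verdict.exhaust)
  thus "prb q {Accept, Cluster_Reject} = 1 - prb q {Reject}"
    "prb q {Reject, Cluster_Reject} = 1 - prb q {Accept}"
    using measure_pmf.prob_compl[of _ q] by simp_all
qed

lemma testers_exist:
  fixes n d :: nat and p \<epsilon> \<Delta> :: real
  assumes p: "1 \<le> p" "1 \<le> d" "1 \<le> n" and \<epsilon>: "0 < \<epsilon>"
    and \<Delta>: "\<Delta> \<le> 1 / (8 * real d powr (1 / p)) * \<epsilon>"
  defines "M \<equiv> sample_bound 5 (3 * 10^8 * 7776) 5 d \<epsilon>"
  shows "\<exists>T. equivalence_tester (grid n d) (lp_dist p n d) (CONN n d) (CONN n d) \<Delta> \<epsilon> T \<and>
      within_budget (grid n d) T M (query_bound 24580 (max (real n) (1 / \<epsilon>)) d \<epsilon>)"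
    and "set_pmf \<nu> \<subseteq> grid n d \<Longrightarrow>
      \<exists>T. identity_tester (grid n d) (lp_dist p n d) (CONN n d) (CONN n d) \<Delta> \<epsilon> \<nu> T \<and>
      within_budget (grid n d) T M (24581 * (M + query_bound 24580 (real n) d \<epsilon>))"
proof -
  have M0: "0 \<le> M" unfolding M_def using \<epsilon> by (intro sample_bound_nonneg) auto
  have Q0: "0 \<le> query_bound 24580 (real n) d \<epsilon>" "0 \<le> query_bound 24580 (max (real n) (1 / \<epsilon>)) d \<epsilon>"
    by (intro query_bound_nonneg; simp)+
  have "(\<exists>T. equivalence_tester (grid n d) (lp_dist p n d) (CONN n d) (CONN n d) \<Delta> \<epsilon> T \<and>
      within_budget (grid n d) T M (query_bound 24580 (max (real n) (1 / \<epsilon>)) d \<epsilon>)) \<and>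
    (\<forall>\<nu>. set_pmf \<nu> \<subseteq> grid n d \<longrightarrow>
      (\<exists>T. identity_tester (grid n d) (lp_dist p n d) (CONN n d) (CONN n d) \<Delta> \<epsilon> \<nu> T \<and>
      within_budget (grid n d) T M (24581 * (M + query_bound 24580 (real n) d \<epsilon>))))"
  proof (cases "\<epsilon> \<le> 1")
    case False
    \<comment> \<open>For \<open>\<epsilon> > 1\<close> no two distributions on the grid are far
      apart, so constant acceptance is correct.\<close>
    have no: "\<not> EMD (lp_dist p n d) \<mu> \<nu> > \<epsilon>"
      if "set_pmf \<mu> \<subseteq> grid n d" "set_pmf \<nu> \<subseteq> grid n d" for \<mu> \<nu>
      using EMD_le_1[OF p that] False by simp
    have equiv: "equivalence_tester (grid n d) (lp_dist p n d) (CONN n d) (CONN n d) \<Delta> \<epsilon> (Output Accept)"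
      unfolding equivalence_tester_def Let_def using no by auto
    have ident: "identity_tester (grid n d) (lp_dist p n d) (CONN n d) (CONN n d) \<Delta> \<epsilon> \<nu> (Output Accept)"
      if "set_pmf \<nu> \<subseteq> grid n d" for \<nu>
      unfolding identity_tester_def Let_def using no that by auto
    show ?thesis
      by (intro conjI allI impI exI[of _ "Output Accept"] equiv ident) (simp_all add: M0 Q0)
  next
    case True
    obtain L :: nat and k m :: "nat \<Rightarrow> nat" and s :: real where par:
      "0 < L" "16 / \<epsilon> \<le> 2 ^ L" "\<forall>i\<in>{1..L}. 0 < m i"
      "\<forall>i\<in>{1..L}. 100 * sqrt (4 / (1 / (48 * real L) * (real (k i) + 1)))
        \<le> real (m i) * (1 / (48 * real L))
          * ((\<epsilon> * 2 ^ i / (4 * real L))\<^sup>2 / (real (2 ^ (i * d)) + 2 * real (k i)))"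
      and s: "\<forall>i\<in>{1..L}. 2 * (real (k i) + 2 * real (m i)) \<le> s" "0 \<le> s"
      "4 * real (hit_samples \<epsilon>) + real L * s \<le> M"
      by (rule emd_tester_parameters[OF \<epsilon> True p(2), folded M_def])
    have budget: "within_budget (grid n d) (emd_tester n d \<epsilon> v L k m) M
        (query_bound 24580 (max (real n) (1 / \<epsilon>)) d \<epsilon>)" for v
      using s by (intro within_budget_emd_tester[OF \<epsilon>] query_count_bound[OF \<epsilon> True p(2,3)])
    let ?run = "\<lambda>K \<mu> \<nu> v. run K (\<lambda>i. if i then \<mu> else \<nu>) (emd_tester n d \<epsilon> v L k m)"
    have sets: "set_pmf (if b then \<mu> else \<nu>) \<subseteq> grid n d"
      if "set_pmf \<mu> \<subseteq> grid n d" "set_pmf \<nu> \<subseteq> grid n d" for b :: bool and \<mu> \<nu> using that by simp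
    note correct = emd_tester_correct[where D = "\<lambda>i. if i then \<mu> else \<nu>" for \<mu> \<nu>, OF p \<epsilon> _ sets par, unfolded if_True if_False]
    have few: "prb (map_pmf (label K) \<mu>) {y. bad_label n d (nat \<lfloor>\<epsilon> * real n / 8\<rfloor>) K y} \<le> \<epsilon> / 256"
      if "K \<in> CONN n d" "set_pmf \<mu> \<subseteq> grid n d" "small_diam (lp_dist p n d) \<Delta> \<epsilon> K \<mu>" for K \<mu>
      using that by (intro small_diam_few_bad[OF _ _ p \<epsilon> \<Delta>]) (auto simp: CONN_def)
    have "equivalence_tester (grid n d) (lp_dist p n d) (CONN n d) (CONN n d) \<Delta> \<epsilon>
        (emd_tester n d \<epsilon> Cluster_Reject L k m)"
      unfolding equivalence_tester_def Let_def prob_verdicts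
    proof (intro ballI allI impI conjI; (elim conjE)?)
      fix K \<mu> \<nu> assume K: "K \<in> CONN n d" and \<mu>: "set_pmf \<mu> \<subseteq> grid n d" and \<nu>: "set_pmf \<nu> \<subseteq> grid n d"
      show "prb (?run K \<mu> \<nu> Cluster_Reject) {Cluster_Reject} \<le> 1 / 6"
        if "small_diam (lp_dist p n d) \<Delta> \<epsilon> K \<mu>" "small_diam (lp_dist p n d) \<Delta> \<epsilon> K \<nu>"
        by (rule correct(1)[OF K \<mu> \<nu> few[OF K \<mu> that(1)] few[OF K \<nu> that(2)]])
      show "5 / 6 \<le> 1 - prb (?run K \<mu> \<nu> Cluster_Reject) {Reject}" if "\<mu> = \<nu>"
        using correct(3)[OF K \<mu> \<nu> that, of Cluster_Reject] by simp
      show "5 / 6 \<le> 1 - prb (?run K \<mu> \<nu> Cluster_Reject) {Accept}"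
        if "\<epsilon> < EMD (lp_dist p n d) \<mu> \<nu>"
        using correct(4)[OF K \<mu> \<nu> _ that, of Cluster_Reject] by simp
    qed
    moreover have "identity_tester (grid n d) (lp_dist p n d) (CONN n d) (CONN n d) \<Delta> \<epsilon> \<nu>
        (simulate \<nu> (emd_tester n d \<epsilon> Reject L k m))" if \<nu>: "set_pmf \<nu> \<subseteq> grid n d" for \<nu>
      unfolding identity_tester_def Let_def prob_verdicts run_simulate
    proof (intro ballI allI impI conjI; (elim conjE)?)
      fix K \<mu> assume K: "K \<in> CONN n d" and \<mu>: "set_pmf \<mu> \<subseteq> grid n d"
      show "prb (?run K \<mu> \<nu> Reject) {Cluster_Reject} \<le> 1 / 6"
        if "small_diam (lp_dist p n d) \<Delta> \<epsilon> K \<mu>"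
        by (rule correct(2)[OF K \<mu> \<nu> few[OF K \<mu> that]])
      show "5 / 6 \<le> 1 - prb (?run K \<mu> \<nu> Reject) {Reject}" if "\<mu> = \<nu>"
        using correct(3)[OF K \<mu> \<nu> that, of Reject] by simp
      show "5 / 6 \<le> 1 - prb (?run K \<mu> \<nu> Reject) {Accept}"
        if "\<epsilon> < EMD (lp_dist p n d) \<mu> \<nu>"
        using correct(4)[OF K \<mu> \<nu> _ that, of Reject] by simp
    qed
    moreover have "within_budget (grid n d) (simulate \<nu> (emd_tester n d \<epsilon> Reject L k m)) M
        (24581 * (M + query_bound 24580 (real n) d \<epsilon>))" if \<nu>: "set_pmf \<nu> \<subseteq> grid n d" for \<nu>
    proof (rule within_budget_mono[OF within_budget_simulate[OF \<nu> budget] order.refl])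
      \<comment> \<open>The factor 24581 covers 24580 sample bounds, from replacing
        \<open>max n (1 / \<epsilon>)\<close> by \<open>n\<close>, and one more for the simulated
        samples.\<close>
      show "query_bound 24580 (max (real n) (1 / \<epsilon>)) d \<epsilon> + M
          \<le> 24581 * (M + query_bound 24580 (real n) d \<epsilon>)"
        using query_bound_max_le[OF \<epsilon> True p(2), of "3 * 10^8 * 7776" 24580 n 5] Q0(1)
        unfolding M_def[symmetric] by simp
    qed
    ultimately show ?thesis using budget by blast
  qed
  thus "\<exists>T. equivalence_tester (grid n d) (lp_dist p n d) (CONN n d) (CONN n d) \<Delta> \<epsilon> T \<and>
      within_budget (grid n d) T M (query_bound 24580 (max (real n) (1 / \<epsilon>)) d \<epsilon>)"
    and "set_pmf \<nu> \<subseteq> grid n d \<Longrightarrow>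
      \<exists>T. identity_tester (grid n d) (lp_dist p n d) (CONN n d) (CONN n d) \<Delta> \<epsilon> \<nu> T \<and>
      within_budget (grid n d) T M (24581 * (M + query_bound 24580 (real n) d \<epsilon>))" by blast+
qed

theorem theorem3p12:
  shows "\<exists>(a::real) (b::real) (k::nat) (C::real) (C\<^sub>1::real) (C\<^sub>2::real).
    a > 0 \<and> b > 0 \<and> C > 0 \<and> C\<^sub>1 > 0 \<and> C\<^sub>2 > 0 \<and>
    (\<forall>(n::nat) (d::nat) (p::real) (\<epsilon>::real) (\<Delta>::real).
      n \<ge> 1 \<and> d \<ge> 1 \<and> p \<ge> 1 \<and> \<epsilon> > 0 \<and> \<Delta> > 0 \<and> \<Delta> \<le> 1 / (8 * real d powr (1 / p)) * \<epsilon> \<longrightarrow>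
      (\<exists>T. equivalence_tester (grid n d) (lp_dist p n d) (CONN n d) (CONN n d) \<Delta> \<epsilon> T \<and>
           within_budget (grid n d) T
             (sample_bound a b k d \<epsilon>)
             (query_bound C (max (real n) (1 / \<epsilon>)) d \<epsilon>)) \<and>
      (\<forall>\<nu>. set_pmf \<nu> \<subseteq> grid n d \<longrightarrow>
        (\<exists>T. identity_tester (grid n d) (lp_dist p n d) (CONN n d) (CONN n d) \<Delta> \<epsilon> \<nu> T \<and>
             within_budget (grid n d) T
               (C\<^sub>1 * sample_bound a b k d \<epsilon>)
               (C\<^sub>2 * (sample_bound a b k d \<epsilon> + query_bound C (real n) d \<epsilon>)))))"
\<comment> \<open>The exponent 5 stands for \<open>32 ^ d = 2 powr (5 * d)\<close>, and
  \<open>C\<^sub>1\<close> is 1 because simulation adds no sample calls.\<close>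
proof (rule exI[of _ 5], rule exI[of _ "3 * 10^8 * 7776"], rule exI[of _ 5], rule exI[of _ 24580],
    rule exI[of _ 1], rule exI[of _ 24581], intro conjI allI impI)
  fix n d :: nat and p \<epsilon> \<Delta> :: real
  assume "n \<ge> 1 \<and> d \<ge> 1 \<and> p \<ge> 1 \<and> \<epsilon> > 0 \<and> \<Delta> > 0 \<and> \<Delta> \<le> 1 / (8 * real d powr (1 / p)) * \<epsilon>"
  hence as: "1 \<le> p" "1 \<le> d" "1 \<le> n" "0 < \<epsilon>" "\<Delta> \<le> 1 / (8 * real d powr (1 / p)) * \<epsilon>" by auto
  show "\<exists>T. equivalence_tester (grid n d) (lp_dist p n d) (CONN n d) (CONN n d) \<Delta> \<epsilon> T \<and>
           within_budget (grid n d) T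
             (sample_bound 5 (3 * 10^8 * 7776) 5 d \<epsilon>)
             (query_bound 24580 (max (real n) (1 / \<epsilon>)) d \<epsilon>)"
    by (rule testers_exist(1)[OF as])
  show "\<exists>T. identity_tester (grid n d) (lp_dist p n d) (CONN n d) (CONN n d) \<Delta> \<epsilon> \<nu> T \<and>
             within_budget (grid n d) T
               (1 * sample_bound 5 (3 * 10^8 * 7776) 5 d \<epsilon>)
               (24581 * (sample_bound 5 (3 * 10^8 * 7776) 5 d \<epsilon> + query_bound 24580 (real n) d \<epsilon>))"
    if "set_pmf \<nu> \<subseteq> grid n d" for \<nu>
    using testers_exist(2)[OF as that] by simp
qed simp_all

end
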